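(* Let $\mathbf{k}$ be a field, $V$ a finite-dimensional $\mathbf{k}$-vector space, $d\ge 2$, and $f$ a homogeneous polynomial of degree $d$ on $V$. (i) The subvariety $Z^{\mathrm{sym}}_f\subset V\times V$ contains the singular locus $\mathrm{Sing}(f^{(2,d-2)}=0)$ of the hypersurface $f^{(2,d-2)}(v,x)=0$ in $V\times V$. (ii) One has $$g_{\mathrm{sym}}(f)\le (d+1)\cdot c(f)$$ (resp., $g_{\mathrm{sym}}(f)\le d\cdot c(f)$ if $d$ is odd and $\mathrm{char}(\mathbf{k})\neq 2$). (iii) If $\mathrm{char}(\mathbf{k})$ does not divide $d-1$, then $$c(f)\le g_{\mathrm{sym}}(f).$$
   Context: $f^{(2,d-2)}(v,x)$ is the component of $f(v+x)$ of bidegree $(2,d-2)$ in $(v,x)\in V\times V$. $H_f(x)(u,v)$ denotes the Hessian form of $f$ at $x\in V$, the symmetric bilinear form on $V$ given by the second derivatives of $f$ at $x$; equivalently, it is the component $f^{(1,1,d-2)}(u,v,x)$ of $f(u+v+x)$ of multidegree $(1,1,d-2)$ in $(u,v,x)$. $$Z^{\mathrm{sym}}_f=\{(v,x)\in V\times V\mid v\in\ker H_f(x)\},\qquad g_{\mathrm{sym}}(f)=\mathrm{codim}_{V\times V}Z^{\mathrm{sym}}_f .$$ For a homogeneous polynomial $F$ on a vector space $E$, $\mathrm{Sing}(F=0)\subset E$ denotes the closed locus where all first partial derivatives of $F$ vanish (when $\mathrm{char}(\mathbf{k})\nmid\deg F$ this is the usual singular locus of the hypersurface $F=0$), and $c(F)=\mathrm{codim}_E\mathrm{Sing}(F=0)$;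 in particular $c(f)=\mathrm{codim}_V\mathrm{Sing}(f=0)$. *)

theory Defs
  imports
    "HOL-Library.Poly_Mapping"
    "HOL-Library.Extended_Nat"
    "HOL-Algebra.Algebraic_Closure_Type"
begin

section \<open>Multivariate polynomials\<close>

text \<open>
  A finite-dimensional vector space is written in coordinates as \<open>V = k^I\<close> for a finite
  index set \<open>I\<close>, which may be empty. Polynomials on \<open>V\<close> are the formal polynomials (not the
  polynomial functions) with variables in \<open>I\<close>.
\<close>

type_synonym ('i, 'k) mpoly = "('i \<Rightarrow>\<^sub>0 nat) \<Rightarrow>\<^sub>0 'k"

definition polys_on :: "'i set \<Rightarrow> ('i, 'k::zero) mpoly set" where
  "polys_on I = {p. \<forall>m\<in>Poly_Mapping.keys p. Poly_Mapping.keys m \<subseteq> I}"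

definition degree_in :: "'i set \<Rightarrow> ('i \<Rightarrow>\<^sub>0 nat) \<Rightarrow> nat" where
  "degree_in S m = (\<Sum>i\<in>Poly_Mapping.keys m \<inter> S. Poly_Mapping.lookup m i)"

definition homogeneous :: "nat \<Rightarrow> ('i, 'k::zero) mpoly \<Rightarrow> bool" where
  "homogeneous d p \<longleftrightarrow> (\<forall>m\<in>Poly_Mapping.keys p. degree_in UNIV m = d)"

definition var :: "'i \<Rightarrow> ('i, 'k::comm_ring_1) mpoly" where
  "var i = Poly_Mapping.single (Poly_Mapping.single i 1) 1"

definition const :: "'k \<Rightarrow> ('i, 'k::comm_ring_1) mpoly" where
  "const c = Poly_Mapping.single 0 c"

text \<open>
  Evaluation at \<open>x\<close> after applying \<open>\<phi>\<close>, meant to be a ring homomorphism, to the coefficients.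
  With \<open>\<phi> = const\<close> this is substitution of polynomials for the variables, with \<open>\<phi> = to_ac\<close>
  evaluation at a point with coordinates in the algebraic closure.
\<close>

definition eval_poly :: "('k::comm_ring_1 \<Rightarrow> 'r::comm_ring_1) \<Rightarrow> ('i \<Rightarrow> 'r) \<Rightarrow> ('i, 'k) mpoly \<Rightarrow> 'r" where
  "eval_poly \<phi> x p = (\<Sum>m\<in>Poly_Mapping.keys p. \<phi> (Poly_Mapping.lookup p m) *
     (\<Prod>i\<in>Poly_Mapping.keys m. x i ^ Poly_Mapping.lookup m i))"

text \<open>
  Formal partial derivative. Where the subtraction of exponents truncates, the coefficient is \<open>0\<close>.
\<close>

definition pderiv_in :: "'i \<Rightarrow> ('i, 'k::comm_ring_1) mpoly \<Rightarrow> ('i, 'k) mpoly" where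
  "pderiv_in i p = (\<Sum>m\<in>Poly_Mapping.keys p. Poly_Mapping.single (m - Poly_Mapping.single i 1)
     (of_nat (Poly_Mapping.lookup m i) * Poly_Mapping.lookup p m))"

text \<open>
  On \<open>V \<times> V\<close>, with points \<open>(v, x)\<close>, the coordinates of \<open>v\<close> are indexed by \<open>Inl ` I\<close> and those
  of \<open>x\<close> by \<open>Inr ` I\<close>, so the index set is \<open>I <+> I\<close>.
\<close>

definition bidegree_part :: "nat \<Rightarrow> nat \<Rightarrow> ('i + 'j, 'k::comm_ring_1) mpoly \<Rightarrow> ('i + 'j, 'k) mpoly" where
  "bidegree_part a b p =
     (\<Sum>m\<in>{m\<in>Poly_Mapping.keys p. degree_in (range Inl) m = a \<and> degree_in (range Inr) m = b}.
        Poly_Mapping.single m (Poly_Mapping.lookup p m))"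

text \<open>The component of bidegree \<open>(a, b)\<close> of \<open>f(v + x)\<close>.\<close>

definition polar :: "nat \<Rightarrow> nat \<Rightarrow> ('i, 'k::comm_ring_1) mpoly \<Rightarrow> ('i + 'i, 'k) mpoly" where
  "polar a b f = bidegree_part a b (eval_poly const (\<lambda>i. var (Inl i) + var (Inr i)) f)"


section \<open>Zariski-closed sets and codimension\<close>

text \<open>
  Closed subvarieties are represented by their sets of points over an algebraically closed
  field. Points of \<open>K^I\<close> are functions vanishing outside \<open>I\<close>.
\<close>

definition affine_space :: "'i set \<Rightarrow> ('i \<Rightarrow> 'a::zero) set" where
  "affine_space I = {x. \<forall>i. i \<notin> I \<longrightarrow> x i = 0}"

definition zariski_closed :: "'i set \<Rightarrow> ('i \<Rightarrow> 'a::alg_closed_field) set \<Rightarrow> bool" where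
  "zariski_closed I Z \<longleftrightarrow>
     (\<exists>P\<subseteq>polys_on I. Z = {x\<in>affine_space I. \<forall>p\<in>P. eval_poly id x p = 0})"

definition irreducible_closed :: "'i set \<Rightarrow> ('i \<Rightarrow> 'a::alg_closed_field) set \<Rightarrow> bool" where
  "irreducible_closed I Z \<longleftrightarrow> zariski_closed I Z \<and> Z \<noteq> {} \<and>
     (\<forall>A B. zariski_closed I A \<and> zariski_closed I B \<and> Z = A \<union> B \<longrightarrow> Z = A \<or> Z = B)"

text \<open>
  Codimension in \<open>K^I\<close>: for irreducible \<open>W\<close>, the supremum of the lengths of chains of
  irreducible closed sets starting at \<open>W\<close>; for closed \<open>Z\<close>, the infimum over the irreducible
  closed subsets of \<open>Z\<close> (so the empty set has codimension \<open>\<infinity>\<close>).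
\<close>

definition codim_irreducible :: "'i set \<Rightarrow> ('i \<Rightarrow> 'a::alg_closed_field) set \<Rightarrow> enat" where
  "codim_irreducible I W = Sup {enat r | r. \<exists>C :: nat \<Rightarrow> ('i \<Rightarrow> 'a) set.
     C 0 = W \<and> (\<forall>j\<le>r. irreducible_closed I (C j)) \<and> (\<forall>j<r. C j \<subset> C (Suc j))}"

definition codim :: "'i set \<Rightarrow> ('i \<Rightarrow> 'a::alg_closed_field) set \<Rightarrow> enat" where
  "codim I Z = (INF W\<in>{W. irreducible_closed I W \<and> W \<subseteq> Z}. codim_irreducible I W)"


section \<open>Singular loci and the symmetric Hessian rank\<close>

text \<open>
  The locus where all first partial derivatives vanish. The equation \<open>F = 0\<close> itself is not
  imposed; this matters when the characteristic divides the degree of \<open>F\<close>.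
\<close>

definition Sing :: "'i set \<Rightarrow> ('i, 'k::field) mpoly \<Rightarrow> ('i \<Rightarrow> 'k alg_closure) set" where
  "Sing I F = {x\<in>affine_space I. \<forall>i\<in>I. eval_poly to_ac x (pderiv_in i F) = 0}"

definition codim_Sing :: "'i set \<Rightarrow> ('i, 'k::field) mpoly \<Rightarrow> enat" where
  "codim_Sing I F = codim I (Sing I F)"

definition hessian :: "'i set \<Rightarrow> ('i, 'k::field) mpoly \<Rightarrow> ('i \<Rightarrow> 'k alg_closure) \<Rightarrow>
    ('i \<Rightarrow> 'k alg_closure) \<Rightarrow> ('i \<Rightarrow> 'k alg_closure) \<Rightarrow> 'k alg_closure" where
  "hessian I f x u v =
     (\<Sum>i\<in>I. \<Sum>j\<in>I. eval_poly to_ac x (pderiv_in i (pderiv_in j f)) * u i * v j)"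

definition hessian_ker :: "'i set \<Rightarrow> ('i, 'k::field) mpoly \<Rightarrow> ('i \<Rightarrow> 'k alg_closure) \<Rightarrow>
    ('i \<Rightarrow> 'k alg_closure) set" where
  "hessian_ker I f x = {v\<in>affine_space I. \<forall>u\<in>affine_space I. hessian I f x u v = 0}"

text \<open>The pair \<open>(v, x)\<close> is encoded as \<open>case_sum v x\<close>, a point of the affine space on \<open>I <+> I\<close>.\<close>

definition Z_sym :: "'i set \<Rightarrow> ('i, 'k::field) mpoly \<Rightarrow> ('i + 'i \<Rightarrow> 'k alg_closure) set" where
  "Z_sym I f = {case_sum v x | v x. x \<in> affine_space I \<and> v \<in> hessian_ker I f x}"

definition g_sym :: "'i set \<Rightarrow> ('i, 'k::field) mpoly \<Rightarrow> enat" where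
  "g_sym I f = codim (I <+> I) (Z_sym I f)"

end

theory Submission
  imports Defs "HOL-Library.FuncSet" "Jordan_Normal_Form.Determinant"
begin

text \<open>
  Let \<open>K\<close> be the algebraic closure of the base field, \<open>n = dim V\<close>, \<open>S = Sing(f = 0)\<close> and \<open>Z = Z\<^sup>s\<^sup>y\<^sup>m\<^sub>f\<close>. Both \<open>S\<close> and \<open>Z\<close> are
  closed cones, and three identities relate them. The derivative of \<open>f\<^sup>(\<^sup>2\<^sup>,\<^sup>d\<^sup>-\<^sup>2\<^sup>)\<close> at \<open>(v, x)\<close> in the direction \<open>(u, 0)\<close> is
  \<open>H\<^sub>f(x)(u, v)\<close>, which gives the inclusion. Euler's identity \<open>H\<^sub>f(x)(u, x) = (d - 1) \<partial>\<^sub>u f(x)\<close> shows that \<open>S\<close> is the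
  intersection of \<open>Z\<close> with the diagonal if \<open>d - 1\<close> is invertible. Finally \<open>\<partial>\<^sub>u f(x + t v)\<close> is a polynomial in \<open>t\<close>
  of degree at most \<open>d - 1\<close> with linear coefficient \<open>H\<^sub>f(x)(u, v)\<close>. If \<open>x + t v \<in> S\<close> for \<open>d\<close> distinct values
  of \<open>t\<close>, then this polynomial is zero, and so \<open>(v, x) \<in> Z\<close>. Hence \<open>Z\<close> contains the intersection of \<open>d\<close> cones of
  codimension \<open>c(f)\<close> in \<open>V \<times> V\<close>, which gives \<open>g\<^sub>s\<^sub>y\<^sub>m(f) \<le> d c(f) \<le> (d + 1) c(f)\<close>.

  What remains is the intersection theory. For a closed cone \<open>C\<close>, define \<open>dim C\<close> as the least number of linear
  forms whose common zeros on \<open>C\<close> reduce to \<open>0\<close> (\<open>cone_dim\<close>). With this definition, cutting a cone by a linear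
  subspace of codimension \<open>m\<close> lowers the dimension by at most \<open>m\<close>, for trivial reasons. The bound
  \<open>c(f) \<le> g\<^sub>s\<^sub>y\<^sub>m(f)\<close> follows, because the diagonal has codimension \<open>n\<close> (\<open>cone_dim_Z_sym_le\<close>). For the other bound, the
  \<open>d\<close>-tuples of points \<open>x + t v\<close> form a linear subspace of \<open>V\<^sup>d\<close> of codimension \<open>(d - 2) n\<close>, so it is enough to know that
  \<open>dim S\<^sup>d \<ge> d dim S\<close> (\<open>cone_dim_Sing_times_le\<close>).

  The link to chains of irreducible closed sets, \<open>codim C = n - dim C\<close> (\<open>codim_cone\<close>), and the bound for \<open>S\<^sup>d\<close> rest on
  two facts about \<open>r\<close> linear forms \<open>y\<close> that cut \<open>C\<close> down to \<open>0\<close>. By elimination theory, the projection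
  \<open>y : C \<rightarrow> K\<^sup>r\<close> is finite and maps closed sets to closed sets (\<open>zariski_closed_forget_variable\<close>, \<open>projected_cone\<close>). In
  particular, the functions of degree at most \<open>s\<close> on \<open>C\<close> span a space of dimension \<open>O(s\<^sup>r)\<close>, so that at most \<open>r\<close>
  functions can be algebraically independent on \<open>C\<close> (\<open>alg_independent_le_growth\<close>). If \<open>r\<close> is minimal, then \<open>y\<close> is onto
  (\<open>projection_onto\<close>), and the forms are algebraically independent on \<open>C\<close>. On \<open>S\<^sup>d\<close>, the forms applied to each factor
  then give \<open>d dim S\<close> independent functions.
  Along a chain of irreducible closed sets, every step adds an independent function, which bounds the length of
  chains from above (\<open>chain_length_bound\<close>). Conversely, the projections that forget a coordinate produce, by induction on
  the number of coordinates, a chain of the expected length above every irreducible closed set (\<open>chain_exists\<close>).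
\<close>

section \<open>Polynomial functions\<close>

text \<open>
  Over an infinite field, a closed set and the equations that hold on it depend only on polynomials as functions, for
  which substitution is composition. The number is an upper bound for the degree.
\<close>

inductive polyfun :: "'j set \<Rightarrow> nat \<Rightarrow> (('j \<Rightarrow> 'a::comm_ring_1) \<Rightarrow> 'a) \<Rightarrow> bool" for A where
  polyfun_const: "polyfun A s (\<lambda>_. c)"
| polyfun_coord: "i \<in> A \<Longrightarrow> polyfun A (Suc s) (\<lambda>x. x i)"
| polyfun_add: "polyfun A s f \<Longrightarrow> polyfun A s g \<Longrightarrow> polyfun A s (\<lambda>x. f x + g x)"
| polyfun_mult: "polyfun A s f \<Longrightarrow> polyfun A t g \<Longrightarrow> polyfun A (s + t) (\<lambda>x. f x * g x)"

definition regular :: "'j set \<Rightarrow> (('j \<Rightarrow> 'a::comm_ring_1) \<Rightarrow> 'a) \<Rightarrow> bool" where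
  "regular A f \<longleftrightarrow> (\<exists>s. polyfun A s f)"

lemma polyfun_mono: "polyfun A s f \<Longrightarrow> A \<subseteq> B \<Longrightarrow> s \<le> t \<Longrightarrow> polyfun B t f"
proof (induction arbitrary: t rule: polyfun.induct)
  case (polyfun_coord i s)
  then obtain t' where "t = Suc t'" by (cases t) auto
  with polyfun_coord show ?case by (auto intro: polyfun.polyfun_coord)
next
  case (polyfun_mult s f s' g)
  have "polyfun B (s + (t - s)) (\<lambda>x. f x * g x)"
    using polyfun_mult.IH(1)[of s] polyfun_mult.IH(2)[of "t - s"] polyfun_mult.prems
    by (intro polyfun.polyfun_mult) auto
  with polyfun_mult.prems show ?case by simp
qed (auto intro: polyfun.intros)

lemma polyfun_cong_on:
  "polyfun A s f \<Longrightarrow> (\<And>i. i \<in> A \<Longrightarrow> x i = y i) \<Longrightarrow> f x = f y"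
  by (induction rule: polyfun.induct) auto

lemma polyfun_compose:
  assumes "polyfun A s f" and "\<And>i. i \<in> A \<Longrightarrow> polyfun B e (G i)"
  shows "polyfun B (s * e) (\<lambda>x. f (\<lambda>i. G i x))"
  using assms
proof (induction rule: polyfun.induct)
  case (polyfun_coord i s)
  then have "polyfun B e (G i)" by simp
  then show ?case by (rule polyfun_mono) auto
next
  case (polyfun_mult s f t g)
  then show ?case by (auto simp: add_mult_distrib intro!: polyfun.polyfun_mult)
qed (auto intro: polyfun.intros)

lemma polyfun_cmult: "polyfun A s f \<Longrightarrow> polyfun A s (\<lambda>x. c * f x)"
  using polyfun_mult[OF polyfun_const[of A 0 c]] by fastforce

lemma polyfun_sum: "(\<And>k. k \<in> S \<Longrightarrow> polyfun A s (f k)) \<Longrightarrow> polyfun A s (\<lambda>x. \<Sum>k\<in>S. f k x)"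
  by (induction S rule: infinite_finite_induct) (auto intro: polyfun.intros)

lemma polyfun_prod:
  "(\<And>k. k \<in> S \<Longrightarrow> polyfun A (s k) (f k)) \<Longrightarrow> polyfun A (sum s S) (\<lambda>x. \<Prod>k\<in>S. f k x)"
  by (induction S rule: infinite_finite_induct) (auto intro: polyfun.intros)

lemma polyfun_power: "polyfun A s f \<Longrightarrow> polyfun A (k * s) (\<lambda>x. f x ^ k)"
  by (induction k) (auto intro: polyfun.intros)

lemma regularI: "polyfun A s f \<Longrightarrow> regular A f"
  by (auto simp: regular_def)

lemma regular_const: "regular A (\<lambda>_. c)"
  and regular_coord: "i \<in> A \<Longrightarrow> regular A (\<lambda>x. x i)"
  by (auto intro!: regularI polyfun.intros)

lemma regular_add: "regular A f \<Longrightarrow> regular A g \<Longrightarrow> regular A (\<lambda>x. f x + g x)"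
  unfolding regular_def using polyfun_add polyfun_mono[OF _ order_refl max.cobounded1]
    polyfun_mono[OF _ order_refl max.cobounded2] by blast

lemma regular_mult: "regular A f \<Longrightarrow> regular A g \<Longrightarrow> regular A (\<lambda>x. f x * g x)"
  unfolding regular_def by (blast intro: polyfun_mult)

lemma regular_diff: "regular A f \<Longrightarrow> regular A g \<Longrightarrow> regular A (\<lambda>x. f x - g x)"
  using regular_add[OF _ regular_mult[OF regular_const[of A "-1"]], of f g] by simp

lemma regular_sum: "(\<And>k. k \<in> S \<Longrightarrow> regular A (f k)) \<Longrightarrow> regular A (\<lambda>x. \<Sum>k\<in>S. f k x)"
  by (induction S rule: infinite_finite_induct) (auto intro: regular_const regular_add)

lemma regular_prod: "(\<And>k. k \<in> S \<Longrightarrow> regular A (f k)) \<Longrightarrow> regular A (\<lambda>x. \<Prod>k\<in>S. f k x)"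
  by (induction S rule: infinite_finite_induct) (auto intro: regular_const regular_mult)

lemma regular_power: "regular A f \<Longrightarrow> regular A (\<lambda>x. f x ^ k)"
  unfolding regular_def by (blast intro: polyfun_power)

lemma regular_mono: "regular A f \<Longrightarrow> A \<subseteq> B \<Longrightarrow> regular B f"
  unfolding regular_def by (meson polyfun_mono order_refl)

lemma regular_cong_on: "regular A f \<Longrightarrow> (\<And>i. i \<in> A \<Longrightarrow> x i = y i) \<Longrightarrow> f x = f y"
  unfolding regular_def by (metis polyfun_cong_on)

lemma regular_compose:
  assumes "regular A f" and "\<And>i. i \<in> A \<Longrightarrow> regular B (G i)"
  shows "regular B (\<lambda>x. f (\<lambda>i. G i x))"
proof -
  obtain s where "polyfun A s f" using assms by (auto simp: regular_def)
  then show ?thesis using assms(2)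
    by (induction rule: polyfun.induct) (auto intro: regular_const regular_add regular_mult)
qed

lemmas regular_intros =
  regular_const regular_coord regular_add regular_mult regular_diff regular_sum regular_prod
  regular_power

lemma regular_on_line:
  fixes f :: "('j \<Rightarrow> 'a::comm_ring_1) \<Rightarrow> 'a"
  assumes "regular A f"
  shows "\<exists>p. \<forall>t. f (\<lambda>i. a i + t * b i) = poly p t"
proof -
  obtain s where "polyfun A s f" using assms by (auto simp: regular_def)
  then show ?thesis
  proof (induction rule: polyfun.induct)
    case (polyfun_const s c) show ?case by (intro exI[of _ "[:c:]"]) simp
  next
    case (polyfun_coord i s) show ?case by (rule exI[of _ "[:a i, b i:]"]) (simp add: mult.commute)
  next
    case (polyfun_add s f g) then show ?case by (metis poly_add)
  next
    case (polyfun_mult s f t g) then show ?case by (metis poly_mult)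
  qed
qed

lemma regular_on_coordinate_line:
  fixes g :: "('j \<Rightarrow> 'a::comm_ring_1) \<Rightarrow> 'a"
  assumes "regular A g"
  shows "\<exists>p. \<forall>t. g (z(i := t)) = poly p t"
proof -
  have "(\<lambda>j. (z(i := 0)) j + t * (if j = i then 1 else 0)) = z(i := t)" for t by auto
  then show ?thesis using regular_on_line[OF assms, of "z(i := 0)" "\<lambda>j. if j = i then 1 else 0"] by simp
qed

lemma alg_closed_field_infinite: "infinite (UNIV :: 'a::alg_closed_field set)"
proof
  assume fin: "finite (UNIV :: 'a set)"
  \<comment> \<open>a polynomial without roots, as in Euclid's argument for primes\<close>
  define p where "p = (\<Prod>a\<in>(UNIV :: 'a set). [:- a, 1:]) + 1"
  have deg: "degree (\<Prod>a\<in>(UNIV :: 'a set). [:- a, 1:]) > 0"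
    using fin by (subst degree_prod_eq_sum_degree) (auto simp: card_gt_0_iff)
  then have "degree p = degree (\<Prod>a\<in>(UNIV :: 'a set). [:- a, 1:])"
    unfolding p_def by (intro degree_add_eq_left) auto
  then obtain x where "poly p x = 0" using deg alg_closed_imp_poly_has_root[of p] by auto
  moreover have "poly (\<Prod>a\<in>(UNIV :: 'a set). [:- a, 1:]) x = 0"
    unfolding poly_prod using fin by (intro prod_zero) auto
  ultimately show False by (simp add: p_def)
qed

lemma poly_fun_eqD:
  fixes p q :: "'a::alg_closed_field poly"
  assumes "\<And>t. poly p t = poly q t"
  shows "p = q"
proof (rule ccontr)
  assume "p \<noteq> q"
  then have "finite {t. poly (p - q) t = 0}" by (intro poly_roots_finite) auto
  then show False using assms alg_closed_field_infinite[where 'a='a] by simp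
qed

lemma polynomial_coeffs_zero:
  fixes c :: "nat \<Rightarrow> 'a::alg_closed_field"
  assumes "\<And>t. (\<Sum>k\<in>S. c k * t ^ k) = 0" and "finite S" and "k \<in> S"
  shows "c k = 0"
proof -
  have "(\<Sum>k\<in>S. monom (c k) k) = 0"
    by (rule poly_fun_eqD) (simp add: poly_sum poly_monom assms)
  then have "coeff (\<Sum>k\<in>S. monom (c k) k) k = 0" by simp
  then show ?thesis using assms by (simp add: coeff_sum if_distrib cong: if_cong)
qed

text \<open>
  On the line through a point where \<open>f \<noteq> 0\<close> and a point where \<open>g \<noteq> 0\<close>, both factors are nonzero polynomials in one
  variable. Over an infinite field, their product is then nonzero as a function.
\<close>

lemma regular_no_zero_divisors:
  fixes f g :: "('j \<Rightarrow> 'a::alg_closed_field) \<Rightarrow> 'a"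
  assumes "regular A f" "regular A g" and "\<And>x. f x * g x = 0"
  shows "(\<forall>x. f x = 0) \<or> (\<forall>x. g x = 0)"
proof (rule ccontr)
  assume "\<not> ?thesis"
  then obtain a b where ab: "f a \<noteq> 0" "g b \<noteq> 0" by auto
  obtain p where p: "\<And>t. f (\<lambda>i. a i + t * (b i - a i)) = poly p t"
    using regular_on_line[OF assms(1), of a "\<lambda>i. b i - a i"] by auto
  obtain q where q: "\<And>t. g (\<lambda>i. a i + t * (b i - a i)) = poly q t"
    using regular_on_line[OF assms(2), of a "\<lambda>i. b i - a i"] by auto
  have "poly (p * q) t = 0" for t
    unfolding poly_mult p[symmetric] q[symmetric] by (rule assms(3))
  then have "p * q = 0" by (intro poly_fun_eqD) simp
  moreover have "poly p 0 \<noteq> 0" using ab p[of 0] by simp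
  moreover have "poly q 1 \<noteq> 0" using ab q[of 1] by simp
  ultimately show False by auto
qed

lemma sum_times_sum_by_index:
  fixes a b :: "nat \<Rightarrow> 'a::comm_ring_1"
  shows "(\<Sum>j\<le>s. a j) * (\<Sum>k\<le>t. b k) =
    (\<Sum>l\<le>s + t. \<Sum>jk\<in>{jk \<in> {..s} \<times> {..t}. fst jk + snd jk = l}. a (fst jk) * b (snd jk))"
proof -
  have "(\<Sum>j\<le>s. a j) * (\<Sum>k\<le>t. b k) = (\<Sum>jk\<in>{..s} \<times> {..t}. a (fst jk) * b (snd jk))"
    by (simp add: sum_product sum.cartesian_product case_prod_unfold)
  also have "\<dots> = (\<Sum>l\<le>s + t. \<Sum>jk\<in>{jk \<in> {..s} \<times> {..t}. fst jk + snd jk = l}. a (fst jk) * b (snd jk))"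
    by (rule sum.group[symmetric]) auto
  finally show ?thesis .
qed

text \<open>
  The bound \<open>s - j\<close> makes the coefficient of \<open>x i ^ s\<close> a constant. This is how monic relations arise.
\<close>

lemma polyfun_expand_in_variable:
  fixes f :: "('j \<Rightarrow> 'a::comm_ring_1) \<Rightarrow> 'a"
  assumes "polyfun A s f" and "i \<in> A"
  obtains a where "\<And>j. j \<le> s \<Longrightarrow> polyfun (A - {i}) (s - j) (a j)"
    and "\<And>x. f x = (\<Sum>j\<le>s. a j x * x i ^ j)"
proof -
  have "\<exists>a. (\<forall>j\<le>s. polyfun (A - {i}) (s - j) (a j)) \<and> (\<forall>x. f x = (\<Sum>j\<le>s. a j x * x i ^ j))"
    using assms
  proof (induction rule: polyfun.induct)
    case (polyfun_const s c)
    show ?case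
      by (rule exI[of _ "\<lambda>j x. if j = 0 then c else 0"])
        (auto simp: if_distrib if_distribR intro: polyfun.intros cong: if_cong)
  next
    case (polyfun_coord k s)
    show ?case
    proof (cases "k = i")
      case True
      have "(\<Sum>j\<le>Suc s. (if j = 1 then 1 else 0) * x i ^ j) = x i" for x :: "'j \<Rightarrow> 'a"
        by (simp add: if_distrib if_distribR cong: if_cong)
      with True show ?thesis
        by (intro exI[of _ "\<lambda>j x. if j = 1 then 1 else 0"]) (auto intro: polyfun.intros)
    next
      case False
      have "(\<Sum>j\<le>Suc s. (if j = 0 then x k else 0) * x i ^ j) = x k" for x :: "'j \<Rightarrow> 'a"
        by (simp add: if_distrib if_distribR cong: if_cong)
      moreover have "polyfun (A - {i}) (Suc s - j) (\<lambda>x. if j = 0 then x k else 0)" for j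
        using False polyfun_coord by (cases "j = 0") (auto intro: polyfun.intros)
      ultimately show ?thesis
        by (intro exI[of _ "\<lambda>j x. if j = 0 then x k else 0"]) auto
    qed
  next
    case (polyfun_add s f g)
    then obtain a b where
      "\<forall>j\<le>s. polyfun (A - {i}) (s - j) (a j)" "\<forall>x. f x = (\<Sum>j\<le>s. a j x * x i ^ j)"
      "\<forall>j\<le>s. polyfun (A - {i}) (s - j) (b j)" "\<forall>x. g x = (\<Sum>j\<le>s. b j x * x i ^ j)"
      by blast
    then show ?case
      by (intro exI[of _ "\<lambda>j x. a j x + b j x"])
        (auto intro: polyfun.intros simp: sum.distrib algebra_simps)
  next
    case (polyfun_mult s f t g)
    then obtain a b where
      a: "\<And>j. j \<le> s \<Longrightarrow> polyfun (A - {i}) (s - j) (a j)" "\<And>x. f x = (\<Sum>j\<le>s. a j x * x i ^ j)" and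
      b: "\<And>j. j \<le> t \<Longrightarrow> polyfun (A - {i}) (t - j) (b j)" "\<And>x. g x = (\<Sum>j\<le>t. b j x * x i ^ j)"
      by blast
    define c where "c l x = (\<Sum>jk\<in>{jk \<in> {..s} \<times> {..t}. fst jk + snd jk = l}. a (fst jk) x * b (snd jk) x)"
      for l x
    have "polyfun (A - {i}) (s + t - l) (c l)" for l
      unfolding c_def
    proof (rule polyfun_sum)
      fix jk assume "jk \<in> {jk \<in> {..s} \<times> {..t}. fst jk + snd jk = l}"
      then have jk: "fst jk \<le> s" "snd jk \<le> t" "fst jk + snd jk = l" by auto
      then have "polyfun (A - {i}) ((s - fst jk) + (t - snd jk)) (\<lambda>x. a (fst jk) x * b (snd jk) x)"
        by (intro polyfun.polyfun_mult a b)
      moreover have "(s - fst jk) + (t - snd jk) = s + t - l" using jk by auto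
      ultimately show "polyfun (A - {i}) (s + t - l) (\<lambda>x. a (fst jk) x * b (snd jk) x)" by simp
    qed
    moreover have "f x * g x = (\<Sum>l\<le>s + t. c l x * x i ^ l)" for x
      unfolding a b c_def sum_times_sum_by_index
      by (intro sum.cong refl, unfold sum_distrib_right, intro sum.cong refl)
        (auto simp: power_add algebra_simps)
    ultimately show ?case by blast
  qed
  then show ?thesis using that by blast
qed

definition homog_fun :: "nat \<Rightarrow> (('j \<Rightarrow> 'a::comm_ring_1) \<Rightarrow> 'a) \<Rightarrow> bool" where
  "homog_fun k f \<longleftrightarrow> (\<forall>t x. f (\<lambda>i. t * x i) = t ^ k * f x)"

text \<open>
  An equation of a cone splits into homogeneous ones, by comparing powers of \<open>t\<close> in its values at \<open>t x\<close>.
\<close>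

lemma polyfun_homogeneous_components:
  fixes f :: "('j \<Rightarrow> 'a::comm_ring_1) \<Rightarrow> 'a"
  assumes "polyfun A s f"
  obtains F where "\<And>k. polyfun A k (F k)" and "\<And>k. homog_fun k (F k)"
    and "\<And>x. f x = (\<Sum>k\<le>s. F k x)"
proof -
  have "\<exists>F. (\<forall>k. polyfun A k (F k)) \<and> (\<forall>k. homog_fun k (F k)) \<and> (\<forall>x. f x = (\<Sum>k\<le>s. F k x))"
    using assms
  proof (induction rule: polyfun.induct)
    case (polyfun_const s c)
    show ?case
      by (rule exI[of _ "\<lambda>j x. if j = 0 then c else 0"]) (auto intro: polyfun.intros simp: homog_fun_def)
  next
    case (polyfun_coord i s)
    have "polyfun A k (\<lambda>x. if k = 1 then x i else 0)" for k
      using polyfun_coord by (cases "k = 1") (auto intro: polyfun.intros)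
    moreover have "(\<Sum>k\<le>Suc s. if k = 1 then x i else 0) = x i" for x :: "'j \<Rightarrow> 'a"
      by simp
    ultimately show ?case
      by (intro exI[of _ "\<lambda>j x. if j = 1 then x i else 0"]) (auto simp: homog_fun_def)
  next
    case (polyfun_add s f g)
    then obtain F G where
      "\<forall>k. polyfun A k (F k)" "\<forall>k. homog_fun k (F k)" "\<forall>x. f x = (\<Sum>k\<le>s. F k x)"
      "\<forall>k. polyfun A k (G k)" "\<forall>k. homog_fun k (G k)" "\<forall>x. g x = (\<Sum>k\<le>s. G k x)"
      by blast
    then show ?case
      by (intro exI[of _ "\<lambda>j x. F j x + G j x"])
        (auto intro: polyfun.intros simp: sum.distrib homog_fun_def algebra_simps)
  next
    case (polyfun_mult s f t g)
    then obtain F G where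
      F: "\<And>k. polyfun A k (F k)" "\<And>k. homog_fun k (F k)" "\<And>x. f x = (\<Sum>k\<le>s. F k x)" and
      G: "\<And>k. polyfun A k (G k)" "\<And>k. homog_fun k (G k)" "\<And>x. g x = (\<Sum>k\<le>t. G k x)"
      by blast
    define H where "H l x = (\<Sum>jk\<in>{jk \<in> {..s} \<times> {..t}. fst jk + snd jk = l}. F (fst jk) x * G (snd jk) x)"
      for l x
    have "polyfun A l (H l)" for l
      unfolding H_def by (rule polyfun_sum) (auto intro: polyfun.polyfun_mult F G)
    moreover have "homog_fun l (H l)" for l
      unfolding H_def homog_fun_def
    proof (intro allI, unfold sum_distrib_left, rule sum.cong)
      fix t' x jk assume "jk \<in> {jk \<in> {..s} \<times> {..t}. fst jk + snd jk = l}"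
      then have l: "l = fst jk + snd jk" by auto
      show "F (fst jk) (\<lambda>i. t' * x i) * G (snd jk) (\<lambda>i. t' * x i) = t' ^ l * (F (fst jk) x * G (snd jk) x)"
        using F(2) G(2) by (simp add: homog_fun_def l power_add)
    qed simp
    moreover have "f x * g x = (\<Sum>l\<le>s + t. H l x)" for x
      unfolding F G H_def sum_times_sum_by_index ..
    ultimately show ?case by blast
  qed
  then show ?thesis using that by blast
qed

section \<open>Evaluation of polynomials and Zariski-closed sets\<close>

abbreviation keys :: "('b \<Rightarrow>\<^sub>0 'c::zero) \<Rightarrow> 'b set" where
  "keys \<equiv> Poly_Mapping.keys"

abbreviation lookup :: "('b \<Rightarrow>\<^sub>0 'c::zero) \<Rightarrow> 'b \<Rightarrow> 'c" where
  "lookup \<equiv> Poly_Mapping.lookup"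

abbreviation single :: "'b \<Rightarrow> 'c::zero \<Rightarrow> 'b \<Rightarrow>\<^sub>0 'c" where
  "single \<equiv> Poly_Mapping.single"

definition mon :: "('i \<Rightarrow> 'r::comm_ring_1) \<Rightarrow> ('i \<Rightarrow>\<^sub>0 nat) \<Rightarrow> 'r" where
  "mon x m = (\<Prod>i\<in>keys m. x i ^ lookup m i)"

lemma mon_superset:
  "finite S \<Longrightarrow> keys m \<subseteq> S \<Longrightarrow> mon x m = (\<Prod>i\<in>S. x i ^ lookup m i)"
  unfolding mon_def by (rule prod.mono_neutral_left) (auto simp: in_keys_iff)

lemma mon_0 [simp]: "mon x 0 = 1"
  by (simp add: mon_def)

lemma mon_single [simp]: "mon x (single i k) = x i ^ k"
  by (simp add: mon_def)

lemma mon_add: "mon x (m + n) = mon x m * mon x n"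
  using Poly_Mapping.keys_add[of m n]
  by (subst (1 2 3) mon_superset[of "keys m \<union> keys n"])
    (auto simp: lookup_add power_add prod.distrib)

definition coeff_hom :: "('k::comm_ring_1 \<Rightarrow> 'r::comm_ring_1) \<Rightarrow> bool" where
  "coeff_hom \<phi> \<longleftrightarrow> \<phi> 0 = 0 \<and> \<phi> 1 = 1 \<and> (\<forall>a b. \<phi> (a + b) = \<phi> a + \<phi> b) \<and> (\<forall>a b. \<phi> (a * b) = \<phi> a * \<phi> b)"

lemma coeff_hom_id: "coeff_hom id"
  and coeff_hom_to_ac: "coeff_hom to_ac"
  and coeff_hom_const: "coeff_hom const"
  by (auto simp: coeff_hom_def const_def single_add mult_single)

lemma coeff_hom_of_nat: "coeff_hom \<phi> \<Longrightarrow> \<phi> (of_nat n) = of_nat n"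
  by (induction n) (auto simp: coeff_hom_def)

lemma eval_poly_superset:
  assumes "coeff_hom \<phi>" "finite S" "keys p \<subseteq> S"
  shows "eval_poly \<phi> x p = (\<Sum>m\<in>S. \<phi> (lookup p m) * mon x m)"
  unfolding eval_poly_def mon_def[symmetric]
  using assms by (intro sum.mono_neutral_left) (auto simp: in_keys_iff coeff_hom_def)

lemma eval_poly_single: "coeff_hom \<phi> \<Longrightarrow> eval_poly \<phi> x (single m c) = \<phi> c * mon x m"
  by (subst eval_poly_superset[of _ "{m}"]) auto

lemma eval_poly_add:
  assumes "coeff_hom \<phi>"
  shows "eval_poly \<phi> x (p + q) = eval_poly \<phi> x p + eval_poly \<phi> x q"
  using assms Poly_Mapping.keys_add[of p q]
  by (subst (1 2 3) eval_poly_superset[of _ "keys p \<union> keys q"])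
    (auto simp: lookup_add coeff_hom_def sum.distrib algebra_simps)

lemma mpoly_decompose:
  "p = (\<Sum>m\<in>keys p. single m (lookup p m))"
  by (rule poly_mapping_eqI) (simp add: lookup_sum lookup_single when_def in_keys_iff)

lemma mpoly_induct [case_names single add]:
  fixes p :: "'b \<Rightarrow>\<^sub>0 'c::comm_monoid_add"
  assumes "\<And>m c. P (single m c)" and "\<And>p q. P p \<Longrightarrow> P q \<Longrightarrow> P (p + q)"
  shows "P p"
proof -
  have "P 0" using assms(1)[of undefined 0] by simp
  then have "P (\<Sum>m\<in>S. single m (lookup p m))" for S
    by (induction S rule: infinite_finite_induct) (auto intro: assms)
  then show ?thesis by (subst mpoly_decompose)
qed

lemma eval_poly_0: "eval_poly \<phi> x 0 = 0"
  by (simp add: eval_poly_def)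

lemma eval_poly_sum:
  "coeff_hom \<phi> \<Longrightarrow> eval_poly \<phi> x (sum p S) = (\<Sum>k\<in>S. eval_poly \<phi> x (p k))"
  by (induction S rule: infinite_finite_induct) (auto simp: eval_poly_0 eval_poly_add)

lemma eval_poly_mult:
  assumes "coeff_hom \<phi>"
  shows "eval_poly \<phi> x (p * q) = eval_poly \<phi> x p * eval_poly \<phi> x q"
proof (induction p rule: mpoly_induct)
  case (single m c)
  show ?case
  proof (induction q rule: mpoly_induct)
    case (single n e)
    show ?case using assms
      by (simp add: mult_single eval_poly_single mon_add) (simp add: coeff_hom_def)
  qed (simp add: algebra_simps eval_poly_add[OF assms])
qed (simp add: algebra_simps eval_poly_add[OF assms])

lemma eval_poly_var: "coeff_hom \<phi> \<Longrightarrow> eval_poly \<phi> x (var i) = x i"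
  by (simp add: var_def eval_poly_single) (simp add: coeff_hom_def)

lemma eval_poly_const: "coeff_hom \<phi> \<Longrightarrow> eval_poly \<phi> x (const c) = \<phi> c"
  by (simp add: const_def eval_poly_single)

lemma regular_eval_poly:
  assumes "p \<in> polys_on A"
  shows "regular A (\<lambda>x. eval_poly \<phi> x p)"
  unfolding eval_poly_def using assms
  by (intro regular_intros) (auto simp: polys_on_def)

lemma polys_on_add: "p \<in> polys_on A \<Longrightarrow> q \<in> polys_on A \<Longrightarrow> p + q \<in> polys_on A"
  unfolding polys_on_def using Poly_Mapping.keys_add[of p q] by blast

lemma polys_on_mult:
  assumes "p \<in> polys_on A" "q \<in> polys_on A"
  shows "p * q \<in> polys_on A"
  unfolding polys_on_def
proof (intro CollectI ballI)
  fix k assume "k \<in> keys (p * q)"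
  then obtain m n where "k = m + n" "m \<in> keys p" "n \<in> keys q"
    using Poly_Mapping.keys_mult[of p q] by blast
  then show "keys k \<subseteq> A"
    using assms Poly_Mapping.keys_add[of m n] unfolding polys_on_def by blast
qed

lemma regular_imp_eval_poly:
  assumes "regular A g"
  shows "\<exists>p\<in>polys_on A. \<forall>x. g x = eval_poly id x p"
proof -
  obtain s where "polyfun A s g" using assms by (auto simp: regular_def)
  then show ?thesis
  proof (induction rule: polyfun.induct)
    case (polyfun_const s c)
    have "const c \<in> polys_on A" by (simp add: polys_on_def const_def)
    moreover have "c = eval_poly id x (const c)" for x
      using eval_poly_const[OF coeff_hom_id, of x c] by simp
    ultimately show ?case by blast
  next
    case (polyfun_coord i s)
    then have "var i \<in> polys_on A" by (simp add: polys_on_def var_def)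
    moreover have "x i = eval_poly id x (var i)" for x
      using eval_poly_var[OF coeff_hom_id, of x i] by simp
    ultimately show ?case by blast
  next
    case (polyfun_add s f g)
    then show ?case using polys_on_add by (metis eval_poly_add coeff_hom_id)
  next
    case (polyfun_mult s f t g)
    then show ?case using polys_on_mult by (metis eval_poly_mult coeff_hom_id)
  qed
qed

lemma zariski_closed_iff_regular:
  "zariski_closed A Z \<longleftrightarrow>
    (\<exists>P. (\<forall>g\<in>P. regular A g) \<and> Z = {x \<in> affine_space A. \<forall>g\<in>P. g x = 0})"
proof
  assume "zariski_closed A Z"
  then obtain P where "P \<subseteq> polys_on A" "Z = {x \<in> affine_space A. \<forall>p\<in>P. eval_poly id x p = 0}"
    by (auto simp: zariski_closed_def)
  then show "\<exists>P. (\<forall>g\<in>P. regular A g) \<and> Z = {x \<in> affine_space A. \<forall>g\<in>P. g x = 0}"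
    by (intro exI[of _ "(\<lambda>p x. eval_poly id x p) ` P"]) (auto intro: regular_eval_poly)
next
  assume "\<exists>P. (\<forall>g\<in>P. regular A g) \<and> Z = {x \<in> affine_space A. \<forall>g\<in>P. g x = 0}"
  then obtain P where P: "\<forall>g\<in>P. regular A g" "Z = {x \<in> affine_space A. \<forall>g\<in>P. g x = 0}" by auto
  obtain h where "\<And>g. g \<in> P \<Longrightarrow> h g \<in> polys_on A \<and> (\<forall>x. g x = eval_poly id x (h g))"
    using P(1) regular_imp_eval_poly by metis
  then show "zariski_closed A Z"
    unfolding zariski_closed_def P(2) by (intro exI[of _ "h ` P"]) auto
qed

lemma zariski_closedI:
  assumes "Z \<subseteq> affine_space A"
    and "\<And>z. z \<in> affine_space A \<Longrightarrow> z \<notin> Z \<Longrightarrow> \<exists>g. regular A g \<and> (\<forall>x\<in>Z. g x = 0) \<and> g z \<noteq> 0"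
  shows "zariski_closed A Z"
  unfolding zariski_closed_iff_regular
  using assms by (intro exI[of _ "{g. regular A g \<and> (\<forall>x\<in>Z. g x = 0)}"]) blast

lemma zariski_closedD:
  assumes "zariski_closed A Z" "z \<in> affine_space A" "z \<notin> Z"
  shows "\<exists>g. regular A g \<and> (\<forall>x\<in>Z. g x = 0) \<and> g z \<noteq> 0"
  using assms unfolding zariski_closed_iff_regular by blast

lemma zariski_closed_subset: "zariski_closed A Z \<Longrightarrow> Z \<subseteq> affine_space A"
  by (auto simp: zariski_closed_def)

lemma zariski_closed_affine_space: "zariski_closed A (affine_space A)"
  by (rule zariski_closedI) auto

lemma zariski_closed_Inter:
  assumes "\<C> \<noteq> {}" and "\<And>Z. Z \<in> \<C> \<Longrightarrow> zariski_closed A Z"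
  shows "zariski_closed A (\<Inter>\<C>)"
proof (rule zariski_closedI)
  show "\<Inter>\<C> \<subseteq> affine_space A" using assms zariski_closed_subset by blast
next
  fix z assume "z \<in> affine_space A" "z \<notin> \<Inter>\<C>"
  then obtain Z where Z: "Z \<in> \<C>" "z \<notin> Z" by auto
  obtain g where "regular A g" "\<forall>x\<in>Z. g x = 0" "g z \<noteq> 0"
    using zariski_closedD[OF assms(2)[OF Z(1)] \<open>z \<in> affine_space A\<close> Z(2)] by auto
  then show "\<exists>g. regular A g \<and> (\<forall>x\<in>\<Inter>\<C>. g x = 0) \<and> g z \<noteq> 0"
    using Z(1) by (intro exI[of _ g]) auto
qed

lemma zariski_closed_Int:
  "zariski_closed A Y \<Longrightarrow> zariski_closed A Z \<Longrightarrow> zariski_closed A (Y \<inter> Z)"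
  using zariski_closed_Inter[of "{Y, Z}"] by auto

lemma zariski_closed_zero_set:
  assumes "regular A g"
  shows "zariski_closed A {x \<in> affine_space A. g x = 0}"
  using assms by (intro zariski_closedI) auto

lemma zariski_closed_vimage:
  assumes "zariski_closed B Z" "\<And>i. i \<in> B \<Longrightarrow> regular A (G i)" "\<And>i x. i \<notin> B \<Longrightarrow> G i x = 0"
  shows "zariski_closed A {x \<in> affine_space A. (\<lambda>i. G i x) \<in> Z}"
proof (rule zariski_closedI)
  fix z assume "z \<in> affine_space A" "z \<notin> {x \<in> affine_space A. (\<lambda>i. G i x) \<in> Z}"
  then have "(\<lambda>i. G i z) \<notin> Z" by simp
  moreover have "(\<lambda>i. G i z) \<in> affine_space B" using assms(3) by (auto simp: affine_space_def)
  ultimately obtain g where "regular B g" "\<forall>x\<in>Z. g x = 0" "g (\<lambda>i. G i z) \<noteq> 0"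
    using zariski_closedD[OF assms(1)] by blast
  then show "\<exists>g. regular A g \<and> (\<forall>x\<in>{x \<in> affine_space A. (\<lambda>i. G i x) \<in> Z}. g x = 0) \<and> g z \<noteq> 0"
    using assms(2) by (intro exI[of _ "\<lambda>x. g (\<lambda>i. G i x)"]) (auto intro: regular_compose)
qed auto


section \<open>Elimination of a variable\<close>

text \<open>
  The linear factors of \<open>p\<close> divide \<open>c\<close> one after the other, since none of them divides \<open>g\<close>.
\<close>

lemma monic_dvd_of_no_common_root:
  fixes p g c :: "'a::alg_closed_field poly"
  assumes "p \<noteq> 0" "p dvd c * g" and "\<And>t. poly p t = 0 \<Longrightarrow> poly g t \<noteq> 0"
  shows "p dvd c"
  using assms
proof (induction "degree p" arbitrary: p c)
  case 0
  then have "p dvd 1" by (simp add: is_unit_iff_degree)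
  then show ?case using dvd_trans one_dvd by blast
next
  case (Suc n)
  then obtain a where a: "poly p a = 0" using alg_closed_imp_poly_has_root[of p] by auto
  then obtain p' where p': "p = [:- a, 1:] * p'" by (auto simp: poly_eq_0_iff_dvd elim: dvdE)
  with Suc.prems have "p' \<noteq> 0" by auto
  then have deg: "n = degree p'" using Suc.hyps(2) unfolding p' by (subst (asm) degree_mult_eq) auto
  have "[:- a, 1:] dvd c * g" using Suc.prems(2) p' dvd_mult_left by blast
  then have "poly c a = 0" using Suc.prems(3)[OF a] by (simp add: poly_eq_0_iff_dvd[symmetric])
  then obtain c' where c': "c = [:- a, 1:] * c'" by (auto simp: poly_eq_0_iff_dvd elim: dvdE)
  obtain r where "c * g = p * r" using Suc.prems(2) by (auto elim: dvdE)
  then have "[:- a, 1:] * (c' * g) = [:- a, 1:] * (p' * r)" unfolding c' p' by (simp only: mult.assoc)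
  then have "c' * g = p' * r" by (subst (asm) mult_cancel_left) auto
  then have "p' dvd c' * g" by simp
  moreover have "poly g t \<noteq> 0" if "poly p' t = 0" for t using Suc.prems(3) that by (simp add: p')
  ultimately have "p' dvd c'" using Suc.hyps(1) deg \<open>p' \<noteq> 0\<close> by blast
  then show ?case unfolding p' c' by (rule mult_dvd_mono[OF dvd_refl])
qed

text \<open>
  The functions that admit division are closed under sums and under products with coefficients from the
  remaining variables. It is thus enough to divide the powers of \<open>x i\<close>, which the divisor itself lowers.
\<close>

lemma regular_divide_by_monic:
  fixes h :: "('j \<Rightarrow> 'a::comm_ring_1) \<Rightarrow> 'a"
  assumes "regular A h" "i \<in> A" "m > 0" and c: "\<And>j. j < m \<Longrightarrow> regular (A - {i}) (c j)"
  shows "\<exists>q M. regular A q \<and> (\<forall>j<m. regular (A - {i}) (M j)) \<and>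
    (\<forall>x. h x = q x * (x i ^ m + (\<Sum>j<m. c j x * x i ^ j)) + (\<Sum>j<m. M j x * x i ^ j))"
proof -
  define F where "F x = x i ^ m + (\<Sum>j<m. c j x * x i ^ j)" for x
  define D where "D h \<longleftrightarrow> (\<exists>q M. regular A q \<and> (\<forall>j<m. regular (A - {i}) (M j)) \<and>
    (\<forall>x. h x = q x * F x + (\<Sum>j<m. M j x * x i ^ j)))" for h
  have D_add: "D (\<lambda>x. g x + h x)" if "D g" "D h" for g h
  proof -
    obtain q M where "regular A q" "\<forall>j<m. regular (A - {i}) (M j)"
      "\<forall>x. g x = q x * F x + (\<Sum>j<m. M j x * x i ^ j)"
      using \<open>D g\<close> unfolding D_def by auto
    moreover obtain q' M' where "regular A q'" "\<forall>j<m. regular (A - {i}) (M' j)"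
      "\<forall>x. h x = q' x * F x + (\<Sum>j<m. M' j x * x i ^ j)"
      using \<open>D h\<close> unfolding D_def by auto
    ultimately show ?thesis unfolding D_def
      by (intro exI[of _ "\<lambda>x. q x + q' x"] exI[of _ "\<lambda>j x. M j x + M' j x"])
        (auto intro: regular_add simp: algebra_simps sum.distrib)
  qed
  have D_mult: "D (\<lambda>x. a x * h x)" if "regular (A - {i}) a" "D h" for a h
  proof -
    obtain q M where "regular A q" "\<forall>j<m. regular (A - {i}) (M j)"
      "\<forall>x. h x = q x * F x + (\<Sum>j<m. M j x * x i ^ j)"
      using \<open>D h\<close> unfolding D_def by auto
    moreover have "regular A a" using that(1) by (rule regular_mono) auto
    ultimately show ?thesis unfolding D_def using that(1)
      by (intro exI[of _ "\<lambda>x. a x * q x"] exI[of _ "\<lambda>j x. a x * M j x"])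
        (auto intro: regular_mult simp: algebra_simps sum_distrib_left)
  qed
  have D_small: "D (\<lambda>x. x i ^ k)" if "k < m" for k
    unfolding D_def using that
    by (intro exI[of _ "\<lambda>_. 0"] exI[of _ "\<lambda>j _. if j = k then 1 else 0"])
      (auto intro: regular_const simp: if_distrib if_distribR cong: if_cong)
  have D_sum: "D (\<lambda>x. \<Sum>k\<in>S. g k x)" if "finite S" "\<And>k. k \<in> S \<Longrightarrow> D (g k)" for S :: "nat set" and g
    using that
  proof (induction S)
    case empty
    then show ?case using D_mult[OF regular_const D_small[OF \<open>m > 0\<close>], of 0] by simp
  next
    case (insert k S)
    then have "D (\<lambda>x. g k x + (\<Sum>k\<in>S. g k x))" by (intro D_add) auto
    with insert show ?case by simp
  qed
  have D_F: "D (\<lambda>x. q x * F x)" if "regular A q" for q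
    unfolding D_def using that by (intro exI[of _ q] exI[of _ "\<lambda>_ _. 0"]) (auto intro: regular_const)
  have D_power: "D (\<lambda>x. x i ^ k)" for k
  proof (induction k rule: less_induct)
    case (less k)
    show ?case
    proof (cases "k < m")
      case False
      \<comment> \<open>replace \<open>x i ^ m\<close> by \<open>F\<close> minus its lower terms\<close>
      have "x i ^ k = x i ^ (k - m) * F x + (\<Sum>j<m. (- 1 * c j x) * x i ^ (k - m + j))" for x
        using False unfolding F_def
        by (simp add: algebra_simps sum_distrib_left flip: power_add) (simp add: sum_negf)
      moreover have "D (\<lambda>x. x i ^ (k - m) * F x + (\<Sum>j<m. (- 1 * c j x) * x i ^ (k - m + j)))"
        using less False assms(2)
        by (intro D_add D_F D_sum D_mult regular_intros c) auto
      ultimately show ?thesis by presburger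
    qed (rule D_small)
  qed
  obtain s where "polyfun A s h" using assms(1) by (auto simp: regular_def)
  then obtain a where a: "\<And>j. j \<le> s \<Longrightarrow> polyfun (A - {i}) (s - j) (a j)"
      "\<And>x. h x = (\<Sum>j\<le>s. a j x * x i ^ j)"
    using polyfun_expand_in_variable[OF _ assms(2)] by blast
  have "D (\<lambda>x. \<Sum>j\<le>s. a j x * x i ^ j)"
    by (intro D_sum D_mult D_power) (auto intro: regularI a(1))
  then show ?thesis unfolding a(2)[symmetric] D_def F_def .
qed

text \<open>
  Closedness of the projection that forgets \<open>x i\<close>. A monic relation of degree \<open>m\<close> for \<open>x i\<close> leaves
  finitely many points of the space above \<open>z\<close> where it holds. If \<open>z\<close> is not in the image, then a combination
  \<open>g\<close> of equations of \<open>V\<close> is nonzero at all of these points. Multiplication by \<open>g\<close> on the polynomials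
  in \<open>x i\<close> modulo the relation has a matrix over the remaining variables. Its determinant, the norm of \<open>g\<close>,
  vanishes below \<open>V\<close>, where \<open>g = 0\<close> makes the powers of \<open>x i\<close> a kernel vector, and it does not vanish at \<open>z\<close>.
\<close>

lemma zariski_closed_forget_variable:
  fixes V :: "('j \<Rightarrow> 'a::alg_closed_field) set"
  assumes "i \<in> A" and V: "zariski_closed A V" and "m > 0"
    and c: "\<And>j. j < m \<Longrightarrow> regular (A - {i}) (c j)"
    and rel: "\<And>x. x \<in> V \<Longrightarrow> x i ^ m + (\<Sum>j<m. c j x * x i ^ j) = 0"
  shows "zariski_closed (A - {i}) ((\<lambda>x. fun_upd x i 0) ` V)"
proof (rule zariski_closedI)
  show "(\<lambda>x. fun_upd x i 0) ` V \<subseteq> affine_space (A - {i})"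
    using zariski_closed_subset[OF V] by (auto simp: affine_space_def)
next
  fix z :: "'j \<Rightarrow> 'a"
  assume z: "z \<in> affine_space (A - {i})" "z \<notin> (\<lambda>x. fun_upd x i 0) ` V"
  define F where "F x = x i ^ m + (\<Sum>j<m. c j x * x i ^ j)" for x
  have c_upd: "c j (x(i := t)) = c j x" if "j < m" for j x t
    using c[OF that] by (rule regular_cong_on) auto
  define p where "p = monom 1 m + (\<Sum>j<m. monom (c j z) j)"
  have poly_p: "poly p t = F (z(i := t))" for t
    unfolding p_def F_def by (simp add: poly_monom poly_sum c_upd)
  have deg_low: "degree (\<Sum>j<m. monom (b j) j) < m" for b :: "nat \<Rightarrow> 'a"
    by (rule degree_lessI) (use \<open>m > 0\<close> in \<open>auto simp: coeff_sum\<close>)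
  have deg_p: "degree p = m"
    unfolding p_def using deg_low by (subst degree_add_eq_left) (auto simp: degree_monom_eq)
  then have "p \<noteq> 0" using \<open>m > 0\<close> by auto
  define R where "R = {t. poly p t = 0}"
  have "finite R" unfolding R_def by (rule poly_roots_finite[OF \<open>p \<noteq> 0\<close>])
  have "\<exists>g. regular A g \<and> (\<forall>x\<in>V. g x = 0) \<and> g (z(i := t)) \<noteq> 0" for t
  proof (rule zariski_closedD[OF V])
    show "z(i := t) \<in> affine_space A" using z(1) \<open>i \<in> A\<close> by (auto simp: affine_space_def)
    have "z = (z(i := t))(i := 0)" using z(1) by (auto simp: affine_space_def)
    then show "z(i := t) \<notin> V" using z(2) by blast
  qed
  then obtain G where G: "\<And>t. regular A (G t)" "\<And>t x. x \<in> V \<Longrightarrow> G t x = 0"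
    "\<And>t. G t (z(i := t)) \<noteq> 0" by metis
  \<comment> \<open>interpolation: at the root \<open>t\<close>, all summands but the one of \<open>t\<close> vanish\<close>
  define g where "g x = (\<Sum>t\<in>R. G t x * (\<Prod>u\<in>R - {t}. x i - u))" for x
  have g_regular: "regular A g"
    unfolding g_def using \<open>i \<in> A\<close> by (intro regular_intros G)
  have g_X: "g x = 0" if "x \<in> V" for x using that by (simp add: g_def G)
  have g_R: "g (z(i := t)) \<noteq> 0" if "t \<in> R" for t
  proof -
    have "(\<Prod>u\<in>R - {s}. t - u) = 0" if "s \<in> R - {t}" for s
      using that \<open>t \<in> R\<close> \<open>finite R\<close> by (intro prod_zero bexI[of _ t]) auto
    then have "(\<Sum>s\<in>R - {t}. G s (z(i := t)) * (\<Prod>u\<in>R - {s}. (z(i := t)) i - u)) = 0"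
      by (intro sum.neutral) auto
    then have "g (z(i := t)) = G t (z(i := t)) * (\<Prod>u\<in>R - {t}. t - u)"
      unfolding g_def by (subst sum.remove[OF \<open>finite R\<close> that]) simp
    then show ?thesis using G(3) \<open>finite R\<close> by auto
  qed
  define reduces_to where "reduces_to k q M \<longleftrightarrow> regular A q \<and> (\<forall>j<m. regular (A - {i}) (M j)) \<and>
      (\<forall>x. x i ^ k * g x = q x * F x + (\<Sum>j<m. M j x * x i ^ j))" for k q and M :: "nat \<Rightarrow> _"
  have "\<exists>q M. reduces_to k q M" for k
    unfolding reduces_to_def F_def using g_regular assms(1,3) c
    by (intro regular_divide_by_monic regular_intros) auto
  then obtain q where "\<And>k. \<exists>M. reduces_to k (q k) M" by metis
  then obtain M where "\<And>k. reduces_to k (q k) (M k)" by metis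
  then have q: "\<And>k. regular A (q k)"
    and M: "\<And>k j. j < m \<Longrightarrow> regular (A - {i}) (M k j)"
    and qM: "\<And>k x. x i ^ k * g x = q k x * F x + (\<Sum>j<m. M k j x * x i ^ j)"
    by (simp_all add: reduces_to_def)
  have M_upd: "M k j (x(i := t)) = M k j x" if "j < m" for j k x t
    using M[OF that] by (rule regular_cong_on) auto
  define mt where "mt x = mat m m (\<lambda>(k, j). M k j x)" for x
  have mt: "mt x \<in> carrier_mat m m" for x by (simp add: mt_def)
  define N where "N x = det (mt x)" for x
  have "regular (A - {i}) N"
    unfolding N_def det_def'[OF mt]
  proof (intro regular_intros)
    fix \<pi> k assume "\<pi> \<in> {\<pi>. \<pi> permutes {0..<m}}" "k \<in> {0..<m}"
    then have "k < m" "\<pi> k < m" using permutes_in_image[of \<pi> "{0..<m}" k] by auto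
    then show "regular (A - {i}) (\<lambda>x. mt x $$ (k, \<pi> k))" by (simp add: mt_def M)
  qed
  moreover have "N x = 0" if "x \<in> (\<lambda>x. fun_upd x i 0) ` V" for x
  proof -
    obtain y where y: "y \<in> V" "x = y(i := 0)" using \<open>x \<in> _\<close> by auto
    define v where "v = vec m (\<lambda>j. y i ^ j)"
    have "v \<in> carrier_vec m" by (simp add: v_def)
    moreover have "v \<noteq> 0\<^sub>v m"
    proof
      assume "v = 0\<^sub>v m"
      then have "v $ 0 = 0\<^sub>v m $ 0" by simp
      then show False using \<open>m > 0\<close> by (simp add: v_def)
    qed
    moreover have "mt x *\<^sub>v v = 0\<^sub>v m"
    proof (rule eq_vecI)
      fix k assume "k < dim_vec (0\<^sub>v m :: 'a vec)"
      then have "k < m" by simp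
      then have "(mt x *\<^sub>v v) $ k = (\<Sum>j<m. M k j y * y i ^ j)"
        by (simp add: mt_def v_def scalar_prod_def lessThan_atLeast0 y M_upd)
      also have "\<dots> = 0" using qM[where k=k and x=y] g_X[OF y(1)] rel[OF y(1)] by (simp add: F_def)
      finally show "(mt x *\<^sub>v v) $ k = 0\<^sub>v m $ k" using \<open>k < m\<close> by simp
    qed (simp add: mt_def)
    ultimately show ?thesis unfolding N_def using det_0_iff_vec_prod_zero_field[OF mt] by blast
  qed
  moreover have "N z \<noteq> 0"
  proof
    assume "N z = 0"
    then have "det (transpose_mat (mt z)) = 0" unfolding N_def using det_transpose[OF mt] by simp
    then obtain v where v: "v \<in> carrier_vec m" "v \<noteq> 0\<^sub>v m" "transpose_mat (mt z) *\<^sub>v v = 0\<^sub>v m"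
      using det_0_iff_vec_prod_zero_field[of "transpose_mat (mt z)" m] mt by auto
    have vM: "(\<Sum>k<m. v $ k * M k j z) = 0" if "j < m" for j
    proof -
      have "(transpose_mat (mt z) *\<^sub>v v) $ j = (\<Sum>k<m. M k j z * v $ k)"
        using v(1) that by (simp add: mt_def scalar_prod_def lessThan_atLeast0)
      then show ?thesis using v(3) that by (simp add: mult.commute)
    qed
    define C where "C = (\<Sum>k<m. monom (v $ k) k)"
    have "\<exists>k<m. v $ k \<noteq> 0"
      using v(1,2) by (metis carrier_vecD eq_vecI index_zero_vec(1) index_zero_vec(2))
    then obtain k where "k < m" "v $ k \<noteq> 0" by auto
    moreover from this have "coeff C k = v $ k" by (simp add: C_def coeff_sum if_distrib cong: if_cong)
    ultimately have "C \<noteq> 0" by auto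
    obtain Pg where Pg: "\<And>t. g (z(i := t)) = poly Pg t"
      using regular_on_coordinate_line[OF g_regular, of z i] by auto
    obtain Q where Q: "\<And>k t. q k (z(i := t)) = poly (Q k) t"
      using regular_on_coordinate_line[OF q, of _ z i] by metis
    have "C * Pg = (\<Sum>k<m. smult (v $ k) (Q k)) * p"
    proof (rule poly_fun_eqD)
      fix t
      define y where "y = z(i := t)"
      have "poly (C * Pg) t = (\<Sum>k<m. v $ k * (t ^ k * g y))"
        by (simp add: C_def poly_sum poly_monom y_def Pg sum_distrib_right mult.assoc)
      also have "\<dots> = (\<Sum>k<m. v $ k * (q k y * F y + (\<Sum>j<m. M k j z * t ^ j)))"
      proof (rule sum.cong[OF refl])
        fix k
        have "t ^ k * g y = q k y * F y + (\<Sum>j<m. M k j y * t ^ j)"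
          using qM[where x=y and k=k] by (simp add: y_def)
        moreover have "(\<Sum>j<m. M k j y * t ^ j) = (\<Sum>j<m. M k j z * t ^ j)"
          by (rule sum.cong) (auto simp: y_def M_upd)
        ultimately show "v $ k * (t ^ k * g y) = v $ k * (q k y * F y + (\<Sum>j<m. M k j z * t ^ j))" by simp
      qed
      also have "\<dots> = (\<Sum>k<m. v $ k * q k y) * F y + (\<Sum>k<m. \<Sum>j<m. v $ k * M k j z * t ^ j)"
        by (simp add: distrib_left sum.distrib sum_distrib_left sum_distrib_right mult.assoc)
      also have "(\<Sum>k<m. \<Sum>j<m. v $ k * M k j z * t ^ j) = (\<Sum>j<m. (\<Sum>k<m. v $ k * M k j z) * t ^ j)"
        by (subst sum.swap) (simp add: sum_distrib_right)
      also have "\<dots> = 0" by (simp add: vM)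
      finally show "poly (C * Pg) t = poly ((\<Sum>k<m. smult (v $ k) (Q k)) * p) t"
        by (simp only: poly_mult poly_sum poly_smult Q[symmetric] poly_p y_def add_0_right)
    qed
    then have "p dvd C * Pg" by simp
    then have "p dvd C"
      by (rule monic_dvd_of_no_common_root[OF \<open>p \<noteq> 0\<close>]) (use g_R in \<open>auto simp: R_def Pg\<close>)
    then have "degree p \<le> degree C" using \<open>C \<noteq> 0\<close> by (rule dvd_imp_degree_le)
    then show False using deg_p deg_low unfolding C_def by (metis not_less)
  qed
  ultimately show "\<exists>g. regular (A - {i}) g \<and> (\<forall>x\<in>(\<lambda>x. fun_upd x i 0) ` V. g x = 0) \<and> g z \<noteq> 0"
    by blast
qed

section \<open>Counting polynomial functions\<close>

lemma underdetermined_system: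
  fixes M :: "'n \<Rightarrow> 'b \<Rightarrow> 'a::field"
  assumes "finite B" "finite N" "card B < card N"
  shows "\<exists>c. (\<exists>a\<in>N. c a \<noteq> 0) \<and> (\<forall>b\<in>B. (\<Sum>a\<in>N. c a * M a b) = 0)"
  using assms
proof (induction B arbitrary: N M rule: finite_induct)
  case empty
  then have "N \<noteq> {}" by auto
  then show ?case by (intro exI[of _ "\<lambda>_. 1"]) auto
next
  case (insert b B)
  show ?case
  proof (cases "\<forall>a\<in>N. M a b = 0")
    case True
    have "card B < card N" using insert by simp
    then obtain c where "\<exists>a\<in>N. c a \<noteq> 0" "\<forall>b\<in>B. (\<Sum>a\<in>N. c a * M a b) = 0"
      using insert.IH[OF insert.prems(1)] by blast
    then show ?thesis using True by (intro exI[of _ c]) auto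
  next
    case False
    then obtain a0 where a0: "a0 \<in> N" "M a0 b \<noteq> 0" by auto
    define N' where "N' = N - {a0}"
    have N': "finite N'" "a0 \<notin> N'" "N = insert a0 N'" using a0 insert.prems by (auto simp: N'_def)
    have "card B < card N'" using insert.hyps insert.prems N' by simp
    \<comment> \<open>use the unknown \<open>a0\<close> to eliminate the equation \<open>b\<close>\<close>
    then obtain c where c: "\<exists>a\<in>N'. c a \<noteq> 0"
        "\<forall>b'\<in>B. (\<Sum>a\<in>N'. c a * (M a b' - M a b / M a0 b * M a0 b')) = 0"
      using insert.IH[OF N'(1), of "\<lambda>a b'. M a b' - M a b / M a0 b * M a0 b'"] by blast
    define u where "u = - (\<Sum>a\<in>N'. c a * M a b) / M a0 b"
    define c' where "c' = c(a0 := u)"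
    have split: "(\<Sum>a\<in>N. c' a * M a b') = u * M a0 b' + (\<Sum>a\<in>N'. c a * M a b')" for b'
      using N' by (auto simp: c'_def intro!: sum.cong)
    have "(\<Sum>a\<in>N. c' a * M a b) = 0"
      unfolding split u_def using a0(2) by simp
    moreover have "(\<Sum>a\<in>N. c' a * M a b') = 0" if "b' \<in> B" for b'
    proof -
      have "0 = (\<Sum>a\<in>N'. c a * M a b') - (\<Sum>a\<in>N'. c a * M a b) / M a0 b * M a0 b'"
        using c(2) that
        by (simp add: right_diff_distrib sum_subtractf sum_divide_distrib sum_distrib_right mult.assoc)
      then show ?thesis unfolding split u_def by simp
    qed
    moreover have "\<exists>a\<in>N. c' a \<noteq> 0" using c(1) N' by (auto simp: c'_def)
    ultimately show ?thesis by (intro exI[of _ c']) auto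
  qed
qed

lemma sum_PiE_insert:
  assumes "i \<notin> A"
  shows "(\<Sum>e\<in>PiE (insert i A) (\<lambda>_. T). f e) = (\<Sum>j\<in>T. \<Sum>e\<in>PiE A (\<lambda>_. T). f (e(i := j)))"
proof -
  have "(\<Sum>e\<in>PiE (insert i A) (\<lambda>_. T). f e) =
      (\<Sum>p\<in>T \<times> PiE A (\<lambda>_. T). f ((snd p)(i := fst p)))"
    unfolding PiE_insert_eq
    by (subst sum.reindex[OF inj_combinator[OF assms]]) (simp add: case_prod_unfold comp_def)
  then show ?thesis by (simp add: sum.cartesian_product case_prod_unfold)
qed

lemma prod_fun_upd_insert:
  assumes "finite A" "i \<notin> A"
  shows "(\<Prod>k\<in>insert i A. x k ^ (e(i := j)) k) = x i ^ j * (\<Prod>k\<in>A. x k ^ e k)"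
proof -
  have "(\<Prod>k\<in>A. x k ^ (e(i := j)) k) = (\<Prod>k\<in>A. x k ^ e k)"
    using assms by (intro prod.cong) auto
  then show ?thesis using assms by simp
qed

text \<open>
  The individual exponents, rather than their sum, are bounded by \<open>s\<close>. This leaves at most \<open>(s + 1)\<^sup>n\<close> monomials in \<open>n\<close> variables, which
  is the order of magnitude that counts.
\<close>

lemma polyfun_sum_of_monomials:
  fixes f :: "('j \<Rightarrow> 'a::comm_ring_1) \<Rightarrow> 'a"
  assumes "finite A" "polyfun A s f"
  shows "\<exists>c. \<forall>x. f x = (\<Sum>e\<in>PiE A (\<lambda>_. {..s}). c e * (\<Prod>i\<in>A. x i ^ e i))"
  using assms
proof (induction A arbitrary: f rule: finite_induct)
  case empty
  have "f x = f undefined" for x using polyfun_cong_on[OF empty] by blast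
  then show ?case by (intro exI[of _ "\<lambda>_. f undefined"]) simp
next
  case (insert i A)
  obtain a where a: "\<And>j. j \<le> s \<Longrightarrow> polyfun (insert i A - {i}) (s - j) (a j)"
    "\<And>x. f x = (\<Sum>j\<le>s. a j x * x i ^ j)"
    using polyfun_expand_in_variable[OF insert.prems, of i] by blast
  have "\<exists>c. \<forall>x. a j x = (\<Sum>e\<in>PiE A (\<lambda>_. {..s}). c e * (\<Prod>i\<in>A. x i ^ e i))" if "j \<le> s" for j
    using insert.hyps(2) by (intro insert.IH polyfun_mono[OF a(1)[OF that]]) auto
  then have "\<exists>c. \<forall>j\<in>{..s}. \<forall>x. a j x = (\<Sum>e\<in>PiE A (\<lambda>_. {..s}). c j e * (\<Prod>i\<in>A. x i ^ e i))"
    by (intro bchoice ballI) auto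
  then obtain c where c: "\<And>j x. j \<le> s \<Longrightarrow>
      a j x = (\<Sum>e\<in>PiE A (\<lambda>_. {..s}). c j e * (\<Prod>i\<in>A. x i ^ e i))" by auto
  define c' where "c' e = c (e i) (e(i := undefined))" for e
  have c': "c' (e(i := j)) = c j e" if "e \<in> PiE A (\<lambda>_. {..s})" for e j
  proof -
    have "e(i := undefined) = e" using that insert.hyps(2) by (auto simp: PiE_def extensional_def)
    then show ?thesis by (simp add: c'_def)
  qed
  have "f x = (\<Sum>e\<in>PiE (insert i A) (\<lambda>_. {..s}). c' e * (\<Prod>i\<in>insert i A. x i ^ e i))" for x
    unfolding a(2) sum_PiE_insert[OF insert.hyps(2)] prod_fun_upd_insert[OF insert.hyps]
    by (intro sum.cong refl) (simp add: c c' sum_distrib_right mult.assoc mult.commute[of "x i ^ _"])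
  then show ?case by blast
qed

lemma monomials_independent:
  fixes c :: "('j \<Rightarrow> nat) \<Rightarrow> 'a::alg_closed_field"
  assumes "finite A" "\<And>x. (\<Sum>e\<in>PiE A (\<lambda>_. {..<t}). c e * (\<Prod>i\<in>A. x i ^ e i)) = 0"
    and "e \<in> PiE A (\<lambda>_. {..<t})"
  shows "c e = 0"
  using assms
proof (induction A arbitrary: c e rule: finite_induct)
  case empty
  then show ?case by simp
next
  case (insert i A)
  define S where "S j x = (\<Sum>e\<in>PiE A (\<lambda>_. {..<t}). c (e(i := j)) * (\<Prod>k\<in>A. x k ^ e k))" for j x
  have S_upd: "S j (x(i := u)) = S j x" for j x u
    unfolding S_def using insert.hyps(2) by (intro sum.cong refl arg_cong2[of _ _ _ _ "(*)"] prod.cong) auto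
  have "(\<Sum>j<t. S j x * u ^ j) = 0" for x u
    using insert.prems(1)[of "x(i := u)"]
    unfolding sum_PiE_insert[OF insert.hyps(2)] prod_fun_upd_insert[OF insert.hyps]
    by (subst S_upd[symmetric, of _ _ u]) (simp add: S_def sum_distrib_left sum_distrib_right algebra_simps)
  then have S0: "S j x = 0" if "j < t" for j x
    using polynomial_coeffs_zero[of "\<lambda>j. S j x" "{..<t}" j] that by auto
  have "e i < t" using insert.prems(2) by (auto simp: PiE_def Pi_def)
  moreover have "e(i := undefined) \<in> PiE A (\<lambda>_. {..<t})"
    using insert.prems(2) insert.hyps(2) by (auto simp: PiE_def Pi_def extensional_def)
  ultimately have "c ((e(i := undefined))(i := e i)) = 0"
    using insert.IH[of "\<lambda>e'. c (e'(i := e i))"] S0 unfolding S_def by blast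
  then show ?case by simp
qed

definition dependent_on :: "'p set \<Rightarrow> nat \<Rightarrow> (nat \<Rightarrow> 'p \<Rightarrow> 'a::field) \<Rightarrow> bool" where
  "dependent_on V N G \<longleftrightarrow> (\<exists>c. (\<exists>a<N. c a \<noteq> 0) \<and> (\<forall>x\<in>V. (\<Sum>a<N. c a * G a x) = 0))"

text \<open>
  In other words, the restrictions to \<open>V\<close> of the polynomials of degree at most \<open>s\<close> span a space of dimension at
  most \<open>C (s + 1)\<^sup>r\<close>. Linear relations transfer directly to subsets of \<open>V\<close> and to sets where the same functions vanish.
\<close>

definition growth_le :: "'j set \<Rightarrow> ('j \<Rightarrow> 'a::field) set \<Rightarrow> nat \<Rightarrow> bool" where
  "growth_le A V r \<longleftrightarrow>
     (\<exists>C. \<forall>s N G. C * (s + 1) ^ r < N \<longrightarrow> (\<forall>a<N. polyfun A s (G a)) \<longrightarrow> dependent_on V N G)"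

text \<open>
  The map \<open>(F\<^sub>0, \<dots>, F\<^sub>q\<^sub>-\<^sub>1)\<close> into \<open>K\<^sup>q\<close>. The entries from \<open>q\<close> on are \<open>0\<close>, as for all points of \<open>affine_space {..<q}\<close>.
\<close>

definition tuple :: "nat \<Rightarrow> (nat \<Rightarrow> 'p \<Rightarrow> 'a::zero) \<Rightarrow> 'p \<Rightarrow> nat \<Rightarrow> 'a" where
  "tuple q F x = (\<lambda>k. if k < q then F k x else 0)"

text \<open>
  Equivalently, the image of \<open>V\<close> under \<open>F\<close> is Zariski-dense in \<open>K\<^sup>q\<close>.
\<close>

definition alg_independent_on :: "'p set \<Rightarrow> nat \<Rightarrow> (nat \<Rightarrow> 'p \<Rightarrow> 'a::comm_ring_1) \<Rightarrow> bool" where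
  "alg_independent_on V q F \<longleftrightarrow>
     (\<forall>g. regular {..<q} g \<longrightarrow> (\<forall>x\<in>V. g (tuple q F x) = 0) \<longrightarrow> (\<forall>p. g p = 0))"

text \<open>
  The \<open>t\<^sup>q\<close> monomials in \<open>F\<close> with exponents less than \<open>t\<close> have degree \<open>O(t)\<close>. If \<open>q > r\<close>, then for large \<open>t\<close> they outnumber the
  dimension \<open>O(t\<^sup>r)\<close> of the space in which they lie, and a linear relation between them is an algebraic relation for \<open>F\<close>.
\<close>

lemma alg_independent_le_growth:
  fixes F :: "nat \<Rightarrow> ('j \<Rightarrow> 'a::alg_closed_field) \<Rightarrow> 'a"
  assumes "growth_le A V r" "alg_independent_on V q F" "\<And>k. k < q \<Longrightarrow> regular A (F k)"
  shows "q \<le> r"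
proof (rule ccontr)
  assume "\<not> q \<le> r"
  then have "r < q" by simp
  obtain C where C: "\<And>s N G. C * (s + 1) ^ r < N \<Longrightarrow> \<forall>a<N. polyfun A s (G a) \<Longrightarrow> dependent_on V N G"
    using assms(1) unfolding growth_le_def by blast
  obtain e where e: "\<And>k. k < q \<Longrightarrow> polyfun A (e k) (F k)"
    using assms(3) unfolding regular_def by metis
  define E where "E = (\<Sum>k<q. e k)"
  have E: "polyfun A E (F k)" if "k < q" for k
    using e[OF that] by (rule polyfun_mono) (use that in \<open>auto simp: E_def intro: member_le_sum\<close>)
  \<comment> \<open>large enough for \<open>C (q E t + 1)\<^sup>r \<le> C (q E + 1)\<^sup>r t\<^sup>r < t\<^sup>r\<^sup>+\<^sup>1\<close>\<close>
  define t where "t = C * (q * E + 1) ^ r + 1"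
  define T where "T = PiE {..<q} (\<lambda>_. {..<t})"
  have "card T = t ^ q" by (simp add: T_def card_PiE)
  have "finite T" by (simp add: T_def finite_PiE)
  obtain h where h: "bij_betw h {..<t ^ q} T"
    using ex_bij_betw_nat_finite[OF \<open>finite T\<close>] \<open>card T = t ^ q\<close> by (auto simp: lessThan_atLeast0)
  define G where "G a x = (\<Prod>k<q. F k x ^ h a k)" for a x
  \<comment> \<open>there are \<open>t ^ q\<close> monomials, of degree at most \<open>q t E\<close>\<close>
  have "C * (q * t * E + 1) ^ r \<le> C * ((q * E + 1) * t) ^ r"
    by (intro mult_left_mono power_mono) (auto simp: t_def algebra_simps)
  also have "\<dots> = C * (q * E + 1) ^ r * t ^ r" by (simp only: power_mult_distrib mult.assoc)
  also have "C * (q * E + 1) ^ r = t - 1" by (simp add: t_def)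
  also have "(t - 1) * t ^ r < t * t ^ r" by (intro mult_strict_right_mono) (auto simp: t_def)
  also have "\<dots> \<le> t ^ q"
    using power_increasing[of "Suc r" q t] \<open>r < q\<close> by (simp add: t_def)
  finally have "C * (q * t * E + 1) ^ r < t ^ q" .
  moreover have "\<forall>a<t ^ q. polyfun A (q * t * E) (G a)"
  proof (intro allI impI)
    fix a assume "a < t ^ q"
    then have "h a \<in> T" using h by (auto simp: bij_betw_def)
    then have "h a k < t" if "k < q" for k using that by (auto simp: T_def PiE_def Pi_def)
    then have "(\<Sum>k<q. h a k * E) \<le> (\<Sum>k<q. t * E)"
      by (intro sum_mono mult_right_mono) (auto intro: less_imp_le)
    moreover have "polyfun A (\<Sum>k<q. h a k * E) (G a)"
      unfolding G_def by (intro polyfun_prod polyfun_power E) auto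
    ultimately show "polyfun A (q * t * E) (G a)" by (auto intro: polyfun_mono simp: mult.assoc)
  qed
  ultimately have "dependent_on V (t ^ q) G" by (rule C)
  then obtain c where c: "\<exists>a<t ^ q. c a \<noteq> 0" "\<And>x. x \<in> V \<Longrightarrow> (\<Sum>a<t ^ q. c a * G a x) = 0"
    unfolding dependent_on_def by auto
  define g where "g p = (\<Sum>a<t ^ q. c a * (\<Prod>k<q. p k ^ h a k))" for p
  have "regular {..<q} g" unfolding g_def by (intro regular_intros) auto
  moreover have "g (tuple q F x) = 0" if "x \<in> V" for x
  proof -
    have "G a x = (\<Prod>k<q. tuple q F x k ^ h a k)" for a
      unfolding G_def by (rule prod.cong) (auto simp: tuple_def)
    then show ?thesis using c(2)[OF that] by (simp add: g_def)
  qed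
  ultimately have g0: "g p = 0" for p using assms(2) unfolding alg_independent_on_def by blast
  define c' where "c' e = c (inv_into {..<t ^ q} h e)" for e
  have c': "c' (h a) = c a" if "a < t ^ q" for a
    using that h by (simp add: c'_def bij_betw_def inv_into_f_f)
  have "(\<Sum>e\<in>T. c' e * (\<Prod>k<q. p k ^ e k)) = g p" for p
    unfolding g_def by (subst sum.reindex_bij_betw[OF h, symmetric]) (auto intro: sum.cong simp: c')
  then have "c' e = 0" if "e \<in> T" for e
    using monomials_independent[of "{..<q}" c' t e] g0 that by (simp add: T_def)
  then have "c a = 0" if "a < t ^ q" for a using that c'[OF that] h by (metis bij_betwE lessThan_iff)
  then show False using c(1) by blast
qed

section \<open>Linear projections of cones\<close>

definition cone :: "('j \<Rightarrow> 'a::comm_ring_1) set \<Rightarrow> bool" where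
  "cone V \<longleftrightarrow> (\<lambda>_. 0) \<in> V \<and> (\<forall>x\<in>V. \<forall>t. (\<lambda>i. t * x i) \<in> V)"

lemma polyfun_degree_0: "polyfun A s f \<Longrightarrow> s = 0 \<Longrightarrow> f x = f y"
  by (induction rule: polyfun.induct) auto

text \<open>
  If a cone does not contain the \<open>i\<close>-th unit vector \<open>e\<close>, then some homogeneous equation of it does not vanish at
  \<open>e\<close>. Its value at \<open>e\<close> is the coefficient of the pure power of \<open>x i\<close>, so that it can be made monic in \<open>x i\<close>.
\<close>

lemma cone_monic_relation:
  fixes V :: "('j \<Rightarrow> 'a::alg_closed_field) set"
  assumes "i \<in> B" "zariski_closed B V" "cone V" "(\<lambda>j. if j = i then 1 else 0) \<notin> V"
  shows "\<exists>m>0. \<exists>c. (\<forall>j<m. polyfun (B - {i}) (m - j) (c j)) \<and>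
    (\<forall>x\<in>V. x i ^ m + (\<Sum>j<m. c j x * x i ^ j) = 0)"
proof -
  define e :: "'j \<Rightarrow> 'a" where "e = (\<lambda>j. if j = i then 1 else 0)"
  have "e \<in> affine_space B" using assms(1) by (auto simp: affine_space_def e_def)
  then obtain g where g: "regular B g" "\<forall>x\<in>V. g x = 0" "g e \<noteq> 0"
    using zariski_closedD[OF assms(2)] assms(4) e_def by metis
  then obtain s where "polyfun B s g" by (auto simp: regular_def)
  then obtain F where F: "\<And>k. polyfun B k (F k)" "\<And>k. homog_fun k (F k)"
    "\<And>x. g x = (\<Sum>k\<le>s. F k x)"
    using polyfun_homogeneous_components by blast
  have F_V: "F k x = 0" if "x \<in> V" "k \<le> s" for k x
  proof (rule polynomial_coeffs_zero[of "\<lambda>k. F k x" "{..s}"])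
    fix t
    have "g (\<lambda>i. t * x i) = (\<Sum>k\<le>s. t ^ k * F k x)"
      unfolding F(3) using F(2) by (simp add: homog_fun_def)
    then show "(\<Sum>k\<in>{..s}. F k x * t ^ k) = 0"
      using g(2) assms(3) that(1) by (simp add: cone_def mult.commute)
  qed (use that in auto)
  have "\<exists>k\<le>s. F k e \<noteq> 0" using g(3) F(3) by (metis sum.neutral atMost_iff)
  then obtain k where k: "k \<le> s" "F k e \<noteq> 0" by auto
  obtain a where a: "\<And>j. j \<le> k \<Longrightarrow> polyfun (B - {i}) (k - j) (a j)"
    "\<And>x. F k x = (\<Sum>j\<le>k. a j x * x i ^ j)"
    using polyfun_expand_in_variable[OF F(1) assms(1)] by blast
  define \<alpha> where "\<alpha> = a k (\<lambda>_. 0)"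
  have a_k: "a k x = \<alpha>" for x
    using polyfun_degree_0[OF a(1)[of k]] by (simp add: \<alpha>_def)
  have "\<alpha> - F k e = 0"
  proof -
    have "(\<Sum>j\<le>k. (a j (\<lambda>_. 0) - (if j = k then F k e else 0)) * t ^ j) = 0" for t
    proof -
      have "t ^ k * F k e = F k (\<lambda>j. t * e j)" using F(2) by (simp add: homog_fun_def)
      also have "\<dots> = (\<Sum>j\<le>k. a j (\<lambda>_. 0) * t ^ j)"
        unfolding a(2)
      proof (intro sum.cong refl arg_cong2[of _ _ _ _ "(*)"])
        fix j assume "j \<in> {..k}"
        then show "a j (\<lambda>j. t * e j) = a j (\<lambda>_. 0)"
          by (intro polyfun_cong_on[OF a(1)]) (auto simp: e_def)
      qed (simp add: e_def)
      finally have "t ^ k * F k e = (\<Sum>j\<le>k. a j (\<lambda>_. 0) * t ^ j)" .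
      moreover have "(\<Sum>j\<le>k. (if j = k then F k e else 0) * t ^ j) = t ^ k * F k e"
        by (simp add: if_distrib if_distribR mult.commute cong: if_cong)
      ultimately show ?thesis by (simp only: left_diff_distrib sum_subtractf diff_self)
    qed
    then show ?thesis
      using polynomial_coeffs_zero[of "\<lambda>j. a j (\<lambda>_. 0) - (if j = k then F k e else 0)" "{..k}" k]
      by (simp add: \<alpha>_def)
  qed
  then have "\<alpha> \<noteq> 0" using k(2) by simp
  have rel: "\<alpha> * x i ^ k + (\<Sum>j<k. a j x * x i ^ j) = 0" if "x \<in> V" for x
    using F_V[OF that k(1)] unfolding a(2) by (simp add: lessThan_Suc_atMost[symmetric] a_k add.commute)
  have "(\<lambda>_. 0) \<in> V" using assms(3) by (simp add: cone_def)
  then have "k \<noteq> 0" using rel[of "\<lambda>_. 0"] \<open>\<alpha> \<noteq> 0\<close> by (intro notI) simp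
  moreover have "x i ^ k + (\<Sum>j<k. (inverse \<alpha> * a j x) * x i ^ j) = 0" if "x \<in> V" for x
  proof -
    have "inverse \<alpha> * (\<alpha> * x i ^ k + (\<Sum>j<k. a j x * x i ^ j)) = 0" using rel[OF that] by simp
    then show ?thesis using \<open>\<alpha> \<noteq> 0\<close> by (simp add: distrib_left sum_distrib_left mult.assoc[symmetric])
  qed
  ultimately show ?thesis
    using a(1) by (intro exI[of _ k] conjI exI[of _ "\<lambda>j x. inverse \<alpha> * a j x"]) (auto intro: polyfun_cmult)
qed

definition linear_form :: "'j set \<Rightarrow> (('j \<Rightarrow> 'a::comm_ring_1) \<Rightarrow> 'a) \<Rightarrow> bool" where
  "linear_form A l \<longleftrightarrow> polyfun A 1 l \<and> homog_fun 1 l"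

definition forget :: "'b set \<Rightarrow> ('b \<Rightarrow> 'a::zero) \<Rightarrow> 'b \<Rightarrow> 'a" where
  "forget J x = (\<lambda>b. if b \<in> J then 0 else x b)"

text \<open>
  The linear subspace \<open>y = 0\<close> of codimension \<open>r\<close> meets the cone \<open>V\<close> only in \<open>0\<close>. It follows that the projection \<open>y : V \<rightarrow> K\<^sup>r\<close> is a
  finite morphism. For the proof, \<open>V\<close> is replaced by the graph of \<open>y\<close> over it, in \<open>K\<^sup>A \<times> K\<^sup>r\<close>, and the coordinates of \<open>K\<^sup>A\<close> are
  eliminated one at a time.
\<close>

locale projected_cone =
  fixes A :: "'j set" and V :: "('j \<Rightarrow> 'a::alg_closed_field) set"
    and r :: nat and y :: "nat \<Rightarrow> ('j \<Rightarrow> 'a) \<Rightarrow> 'a"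
  assumes fin: "finite A" and closed_V: "zariski_closed A V" and cone_V: "cone V"
    and forms: "\<And>k. k < r \<Longrightarrow> linear_form A (y k)"
    and trivial_kernel: "\<And>x. x \<in> V \<Longrightarrow> \<forall>k<r. y k x = 0 \<Longrightarrow> x = (\<lambda>_. 0)"
begin

definition lift :: "('j \<Rightarrow> 'a) \<Rightarrow> 'j + nat \<Rightarrow> 'a" where
  "lift x = case_sum x (tuple r y x)"

lemma y_scale: "k < r \<Longrightarrow> y k (\<lambda>i. t * x i) = t * y k x"
  using forms by (simp add: linear_form_def homog_fun_def)

lemma y_zero: "k < r \<Longrightarrow> y k (\<lambda>_. 0) = 0"
  using y_scale[of k 0 "\<lambda>_. 0"] by simp

lemma tuple_scale: "tuple r y (\<lambda>i. t * x i) = (\<lambda>k. t * tuple r y x k)"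
  by (auto simp: tuple_def y_scale)

lemma regular_y: "k < r \<Longrightarrow> regular A (y k)"
  using forms by (auto simp: linear_form_def intro: regularI)

lemma zariski_closed_graph:
  assumes Y: "zariski_closed A Y"
  shows "zariski_closed (A <+> {..<r}) (lift ` Y)"
proof (rule zariski_closedI)
  show "lift ` Y \<subseteq> affine_space (A <+> {..<r})"
  proof
    fix w assume "w \<in> lift ` Y"
    then obtain x where "x \<in> affine_space A" "w = lift x" using zariski_closed_subset[OF Y] by auto
    then show "w \<in> affine_space (A <+> {..<r})"
      by (auto simp: affine_space_def lift_def tuple_def split: sum.splits)
  qed
next
  fix w :: "'j + nat \<Rightarrow> 'a"
  assume w: "w \<in> affine_space (A <+> {..<r})" "w \<notin> lift ` Y"
  define x where "x = (\<lambda>i. w (Inl i))"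
  have x: "x \<in> affine_space A" using w(1) by (auto simp: affine_space_def x_def)
  show "\<exists>g. regular (A <+> {..<r}) g \<and> (\<forall>u\<in>lift ` Y. g u = 0) \<and> g w \<noteq> 0"
  proof (cases "x \<in> Y")
    case False
    then obtain g where g: "regular A g" "\<forall>x\<in>Y. g x = 0" "g x \<noteq> 0"
      using zariski_closedD[OF Y x] by blast
    have "regular (A <+> {..<r}) (\<lambda>w. g (\<lambda>i. w (Inl i)))"
      using g(1) by (rule regular_compose) (auto intro: regular_coord)
    then show ?thesis using g(2,3)
      by (intro exI[of _ "\<lambda>w. g (\<lambda>i. w (Inl i))"]) (auto simp: lift_def x_def)
  next
    case True
    have "\<exists>k<r. w (Inr k) \<noteq> y k x"
    proof (rule ccontr)
      assume "\<not> ?thesis"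
      then have "w b = lift x b" for b
        using w(1) by (cases b) (auto simp: lift_def x_def tuple_def affine_space_def)
      then show False using w(2) True by blast
    qed
    then obtain k where k: "k < r" "w (Inr k) \<noteq> y k x" by auto
    have "regular (A <+> {..<r}) (\<lambda>w. w (Inr k) - y k (\<lambda>i. w (Inl i)))"
      using k(1) by (intro regular_diff regular_compose[OF regular_y[OF k(1)]] regular_coord) auto
    then show ?thesis using k
      by (intro exI[of _ "\<lambda>w. w (Inr k) - y k (\<lambda>i. w (Inl i))"]) (auto simp: lift_def tuple_def x_def)
  qed
qed

text \<open>
  After elimination of the coordinates in \<open>J\<close>, the image of the graph is still a cone on which \<open>y = 0\<close> only at \<open>0\<close>. It thus
  does not contain the unit vector of the next coordinate \<open>i\<close>.
\<close>

lemma monic_relation_step: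
  assumes "J \<subseteq> A" "i \<in> A - J"
    and closed_J: "zariski_closed ((A - J) <+> {..<r}) (forget (Inl ` J) ` lift ` V)"
  shows "\<exists>m>0. \<exists>c. (\<forall>j<m. polyfun ((A - J) <+> {..<r} - {Inl i}) (m - j) (c j)) \<and>
    (\<forall>w\<in>forget (Inl ` J) ` lift ` V. w (Inl i) ^ m + (\<Sum>j<m. c j w * w (Inl i) ^ j) = 0)"
proof (rule cone_monic_relation[OF _ closed_J])
  show "Inl i \<in> (A - J) <+> {..<r}" using assms by auto
next
  have scale: "(\<lambda>b. t * forget (Inl ` J) (lift x) b) = forget (Inl ` J) (lift (\<lambda>i. t * x i))" for t x
    by (auto simp: forget_def lift_def tuple_scale fun_eq_iff split: sum.splits)
  have zero: "forget (Inl ` J) (lift (\<lambda>_. 0)) = (\<lambda>_. 0)"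
    by (auto simp: forget_def lift_def tuple_def y_zero fun_eq_iff split: sum.splits)
  show "cone (forget (Inl ` J) ` lift ` V)"
    unfolding cone_def
  proof (intro conjI ballI allI)
    show "(\<lambda>_. 0) \<in> forget (Inl ` J) ` lift ` V"
      using cone_V zero unfolding cone_def by (metis imageI)
  next
    fix w t assume "w \<in> forget (Inl ` J) ` lift ` V"
    then obtain x where "x \<in> V" "w = forget (Inl ` J) (lift x)" by auto
    then show "(\<lambda>b. t * w b) \<in> forget (Inl ` J) ` lift ` V"
      using cone_V scale by (auto simp: cone_def)
  qed
  show "(\<lambda>b. if b = Inl i then 1 else 0) \<notin> forget (Inl ` J) ` lift ` V"
  proof
    assume "(\<lambda>b. if b = Inl i then 1 else 0) \<in> forget (Inl ` J) ` lift ` V"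
    then obtain x where x: "x \<in> V" and eq: "(\<lambda>b. if b = Inl i then 1 else 0) = forget (Inl ` J) (lift x)"
      by auto
    have "y k x = 0" if "k < r" for k
      using fun_cong[OF eq, of "Inr k"] that by (auto simp: forget_def lift_def tuple_def image_iff split: if_splits)
    then have "x = (\<lambda>_. 0)" using trivial_kernel x by blast
    then show False using fun_cong[OF eq, of "Inl i"] assms(2)
      by (auto simp: forget_def lift_def image_iff split: if_splits)
  qed
qed

text \<open>
  The relation that makes \<open>x i\<close> integral holds on the image of the whole cone \<open>V\<close>, and is inherited by the images of
  closed subsets, which may fail to be cones.
\<close>

lemma zariski_closed_forget:
  assumes "finite J" "J \<subseteq> A" "zariski_closed A Y" "Y \<subseteq> V"
  shows "zariski_closed ((A - J) <+> {..<r}) (forget (Inl ` J) ` lift ` Y)"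
  using assms
proof (induction J arbitrary: Y rule: finite_induct)
  case empty
  then show ?case using zariski_closed_graph by (simp add: forget_def)
next
  case (insert i J)
  let ?B = "(A - J) <+> {..<r}"
  have i: "i \<in> A - J" using insert by auto
  have V_J: "zariski_closed ?B (forget (Inl ` J) ` lift ` V)"
    using insert.IH[OF _ closed_V] insert.prems by auto
  have "J \<subseteq> A" using insert.prems by simp
  obtain m c where m: "m > 0" "\<forall>j<m. polyfun (?B - {Inl i}) (m - j) (c j)"
    and rel: "\<forall>w\<in>forget (Inl ` J) ` lift ` V. w (Inl i) ^ m + (\<Sum>j<m. c j w * w (Inl i) ^ j) = 0"
    using monic_relation_step[OF \<open>J \<subseteq> A\<close> i V_J] by (elim exE conjE) (rule that)
  have Y_J: "zariski_closed ?B (forget (Inl ` J) ` lift ` Y)"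
    using insert.IH insert.prems by auto
  have "zariski_closed (?B - {Inl i}) ((\<lambda>w. fun_upd w (Inl i) 0) ` forget (Inl ` J) ` lift ` Y)"
  proof (rule zariski_closed_forget_variable[OF _ Y_J m(1)])
    show "Inl i \<in> ?B" using i by auto
    show "regular (?B - {Inl i}) (c j)" if "j < m" for j
      using m(2) that by (blast intro: regularI)
    show "w (Inl i) ^ m + (\<Sum>j<m. c j w * w (Inl i) ^ j) = 0" if "w \<in> forget (Inl ` J) ` lift ` Y" for w
      using rel that insert.prems by blast
  qed
  moreover have "?B - {Inl i} = (A - insert i J) <+> {..<r}" by auto
  moreover have "(\<lambda>w. fun_upd w (Inl i) 0) ` forget (Inl ` J) ` lift ` Y = forget (Inl ` insert i J) ` lift ` Y"
    unfolding image_image by (rule image_cong) (auto simp: forget_def fun_eq_iff)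
  ultimately show ?case by simp
qed

lemma zariski_closed_projection:
  assumes Y: "zariski_closed A Y" "Y \<subseteq> V"
  shows "zariski_closed {..<r} (tuple r y ` Y)"
proof -
  define G where "G b p = case_sum (\<lambda>_. 0) (\<lambda>k. if k < r then p k else 0) b" for b :: "'j + nat" and p :: "nat \<Rightarrow> 'a"
  have cl: "zariski_closed ((A - A) <+> {..<r}) (forget (Inl ` A) ` lift ` Y)"
    using zariski_closed_forget[OF fin _ Y] by simp
  have "zariski_closed {..<r} {p \<in> affine_space {..<r}. (\<lambda>b. G b p) \<in> forget (Inl ` A) ` lift ` Y}"
    by (rule zariski_closed_vimage[OF cl])
      (auto simp: G_def intro!: regular_coord split: sum.splits)
  moreover have "{p \<in> affine_space {..<r}. (\<lambda>b. G b p) \<in> forget (Inl ` A) ` lift ` Y} = tuple r y ` Y"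
  proof (intro equalityI subsetI)
    fix p assume "p \<in> {p \<in> affine_space {..<r}. (\<lambda>b. G b p) \<in> forget (Inl ` A) ` lift ` Y}"
    then obtain x where p: "p \<in> affine_space {..<r}" "x \<in> Y" "(\<lambda>b. G b p) = forget (Inl ` A) (lift x)"
      by auto
    have "p k = tuple r y x k" for k
      using fun_cong[OF p(3), of "Inr k"] p(1)
      by (cases "k < r") (auto simp: G_def forget_def lift_def tuple_def affine_space_def)
    then show "p \<in> tuple r y ` Y" using p(2) by blast
  next
    fix p assume "p \<in> tuple r y ` Y"
    then obtain x where x: "x \<in> Y" "p = tuple r y x" by auto
    have "x \<in> affine_space A" using x zariski_closed_subset[OF Y(1)] by auto
    then have "(\<lambda>b. G b p) = forget (Inl ` A) (lift x)"
      by (auto simp: x G_def forget_def lift_def tuple_def affine_space_def fun_eq_iff split: sum.splits)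
    then show "p \<in> {p \<in> affine_space {..<r}. (\<lambda>b. G b p) \<in> forget (Inl ` A) ` lift ` Y}"
      using x by (auto simp: affine_space_def tuple_def)
  qed
  ultimately show ?thesis by simp
qed

definition integral_relation :: "'j \<Rightarrow> nat \<Rightarrow> (nat \<Rightarrow> (nat \<Rightarrow> 'a) \<Rightarrow> 'a) \<Rightarrow> bool" where
  "integral_relation i m c \<longleftrightarrow> m > 0 \<and> (\<forall>j<m. polyfun {..<r} (m - j) (c j)) \<and>
    (\<forall>x\<in>V. x i ^ m + (\<Sum>j<m. c j (tuple r y x) * x i ^ j) = 0)"

text \<open>
  Eliminate all coordinates other than \<open>x i\<close>.
\<close>

lemma coordinate_integral:
  assumes "i \<in> A"
  shows "\<exists>m c. integral_relation i m c"
proof -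
  define J where "J = A - {i}"
  have J: "finite J" "J \<subseteq> A" "i \<in> A - J" using fin assms by (auto simp: J_def)
  obtain m c where m: "m > 0" "\<forall>j<m. polyfun ((A - J) <+> {..<r} - {Inl i}) (m - j) (c j)"
    and rel: "\<forall>w\<in>forget (Inl ` J) ` lift ` V. w (Inl i) ^ m + (\<Sum>j<m. c j w * w (Inl i) ^ j) = 0"
    using monic_relation_step[OF J(2,3) zariski_closed_forget[OF J(1,2) closed_V order_refl]]
    by (elim exE conjE) (rule that)
  define c' where "c' j p = c j (\<lambda>b. case b of Inl _ \<Rightarrow> 0 | Inr k \<Rightarrow> p k)" for j p
  have coord: "polyfun {..<r} 1 (\<lambda>p. case b of Inl _ \<Rightarrow> 0 | Inr k \<Rightarrow> p k)"
    if "b \<in> (A - J) <+> {..<r} - {Inl i}" for b :: "'j + nat"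
    using that assms by (auto simp: J_def intro: polyfun.intros)
  have "polyfun {..<r} (m - j) (c' j)" if "j < m" for j
    using polyfun_compose[OF m(2)[rule_format, OF that] coord] by (simp add: c'_def[abs_def])
  moreover have "x i ^ m + (\<Sum>j<m. c' j (tuple r y x) * x i ^ j) = 0" if "x \<in> V" for x
  proof -
    define w where "w = forget (Inl ` J) (lift x)"
    have wi: "w (Inl i) = x i" using J(3) by (auto simp: w_def forget_def lift_def)
    have "c j w = c' j (tuple r y x)" if "j < m" for j
      unfolding c'_def by (rule polyfun_cong_on[OF m(2)[rule_format, OF that]]) (auto simp: J_def w_def forget_def lift_def)
    moreover have "w (Inl i) ^ m + (\<Sum>j<m. c j w * w (Inl i) ^ j) = 0" using rel that by (simp add: w_def)
    ultimately show ?thesis unfolding wi by simp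
  qed
  ultimately show ?thesis
    using m(1) unfolding integral_relation_def by (intro exI[of _ m] exI[of _ c']) auto
qed

definition power_expansion :: "'j \<Rightarrow> nat \<Rightarrow> nat \<Rightarrow> (nat \<Rightarrow> (nat \<Rightarrow> 'a) \<Rightarrow> 'a) \<Rightarrow> bool" where
  "power_expansion i m e g \<longleftrightarrow> (\<forall>b. polyfun {..<r} e (g b)) \<and>
     (\<forall>x\<in>V. x i ^ e = (\<Sum>b<m. g b (tuple r y x) * x i ^ b))"

lemma power_reduction:
  assumes "integral_relation i m c"
  shows "\<exists>g. power_expansion i m e g"
proof (induction e rule: less_induct)
  case (less e)
  have c: "\<forall>j<m. polyfun {..<r} (m - j) (c j)"
    and rel: "\<forall>x\<in>V. x i ^ m + (\<Sum>j<m. c j (tuple r y x) * x i ^ j) = 0"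
    using assms by (auto simp: integral_relation_def)
  show ?case
  proof (cases "e < m")
    case True
    then have "x i ^ e = (\<Sum>b<m. (if b = e then 1 else 0) * x i ^ b)" for x :: "'j \<Rightarrow> 'a"
      by (simp add: if_distrib if_distribR cong: if_cong)
    then show ?thesis unfolding power_expansion_def
      by (intro exI[of _ "\<lambda>b _. if b = e then 1 else 0"]) (auto intro: polyfun_const)
  next
    case False
    then have "\<exists>g. power_expansion i m (e - m + j) g" if "j < m" for j
      using that by (intro less) auto
    then obtain g where "\<And>j. j < m \<Longrightarrow> power_expansion i m (e - m + j) (g j)" by metis
    then have g: "\<And>j b. j < m \<Longrightarrow> polyfun {..<r} (e - m + j) (g j b)"
      "\<And>j x. j < m \<Longrightarrow> x \<in> V \<Longrightarrow> x i ^ (e - m + j) = (\<Sum>b<m. g j b (tuple r y x) * x i ^ b)"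
      by (simp_all add: power_expansion_def)
    define g' where "g' b p = (\<Sum>j<m. - 1 * (c j p * g j b p))" for b p
    have "polyfun {..<r} e (g' b)" for b
      unfolding g'_def
    proof (intro polyfun_sum polyfun_cmult)
      fix j assume "j \<in> {..<m}"
      then have "polyfun {..<r} ((m - j) + (e - m + j)) (\<lambda>p. c j p * g j b p)"
        using c g(1) by (intro polyfun_mult) auto
      then show "polyfun {..<r} e (\<lambda>p. c j p * g j b p)"
        using False \<open>j \<in> {..<m}\<close> by simp
    qed
    moreover have "x i ^ e = (\<Sum>b<m. g' b (tuple r y x) * x i ^ b)" if "x \<in> V" for x
    proof -
      have "x i ^ m = (\<Sum>j<m. - 1 * (c j (tuple r y x) * x i ^ j))"
        using rel that by (simp add: sum_negf eq_neg_iff_add_eq_0)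
      then have "x i ^ (e - m) * x i ^ m = (\<Sum>j<m. - 1 * (c j (tuple r y x) * x i ^ (e - m + j)))"
        by (simp add: sum_distrib_left power_add algebra_simps)
      also have "x i ^ (e - m) * x i ^ m = x i ^ e" using False by (simp flip: power_add)
      also have "(\<Sum>j<m. - 1 * (c j (tuple r y x) * x i ^ (e - m + j))) =
          (\<Sum>j<m. \<Sum>b<m. - 1 * (c j (tuple r y x) * g j b (tuple r y x)) * x i ^ b)"
        using g(2) that by (intro sum.cong refl) (simp add: sum_distrib_left mult.assoc sum_negf)
      also have "\<dots> = (\<Sum>b<m. g' b (tuple r y x) * x i ^ b)"
        unfolding g'_def sum_distrib_right by (rule sum.swap)
      finally show ?thesis .
    qed
    ultimately show ?thesis unfolding power_expansion_def by blast
  qed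
qed

text \<open>
  As a module over \<open>K[y]\<close>, the functions on \<open>V\<close> are generated by the finitely many monomials whose exponents are less than
  the degrees of the integral relations, and \<open>K[y]\<close> has \<open>O(s\<^sup>r)\<close> monomials of degree at most \<open>O(s)\<close>.
\<close>

lemma growth_le_V: "growth_le A V r"
proof -
  obtain m c where "\<And>i. i \<in> A \<Longrightarrow> integral_relation i (m i) (c i)"
    using coordinate_integral by metis
  then have "\<exists>g. power_expansion i (m i) e g" if "i \<in> A" for i e
    using power_reduction that by blast
  then obtain g where "\<And>i e. i \<in> A \<Longrightarrow> power_expansion i (m i) e (g i e)" by metis
  then have g: "\<And>i e b. i \<in> A \<Longrightarrow> polyfun {..<r} e (g i e b)"
    "\<And>i e x. i \<in> A \<Longrightarrow> x \<in> V \<Longrightarrow> x i ^ e = (\<Sum>b<m i. g i e b (tuple r y x) * x i ^ b)"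
    by (simp_all add: power_expansion_def)
  define n where "n = card A"
  define \<B> where "\<B> = PiE A (\<lambda>i. {..<m i})"
  define \<Gamma> where "\<Gamma> s = PiE {..<r} (\<lambda>_. {..n * s})" for s
  define B where "B \<beta> \<gamma> x = (\<Prod>i\<in>A. x i ^ \<beta> i) * (\<Prod>k<r. tuple r y x k ^ \<gamma> k)"
    for \<beta> :: "'j \<Rightarrow> nat" and \<gamma> :: "nat \<Rightarrow> nat" and x :: "'j \<Rightarrow> 'a"
  have fin_\<B>: "finite \<B>" "finite (\<Gamma> s)" for s by (auto simp: \<B>_def \<Gamma>_def fin intro!: finite_PiE)
  have spanned: "\<exists>M. \<forall>x\<in>V. f x = (\<Sum>\<beta>\<in>\<B>. \<Sum>\<gamma>\<in>\<Gamma> s. M (\<beta>, \<gamma>) * B \<beta> \<gamma> x)"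
    if "polyfun A s f" for f s
  proof -
    obtain a where a: "\<And>x. f x = (\<Sum>e\<in>PiE A (\<lambda>_. {..s}). a e * (\<Prod>i\<in>A. x i ^ e i))"
      using polyfun_sum_of_monomials[OF fin \<open>polyfun A s f\<close>] by blast
    define h where "h \<beta> p = (\<Sum>e\<in>PiE A (\<lambda>_. {..s}). a e * (\<Prod>i\<in>A. g i (e i) (\<beta> i) p))" for \<beta> p
    have "polyfun {..<r} (n * s) (h \<beta>)" for \<beta>
      unfolding h_def
    proof (intro polyfun_sum polyfun_cmult)
      fix e assume e: "e \<in> PiE A (\<lambda>_. {..s})"
      have "polyfun {..<r} (\<Sum>i\<in>A. e i) (\<lambda>p. \<Prod>i\<in>A. g i (e i) (\<beta> i) p)"
        by (intro polyfun_prod g(1))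
      moreover have "(\<Sum>i\<in>A. e i) \<le> n * s"
        unfolding n_def using e sum_bounded_above[of A e s] by (auto simp: PiE_def Pi_def)
      ultimately show "polyfun {..<r} (n * s) (\<lambda>p. \<Prod>i\<in>A. g i (e i) (\<beta> i) p)"
        by (auto intro: polyfun_mono)
    qed
    then have "\<exists>b. \<forall>p. h \<beta> p = (\<Sum>\<gamma>\<in>\<Gamma> s. b \<gamma> * (\<Prod>k<r. p k ^ \<gamma> k))" for \<beta>
      unfolding \<Gamma>_def by (intro polyfun_sum_of_monomials) auto
    then have "\<exists>b. \<forall>\<beta> p. h \<beta> p = (\<Sum>\<gamma>\<in>\<Gamma> s. b \<beta> \<gamma> * (\<Prod>k<r. p k ^ \<gamma> k))" by (intro choice allI)
    then obtain b where b: "\<And>\<beta> p. h \<beta> p = (\<Sum>\<gamma>\<in>\<Gamma> s. b \<beta> \<gamma> * (\<Prod>k<r. p k ^ \<gamma> k))" by auto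
    have "f x = (\<Sum>\<beta>\<in>\<B>. \<Sum>\<gamma>\<in>\<Gamma> s. b \<beta> \<gamma> * B \<beta> \<gamma> x)" if "x \<in> V" for x
    proof -
      have expand: "(\<Prod>i\<in>A. x i ^ e i) =
          (\<Sum>\<beta>\<in>\<B>. (\<Prod>i\<in>A. g i (e i) (\<beta> i) (tuple r y x)) * (\<Prod>i\<in>A. x i ^ \<beta> i))" for e
      proof -
        have "(\<Prod>i\<in>A. x i ^ e i) = (\<Prod>i\<in>A. \<Sum>b<m i. g i (e i) b (tuple r y x) * x i ^ b)"
          using g(2) that by (intro prod.cong) auto
        also have "\<dots> = (\<Sum>\<beta>\<in>\<B>. \<Prod>i\<in>A. g i (e i) (\<beta> i) (tuple r y x) * x i ^ \<beta> i)"
          unfolding \<B>_def by (rule prod_sum_PiE) (auto simp: fin)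
        finally show ?thesis by (simp add: prod.distrib)
      qed
      have "f x = (\<Sum>e\<in>PiE A (\<lambda>_. {..s}). \<Sum>\<beta>\<in>\<B>.
          (a e * (\<Prod>i\<in>A. g i (e i) (\<beta> i) (tuple r y x))) * (\<Prod>i\<in>A. x i ^ \<beta> i))"
        unfolding a by (intro sum.cong refl, subst expand) (simp add: sum_distrib_left mult.assoc)
      also have "\<dots> = (\<Sum>\<beta>\<in>\<B>. h \<beta> (tuple r y x) * (\<Prod>i\<in>A. x i ^ \<beta> i))"
        unfolding h_def sum_distrib_right by (rule sum.swap)
      also have "\<dots> = (\<Sum>\<beta>\<in>\<B>. \<Sum>\<gamma>\<in>\<Gamma> s. b \<beta> \<gamma> * B \<beta> \<gamma> x)"
        unfolding b B_def by (simp add: sum_distrib_left sum_distrib_right mult.assoc mult.commute mult.left_commute)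
      finally show ?thesis .
    qed
    then show ?thesis by (intro exI[of _ "\<lambda>(\<beta>, \<gamma>). b \<beta> \<gamma>"]) auto
  qed
  define C where "C = (\<Prod>i\<in>A. m i) * (n + 1) ^ r"
  show ?thesis
    unfolding growth_le_def
  proof (intro exI[of _ C] allI impI)
    fix s N and G :: "nat \<Rightarrow> ('j \<Rightarrow> 'a) \<Rightarrow> 'a"
    assume N: "C * (s + 1) ^ r < N" and "\<forall>a<N. polyfun A s (G a)"
    define expands where
      "expands f M \<longleftrightarrow> (\<forall>x\<in>V. f x = (\<Sum>\<beta>\<in>\<B>. \<Sum>\<gamma>\<in>\<Gamma> s. M (\<beta>, \<gamma>) * B \<beta> \<gamma> x))" for f M
    have "\<exists>M. expands (G a) M" if "a < N" for a
      unfolding expands_def using that \<open>\<forall>a<N. polyfun A s (G a)\<close> by (intro spanned) auto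
    then obtain M where "\<And>a. a < N \<Longrightarrow> expands (G a) (M a)" by metis
    then have M: "G a x = (\<Sum>b\<in>\<B> \<times> \<Gamma> s. M a b * B (fst b) (snd b) x)" if "a < N" "x \<in> V" for a x
      using that by (simp add: expands_def sum.cartesian_product case_prod_unfold)
    have "card (\<B> \<times> \<Gamma> s) = (\<Prod>i\<in>A. m i) * (n * s + 1) ^ r"
      by (simp add: \<B>_def \<Gamma>_def card_cartesian_product card_PiE fin)
    also have "\<dots> \<le> (\<Prod>i\<in>A. m i) * ((n + 1) * (s + 1)) ^ r"
      by (intro mult_left_mono power_mono) auto
    also have "\<dots> = C * (s + 1) ^ r" by (simp only: C_def power_mult_distrib mult.assoc)
    also have "\<dots> < card {..<N}" using N by simp
    finally obtain u where u: "\<exists>a\<in>{..<N}. u a \<noteq> 0" "\<forall>b\<in>\<B> \<times> \<Gamma> s. (\<Sum>a<N. u a * M a b) = 0"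
      using underdetermined_system[of "\<B> \<times> \<Gamma> s" "{..<N}" M] fin_\<B> by auto
    have "(\<Sum>a<N. u a * G a x) = 0" if "x \<in> V" for x
    proof -
      have "(\<Sum>a<N. u a * G a x) = (\<Sum>a<N. \<Sum>b\<in>\<B> \<times> \<Gamma> s. (u a * M a b) * B (fst b) (snd b) x)"
        using M that by (intro sum.cong refl) (simp add: sum_distrib_left mult.assoc)
      also have "\<dots> = (\<Sum>b\<in>\<B> \<times> \<Gamma> s. (\<Sum>a<N. u a * M a b) * B (fst b) (snd b) x)"
        unfolding sum_distrib_right by (rule sum.swap)
      also have "\<dots> = 0" using u(2) by (intro sum.neutral) auto
      finally show ?thesis .
    qed
    then show "dependent_on V N G"
      unfolding dependent_on_def using u(1) by (intro exI[of _ u]) auto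
  qed
qed

text \<open>
  Over \<open>p\<close>, each coordinate is a root of its integral relation.
\<close>

lemma finite_fibre: "finite {x \<in> V. tuple r y x = p}"
proof -
  obtain m c where mc: "\<And>i. i \<in> A \<Longrightarrow> integral_relation i (m i) (c i)"
    using coordinate_integral by metis
  have m: "x i ^ m i + (\<Sum>j<m i. c i j (tuple r y x) * x i ^ j) = 0" if "i \<in> A" "x \<in> V" for i x
    using mc[OF that(1)] that(2) by (simp add: integral_relation_def)
  define P where "P i = monom 1 (m i) + (\<Sum>j<m i. monom (c i j p) j)" for i
  have "coeff (P i) (m i) = 1" for i by (simp add: P_def coeff_sum)
  then have "P i \<noteq> 0" for i by (metis coeff_0 zero_neq_one)
  then have roots: "finite {t. poly (P i) t = 0}" for i by (rule poly_roots_finite)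
  have "{x \<in> V. tuple r y x = p} \<subseteq> {x. (\<forall>i\<in>A. x i \<in> {t. poly (P i) t = 0}) \<and> (\<forall>i. i \<notin> A \<longrightarrow> x i = 0)}"
  proof
    fix x assume x: "x \<in> {x \<in> V. tuple r y x = p}"
    then have "x \<in> affine_space A" using zariski_closed_subset[OF closed_V] by auto
    then show "x \<in> {x. (\<forall>i\<in>A. x i \<in> {t. poly (P i) t = 0}) \<and> (\<forall>i. i \<notin> A \<longrightarrow> x i = 0)}"
      using x m by (auto simp: affine_space_def P_def poly_sum poly_monom)
  qed
  moreover have "finite {x. (\<forall>i\<in>A. x i \<in> {t. poly (P i) t = 0}) \<and> (\<forall>i. i \<notin> A \<longrightarrow> x i = 0)}"
    using finite_set_of_finite_funs[OF fin, of "\<Union>i\<in>A. {t. poly (P i) t = 0}" 0] roots fin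
    by (rule_tac rev_finite_subset) auto
  ultimately show ?thesis by (rule finite_subset)
qed

end

section \<open>Irreducible closed sets and chains\<close>

lemma irreducible_closedI:
  assumes "zariski_closed A W" "W \<noteq> {}"
    and "\<And>P Q. zariski_closed A P \<Longrightarrow> zariski_closed A Q \<Longrightarrow> W \<subseteq> P \<union> Q \<Longrightarrow> W \<subseteq> P \<or> W \<subseteq> Q"
  shows "irreducible_closed A W"
  unfolding irreducible_closed_def
proof (intro conjI allI impI)
  fix P Q assume PQ: "zariski_closed A P \<and> zariski_closed A Q \<and> W = P \<union> Q"
  then have "W \<subseteq> P \<or> W \<subseteq> Q" using assms(3)[of P Q] by simp
  then show "W = P \<or> W = Q" using PQ by auto
qed (use assms in auto)

lemma irreducible_closed_closed: "irreducible_closed A W \<Longrightarrow> zariski_closed A W"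
  and irreducible_closed_nonempty: "irreducible_closed A W \<Longrightarrow> W \<noteq> {}"
  unfolding irreducible_closed_def by (elim conjE, assumption)+

lemma irreducible_closed_subset: "irreducible_closed A W \<Longrightarrow> W \<subseteq> affine_space A"
  by (rule zariski_closed_subset[OF irreducible_closed_closed])

lemma irreducible_closedD:
  assumes "irreducible_closed A W" "zariski_closed A P" "zariski_closed A Q" "W \<subseteq> P \<union> Q"
  shows "W \<subseteq> P \<or> W \<subseteq> Q"
proof -
  have "zariski_closed A (W \<inter> P)" "zariski_closed A (W \<inter> Q)"
    using irreducible_closed_closed[OF assms(1)] assms(2,3) by (simp_all add: zariski_closed_Int)
  moreover have "W = (W \<inter> P) \<union> (W \<inter> Q)" using assms(4) by blast
  moreover have "\<forall>B C. zariski_closed A B \<and> zariski_closed A C \<and> W = B \<union> C \<longrightarrow> W = B \<or> W = C"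
    using assms(1) unfolding irreducible_closed_def by (elim conjE)
  ultimately have "W = W \<inter> P \<or> W = W \<inter> Q"
    by (elim allE[of _ "W \<inter> P"] allE[of _ "W \<inter> Q"] impE) (intro conjI)
  then show ?thesis by blast
qed

lemma irreducible_closed_prime:
  assumes W: "irreducible_closed A W" and fg: "regular A f" "regular A g" and "\<And>x. x \<in> W \<Longrightarrow> f x * g x = 0"
  shows "(\<forall>x\<in>W. f x = 0) \<or> (\<forall>x\<in>W. g x = 0)"
proof -
  have "W \<subseteq> affine_space A" using irreducible_closed_subset[OF W] .
  then have "W \<subseteq> {x \<in> affine_space A. f x = 0} \<union> {x \<in> affine_space A. g x = 0}"
    using assms(4) by auto
  then show ?thesis
    using irreducible_closedD[OF W zariski_closed_zero_set[OF fg(1)] zariski_closed_zero_set[OF fg(2)]] by auto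
qed

lemma regular_restrict:
  assumes "regular A g"
  shows "g (\<lambda>i. if i \<in> A then p i else 0) = g p"
  by (rule regular_cong_on[OF assms]) auto

lemma irreducible_affine_space:
  "irreducible_closed A (affine_space A :: ('j \<Rightarrow> 'a::alg_closed_field) set)"
proof (rule irreducible_closedI[OF zariski_closed_affine_space])
  show "(affine_space A :: ('j \<Rightarrow> 'a) set) \<noteq> {}" by (auto simp: affine_space_def)
next
  fix P Q :: "('j \<Rightarrow> 'a) set"
  assume PQ: "zariski_closed A P" "zariski_closed A Q" "affine_space A \<subseteq> P \<union> Q"
  show "affine_space A \<subseteq> P \<or> affine_space A \<subseteq> Q"
  proof (rule ccontr)
    assume "\<not> ?thesis"
    then obtain p q where p: "p \<in> affine_space A" "p \<notin> P" and q: "q \<in> affine_space A" "q \<notin> Q" by auto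
    obtain g where g: "regular A g" "\<forall>x\<in>P. g x = 0" "g p \<noteq> 0" using zariski_closedD[OF PQ(1) p] by blast
    obtain h where h: "regular A h" "\<forall>x\<in>Q. h x = 0" "h q \<noteq> 0" using zariski_closedD[OF PQ(2) q] by blast
    have "g x * h x = 0" for x
    proof -
      let ?x = "\<lambda>i. if i \<in> A then x i else 0"
      have "?x \<in> affine_space A" by (auto simp: affine_space_def)
      then have "?x \<in> P \<union> Q" using PQ(3) by blast
      then have "g ?x * h ?x = 0" using g(2) h(2) by auto
      then show ?thesis by (simp add: regular_restrict[OF g(1)] regular_restrict[OF h(1)])
    qed
    then show False using regular_no_zero_divisors[OF g(1) h(1)] g(3) h(3) by blast
  qed
qed

lemma growth_le_mono:
  assumes "growth_le A V r" "U \<subseteq> V"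
  shows "growth_le A U r"
proof -
  have "dependent_on U N G" if "dependent_on V N G" for N and G :: "nat \<Rightarrow> ('a \<Rightarrow> 'b) \<Rightarrow> 'b"
  proof -
    obtain c where "\<exists>a<N. c a \<noteq> 0" "\<forall>x\<in>V. (\<Sum>a<N. c a * G a x) = 0"
      using \<open>dependent_on V N G\<close> unfolding dependent_on_def by auto
    then show ?thesis unfolding dependent_on_def using assms(2) by (intro exI[of _ c]) auto
  qed
  then show ?thesis using assms(1) unfolding growth_le_def by blast
qed

lemma coordinates_alg_independent:
  fixes h :: "nat \<Rightarrow> 'j"
  assumes h: "bij_betw h {..<n} A"
  shows "alg_independent_on (affine_space A) n (\<lambda>k (x :: 'j \<Rightarrow> 'a::comm_ring_1). x (h k))"
  unfolding alg_independent_on_def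
proof (intro allI impI)
  fix g :: "(nat \<Rightarrow> 'a) \<Rightarrow> 'a" and p
  assume g: "regular {..<n} g" "\<forall>x\<in>affine_space A. g (tuple n (\<lambda>k x. x (h k)) x) = 0"
  define x :: "'j \<Rightarrow> 'a" where "x i = (if i \<in> A then p (inv_into {..<n} h i) else 0)" for i
  have "tuple n (\<lambda>k x. x (h k)) x k = p k" if "k < n" for k
    using h that by (auto simp: tuple_def x_def bij_betw_def inv_into_f_f)
  then have "g (tuple n (\<lambda>k x. x (h k)) x) = g p"
    by (intro regular_cong_on[OF g(1)]) auto
  moreover have "x \<in> affine_space A" by (auto simp: affine_space_def x_def)
  ultimately show "g p = 0" using g(2) by simp
qed

lemma linear_form_coord: "i \<in> A \<Longrightarrow> linear_form A (\<lambda>x. x i)"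
  using polyfun_coord[of i A 0] by (simp add: linear_form_def homog_fun_def)

lemma cone_affine_space: "cone (affine_space A)"
  by (auto simp: cone_def affine_space_def)

text \<open>
  The coordinates themselves cut affine space down to \<open>0\<close>.
\<close>

lemma growth_le_affine_space:
  assumes "finite A"
  shows "growth_le A (affine_space A :: ('j \<Rightarrow> 'a::alg_closed_field) set) (card A)"
proof -
  obtain h where h: "bij_betw h {..<card A} A"
    using ex_bij_betw_nat_finite[OF assms] by (auto simp: lessThan_atLeast0)
  interpret projected_cone A "affine_space A :: ('j \<Rightarrow> 'a) set" "card A" "\<lambda>k x. x (h k)"
  proof
    fix k assume "k < card A"
    then show "linear_form A (\<lambda>x. x (h k))" using h by (intro linear_form_coord) (auto simp: bij_betw_def)
  next
    fix x :: "'j \<Rightarrow> 'a" assume x: "x \<in> affine_space A" "\<forall>k<card A. x (h k) = 0"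
    have "x i = 0" if "i \<in> A" for i
      using x(2) h that unfolding bij_betw_def by (metis imageE lessThan_iff)
    then show "x = (\<lambda>_. 0)" using x(1) by (auto simp: affine_space_def)
  qed (use assms zariski_closed_affine_space cone_affine_space in auto)
  show ?thesis by (rule growth_le_V)
qed

text \<open>
  Algebraic independence grows along strict inclusions of irreducible closed sets: if \<open>f\<close> vanishes on the smaller
  set but not on the larger one, then \<open>f\<close> can be adjoined. In a relation between them on the larger
  set, the lowest power of \<open>f\<close> cancels, and restriction to the smaller set kills all but the lowest coefficient.
\<close>

lemma alg_independent_extend:
  fixes F :: "nat \<Rightarrow> ('j \<Rightarrow> 'a::alg_closed_field) \<Rightarrow> 'a"
  assumes D: "irreducible_closed A D" and C: "zariski_closed A C" "C \<subset> D"
    and F: "alg_independent_on C q F" "\<And>k. k < q \<Longrightarrow> regular A (F k)"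
  shows "\<exists>f. regular A f \<and> alg_independent_on D (Suc q) (F(q := f))"
proof -
  obtain z where z: "z \<in> D" "z \<notin> C" using C(2) by auto
  have "D \<subseteq> affine_space A" using irreducible_closed_subset[OF D] .
  then obtain f where f: "regular A f" "\<forall>x\<in>C. f x = 0" "f z \<noteq> 0"
    using zariski_closedD[OF C(1) _ z(2)] z(1) by blast
  define F' where "F' = F(q := f)"
  define T where "T = tuple (Suc q) F'"
  have T_q: "T x q = f x" for x by (simp add: T_def tuple_def F'_def)
  have F'_regular: "regular A (F' k)" if "k < Suc q" for k
    using that f(1) F(2) by (auto simp: F'_def less_Suc_eq)
  have "alg_independent_on D (Suc q) F'"
    unfolding alg_independent_on_def
  proof (intro allI impI)
    fix g :: "(nat \<Rightarrow> 'a) \<Rightarrow> 'a" and p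
    assume g: "regular {..<Suc q} g" "\<forall>x\<in>D. g (tuple (Suc q) F' x) = 0"
    then obtain s where "polyfun {..<Suc q} s g" by (auto simp: regular_def)
    then obtain a where a: "\<And>j. j \<le> s \<Longrightarrow> polyfun ({..<Suc q} - {q}) (s - j) (a j)"
      "\<And>p. g p = (\<Sum>j\<le>s. a j p * p q ^ j)"
      using polyfun_expand_in_variable[of "{..<Suc q}" s g q] by blast
    have "{..<Suc q} - {q} = {..<q}" by auto
    then have a_reg: "regular {..<q} (a j)" if "j \<le> s" for j using a(1)[OF that] by (auto intro: regularI)
    have "\<forall>p. a j p = 0" if "j \<le> s" for j
      using that
    proof (induction j rule: less_induct)
      case (less j)
      define S where "S x = (\<Sum>l\<in>{j..s}. a l (T x) * f x ^ (l - j))" for x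
      have aT: "regular A (\<lambda>x. a l (T x))" if "l \<le> s" for l
        using regular_compose[OF a_reg[OF that], of A "\<lambda>k x. T x k"] F'_regular
        by (simp add: T_def tuple_def)
      have "regular A S" unfolding S_def by (intro regular_intros aT f) auto
      moreover have "f x ^ j * S x = 0" if "x \<in> D" for x
      proof -
        have "0 = (\<Sum>l\<le>s. a l (T x) * f x ^ l)"
          using g(2) that unfolding a(2) by (simp add: T_def[symmetric] T_q)
        also have "\<dots> = (\<Sum>l\<in>{j..s}. a l (T x) * f x ^ l)"
          using less by (intro sum.mono_neutral_right) auto
        also have "\<dots> = f x ^ j * S x"
          unfolding S_def sum_distrib_left
          by (intro sum.cong refl) (auto simp: mult.left_commute simp flip: power_add)
        finally show ?thesis by simp
      qed
      ultimately have "(\<forall>x\<in>D. f x ^ j = 0) \<or> (\<forall>x\<in>D. S x = 0)"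
        by (intro irreducible_closed_prime[OF D] regular_power[OF f(1)]) auto
      then have S0: "\<forall>x\<in>D. S x = 0" using f(3) z(1) by auto
      have "a j (tuple q F x) = 0" if "x \<in> C" for x
      proof -
        have "S x = (\<Sum>l\<in>{j..s}. if l = j then a j (T x) else 0)"
          unfolding S_def using f(2) that by (intro sum.cong refl) (auto simp: power_0_left)
        then have "a j (T x) = S x" using less.prems by simp
        moreover have "a j (T x) = a j (tuple q F x)"
          by (rule regular_cong_on[OF a_reg[OF less.prems]]) (auto simp: T_def tuple_def F'_def)
        moreover have "S x = 0" using S0 C(2) that by auto
        ultimately show ?thesis by simp
      qed
      then show ?case using F(1) a_reg[OF less.prems] unfolding alg_independent_on_def by blast
    qed
    then show "g p = 0" unfolding a(2) by (intro sum.neutral) auto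
  qed
  then show ?thesis using f(1) by (auto simp: F'_def)
qed

text \<open>
  Every step of the chain contributes one more algebraically independent function, and affine space has at
  most \<open>card A\<close> of them.
\<close>

lemma chain_length_bound:
  fixes C :: "nat \<Rightarrow> ('j \<Rightarrow> 'a::alg_closed_field) set"
  assumes "finite A" "alg_independent_on (C 0) q F" "\<And>k. k < q \<Longrightarrow> regular A (F k)"
    and C: "\<forall>j\<le>n. irreducible_closed A (C j)" "\<forall>j<n. C j \<subset> C (Suc j)"
  shows "q + n \<le> card A"
proof -
  have "\<exists>F. (\<forall>k<q + j. regular A (F k)) \<and> alg_independent_on (C j) (q + j) F" if "j \<le> n" for j
    using that
  proof (induction j)
    case 0
    then show ?case using assms(2,3) by auto
  next
    case (Suc j)
    then obtain F' where F': "\<forall>k<q + j. regular A (F' k)" "alg_independent_on (C j) (q + j) F'" by auto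
    have "zariski_closed A (C j)" "irreducible_closed A (C (Suc j))" "C j \<subset> C (Suc j)"
      using C Suc.prems by (auto intro: irreducible_closed_closed)
    then obtain f where "regular A f" "alg_independent_on (C (Suc j)) (Suc (q + j)) (F'(q + j := f))"
      using alg_independent_extend[OF _ _ _ F'(2)] F'(1) by blast
    moreover from this have "\<forall>k<q + Suc j. regular A ((F'(q + j := f)) k)"
      using F'(1) by (auto simp: less_Suc_eq)
    ultimately show ?case unfolding add_Suc_right by (intro exI[of _ "F'(q + j := f)"] conjI)
  qed
  then obtain F' where F': "\<And>k. k < q + n \<Longrightarrow> regular A (F' k)" "alg_independent_on (C n) (q + n) F'"
    by blast
  have "C n \<subseteq> affine_space A" using C(1) by (intro irreducible_closed_subset) auto
  then have "growth_le A (C n) (card A)" using growth_le_affine_space[OF assms(1)] growth_le_mono by blast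
  then show ?thesis using F' by (intro alg_independent_le_growth)
qed

definition cylinder :: "'j set \<Rightarrow> 'j \<Rightarrow> ('j \<Rightarrow> 'a::zero) set \<Rightarrow> ('j \<Rightarrow> 'a) set" where
  "cylinder A i Z = {x \<in> affine_space A. fun_upd x i 0 \<in> Z}"

lemma regular_upd_const:
  fixes g :: "('j \<Rightarrow> 'a::comm_ring_1) \<Rightarrow> 'a"
  assumes "regular A g"
  shows "regular (A - {i}) (\<lambda>x. g (x(i := t)))"
proof -
  have "regular (A - {i}) (\<lambda>x. g (\<lambda>j. if j = i then t else x j))"
    using assms
  proof (rule regular_compose)
    fix j assume "j \<in> A"
    then show "regular (A - {i}) (\<lambda>x. if j = i then t else x j)"
      by (cases "j = i") (auto intro: regular_const regular_coord)
  qed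
  then show ?thesis by (simp add: fun_upd_def)
qed

lemma zariski_closed_cylinder:
  fixes Z :: "('j \<Rightarrow> 'a::alg_closed_field) set"
  assumes "zariski_closed (A - {i}) Z"
  shows "zariski_closed A (cylinder A i Z)"
proof -
  define G where "G j x = (if j \<in> A - {i} then x j else 0)" for j and x :: "'j \<Rightarrow> 'a"
  have G_regular: "regular A (G j)" if "j \<in> A - {i}" for j
    using that by (auto simp: G_def[abs_def] intro: regular_coord)
  have G_0: "G j x = 0" if "j \<notin> A - {i}" for j x
    using that by (auto simp: G_def)
  have "zariski_closed A {x \<in> affine_space A. (\<lambda>j. G j x) \<in> Z}"
    by (rule zariski_closed_vimage[OF assms G_regular G_0])
  moreover have "(\<lambda>j. G j x) = x(i := 0)" if "x \<in> affine_space A" for x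
    using that by (auto simp: G_def affine_space_def)
  ultimately show ?thesis unfolding cylinder_def by (simp cong: conj_cong)
qed

text \<open>
  Each line of the cylinder, being irreducible, lies in one of two closed sets that cover the cylinder. The base points
  whose line lies in a given closed set form a closed set, so that the irreducible base consists of points of one kind.
\<close>

lemma irreducible_cylinder:
  fixes Z :: "('j \<Rightarrow> 'a::alg_closed_field) set"
  assumes "i \<in> A" and Z: "irreducible_closed (A - {i}) Z"
  shows "irreducible_closed A (cylinder A i Z)"
proof -
  have closed_Z: "zariski_closed (A - {i}) Z" and "Z \<noteq> {}"
    using irreducible_closed_closed[OF Z] irreducible_closed_nonempty[OF Z] .
  have Z_affine: "Z \<subseteq> affine_space (A - {i})" using zariski_closed_subset[OF closed_Z] .
  have upd_in: "z(i := t) \<in> cylinder A i Z" if "z \<in> Z" for z t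
  proof -
    have "z \<in> affine_space (A - {i})" using that Z_affine by blast
    then have "(z(i := t))(i := 0) = z" "z(i := t) \<in> affine_space A"
      using assms(1) by (auto simp: affine_space_def fun_eq_iff)
    then show ?thesis using that by (simp add: cylinder_def)
  qed
  show ?thesis
  proof (rule irreducible_closedI)
    show "zariski_closed A (cylinder A i Z)" by (rule zariski_closed_cylinder[OF closed_Z])
  next
    show "cylinder A i Z \<noteq> {}" using upd_in \<open>Z \<noteq> {}\<close> by blast
  next
    fix P Q assume PQ: "zariski_closed A P" "zariski_closed A Q" "cylinder A i Z \<subseteq> P \<union> Q"
    define base where "base R = {z \<in> affine_space (A - {i}). \<forall>t. z(i := t) \<in> R}" for R :: "('j \<Rightarrow> 'a) set"
    have base_closed: "zariski_closed (A - {i}) (base R)" if R: "zariski_closed A R" for R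
    proof (rule zariski_closedI)
      fix z assume z: "z \<in> affine_space (A - {i})" "z \<notin> base R"
      then obtain t where t: "z(i := t) \<notin> R" by (auto simp: base_def)
      have "z(i := t) \<in> affine_space A" using z(1) assms(1) by (auto simp: affine_space_def)
      then obtain g where g: "regular A g" "\<forall>x\<in>R. g x = 0" "g (z(i := t)) \<noteq> 0"
        using zariski_closedD[OF R _ t] by blast
      then show "\<exists>g. regular (A - {i}) g \<and> (\<forall>x\<in>base R. g x = 0) \<and> g z \<noteq> 0"
        by (intro exI[of _ "\<lambda>x. g (x(i := t))"]) (auto intro: regular_upd_const simp: base_def)
    qed (auto simp: base_def)
    have "Z \<subseteq> base P \<union> base Q"
    proof (rule ccontr)
      assume "\<not> Z \<subseteq> base P \<union> base Q"
      then obtain z u v where z: "z \<in> Z" "z(i := u) \<notin> P" "z(i := v) \<notin> Q"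
        using Z_affine by (auto simp: base_def)
      have aff: "z(i := t) \<in> affine_space A" for t
        using z(1) Z_affine assms(1) by (auto simp: affine_space_def)
      obtain g where g: "regular A g" "\<forall>x\<in>P. g x = 0" "g (z(i := u)) \<noteq> 0"
        using zariski_closedD[OF PQ(1) aff z(2)] by blast
      obtain h where h: "regular A h" "\<forall>x\<in>Q. h x = 0" "h (z(i := v)) \<noteq> 0"
        using zariski_closedD[OF PQ(2) aff z(3)] by blast
      obtain p where p: "\<And>t. g (z(i := t)) = poly p t"
        using regular_on_coordinate_line[OF g(1), of z i] by auto
      obtain q where q: "\<And>t. h (z(i := t)) = poly q t"
        using regular_on_coordinate_line[OF h(1), of z i] by auto
      have "poly (p * q) t = 0" for t
      proof -
        have "z(i := t) \<in> P \<union> Q" using upd_in[OF z(1)] PQ(3) by blast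
        then have "g (z(i := t)) * h (z(i := t)) = 0" using g(2) h(2) by auto
        then show ?thesis by (simp only: poly_mult p q)
      qed
      then have "p * q = 0" by (intro poly_fun_eqD) simp
      then show False using g(3) h(3) unfolding p q by auto
    qed
    then have "Z \<subseteq> base P \<or> Z \<subseteq> base Q"
      using irreducible_closedD[OF Z base_closed[OF PQ(1)] base_closed[OF PQ(2)]] by simp
    moreover have "cylinder A i Z \<subseteq> R" if "Z \<subseteq> base R" for R
    proof
      fix x assume "x \<in> cylinder A i Z"
      then have "x(i := 0) \<in> base R" using that by (auto simp: cylinder_def)
      then have "(x(i := 0))(i := x i) \<in> R" unfolding base_def by blast
      then show "x \<in> R" by simp
    qed
    ultimately show "cylinder A i Z \<subseteq> P \<or> cylinder A i Z \<subseteq> Q" by blast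
  qed
qed

text \<open>
  The Zariski closure of the image of \<open>W\<close> under the projection that forgets \<open>x i\<close>.
\<close>

definition image_closure :: "'j set \<Rightarrow> 'j \<Rightarrow> ('j \<Rightarrow> 'a::comm_ring_1) set \<Rightarrow> ('j \<Rightarrow> 'a) set" where
  "image_closure A i W =
     {z \<in> affine_space (A - {i}). \<forall>g. regular (A - {i}) g \<and> (\<forall>x\<in>W. g x = 0) \<longrightarrow> g z = 0}"

lemma image_closureD:
  assumes "z \<in> image_closure A i W" "regular (A - {i}) g" "\<And>x. x \<in> W \<Longrightarrow> g x = 0"
  shows "g z = 0"
proof -
  have "\<forall>g. regular (A - {i}) g \<and> (\<forall>x\<in>W. g x = 0) \<longrightarrow> g z = 0"
    using assms(1) unfolding image_closure_def by simp
  from this[THEN spec, of g] show ?thesis using assms(2,3) by simp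
qed

lemma image_closureI:
  assumes "z \<in> affine_space (A - {i})"
    and "\<And>g. regular (A - {i}) g \<Longrightarrow> (\<And>x. x \<in> W \<Longrightarrow> g x = 0) \<Longrightarrow> g z = 0"
  shows "z \<in> image_closure A i W"
  unfolding image_closure_def
proof (intro CollectI conjI allI impI)
  fix g assume "regular (A - {i}) g \<and> (\<forall>x\<in>W. g x = 0)"
  then show "g z = 0" by (intro assms(2)[of g]) simp_all
qed (rule assms(1))

lemma image_closure_subset: "image_closure A i W \<subseteq> affine_space (A - {i})"
  unfolding image_closure_def by (rule Collect_restrict)

lemma zariski_closed_image_closure: "zariski_closed (A - {i}) (image_closure A i W)"
proof (rule zariski_closedI)
  fix z assume z: "z \<in> affine_space (A - {i})" "z \<notin> image_closure A i W"
  show "\<exists>g. regular (A - {i}) g \<and> (\<forall>x\<in>image_closure A i W. g x = 0) \<and> g z \<noteq> 0"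
  proof (rule ccontr)
    assume no_g: "\<not> ?thesis"
    have "z \<in> image_closure A i W"
    proof (rule image_closureI[OF z(1)], rule ccontr)
      fix g assume g: "regular (A - {i}) g" "\<And>x. x \<in> W \<Longrightarrow> g x = 0" "g z \<noteq> 0"
      then have "\<forall>x\<in>image_closure A i W. g x = 0" using image_closureD[OF _ g(1,2)] by blast
      then show False using no_g g(1,3) by blast
    qed
    then show False using z(2) by simp
  qed
qed (rule image_closure_subset)

lemma regular_forget:
  assumes "regular (A - {i}) g"
  shows "g (x(i := t)) = g x"
  by (rule regular_cong_on[OF assms]) auto

lemma subset_cylinder_image_closure:
  assumes "W \<subseteq> affine_space A"
  shows "W \<subseteq> cylinder A i (image_closure A i W)"
proof
  fix x assume "x \<in> W"
  moreover from this have "x(i := 0) \<in> affine_space (A - {i})" "x \<in> affine_space A"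
    using assms by (auto simp: affine_space_def)
  ultimately show "x \<in> cylinder A i (image_closure A i W)"
    unfolding cylinder_def
    by (intro CollectI conjI image_closureI) (simp_all add: regular_forget)
qed

lemma irreducible_image_closure:
  assumes "i \<in> A" and W: "irreducible_closed A W"
  shows "irreducible_closed (A - {i}) (image_closure A i W)"
proof (rule irreducible_closedI[OF zariski_closed_image_closure])
  have sub: "W \<subseteq> affine_space A" and "W \<noteq> {}"
    using irreducible_closed_subset[OF W] irreducible_closed_nonempty[OF W] .
  then show "image_closure A i W \<noteq> {}"
    using subset_cylinder_image_closure[of W A i] by (auto simp: cylinder_def)
  fix P Q assume PQ: "zariski_closed (A - {i}) P" "zariski_closed (A - {i}) Q" "image_closure A i W \<subseteq> P \<union> Q"
  have "W \<subseteq> cylinder A i P \<union> cylinder A i Q"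
    using subset_cylinder_image_closure[OF sub, of i] PQ(3) unfolding cylinder_def by blast
  then have "W \<subseteq> cylinder A i P \<or> W \<subseteq> cylinder A i Q"
    by (rule irreducible_closedD[OF W zariski_closed_cylinder[OF PQ(1)] zariski_closed_cylinder[OF PQ(2)]])
  moreover have "image_closure A i W \<subseteq> R" if "W \<subseteq> cylinder A i R" and closed_R: "zariski_closed (A - {i}) R" for R
  proof (rule ccontr)
    assume "\<not> image_closure A i W \<subseteq> R"
    then obtain z where z: "z \<in> image_closure A i W" "z \<notin> R" by auto
    have "z \<in> affine_space (A - {i})" by (rule subsetD[OF image_closure_subset z(1)])
    then obtain g where g: "regular (A - {i}) g" "\<forall>x\<in>R. g x = 0" "g z \<noteq> 0"
      using zariski_closedD[OF closed_R _ z(2)] by blast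
    have "g x = 0" if "x \<in> W" for x
    proof -
      have "x(i := 0) \<in> R" using \<open>W \<subseteq> cylinder A i R\<close> that by (auto simp: cylinder_def)
      then show ?thesis using g(2) regular_forget[OF g(1), of x 0] by simp
    qed
    then show False using image_closureD[OF z(1) g(1)] g(3) by blast
  qed
  ultimately show "image_closure A i W \<subseteq> P \<or> image_closure A i W \<subseteq> Q" using PQ by blast
qed

text \<open>
  A linear relation on \<open>W\<close> between functions that do not involve \<open>x i\<close> persists on the closure of the projection.
\<close>

lemma growth_le_image_closure:
  fixes W :: "('j \<Rightarrow> 'a::field) set"
  assumes "growth_le A W r"
  shows "growth_le (A - {i}) (image_closure A i W) r"
proof -
  have "dependent_on (image_closure A i W) N G"
    if "dependent_on W N G" "\<forall>a<N. polyfun (A - {i}) s (G a)" for s N and G :: "nat \<Rightarrow> ('j \<Rightarrow> 'a) \<Rightarrow> 'a"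
  proof -
    obtain c where c: "\<exists>a<N. c a \<noteq> 0" "\<forall>x\<in>W. (\<Sum>a<N. c a * G a x) = 0"
      using \<open>dependent_on W N G\<close> unfolding dependent_on_def by auto
    have "regular (A - {i}) (\<lambda>x. \<Sum>a<N. c a * G a x)"
      using that(2) by (intro regular_intros) (auto intro: regularI)
    from image_closureD[OF _ this] have "(\<Sum>a<N. c a * G a x) = 0" if "x \<in> image_closure A i W" for x
      using that c(2) by simp
    then show ?thesis unfolding dependent_on_def using c(1) by (intro exI[of _ c]) auto
  qed
  moreover have "\<forall>a<N. polyfun A s (G a)" if "\<forall>a<N. polyfun (A - {i}) s (G a)"
    for s N and G :: "nat \<Rightarrow> ('j \<Rightarrow> 'a) \<Rightarrow> 'a"
    using that by (auto intro: polyfun_mono)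
  ultimately show ?thesis using assms unfolding growth_le_def by meson
qed

lemma invariant_under_coordinate_changes:
  fixes W :: "('j \<Rightarrow> 'a::zero) set"
  assumes "finite A" "W \<subseteq> affine_space A" "W \<noteq> {}"
    and "\<And>i x t. i \<in> A \<Longrightarrow> x \<in> W \<Longrightarrow> x(i := t) \<in> W"
  shows "W = affine_space A"
proof (intro equalityI subsetI)
  fix z :: "'j \<Rightarrow> 'a" assume z: "z \<in> affine_space A"
  obtain x where x: "x \<in> W" using assms(3) by auto
  have "(\<lambda>i. if i \<in> J then z i else x i) \<in> W" if "finite J" "J \<subseteq> A" for J
    using that
  proof (induction J rule: finite_induct)
    case empty
    then show ?case using x by simp
  next
    case (insert i J)
    then have "(\<lambda>i. if i \<in> J then z i else x i)(i := z i) \<in> W" by (intro assms(4)) auto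
    moreover have "(\<lambda>i. if i \<in> J then z i else x i)(i := z i) = (\<lambda>j. if j \<in> insert i J then z j else x j)"
      by auto
    ultimately show ?case by simp
  qed
  from this[OF assms(1) order_refl] have "(\<lambda>i. if i \<in> A then z i else x i) \<in> W" .
  moreover have "(\<lambda>i. if i \<in> A then z i else x i) = z"
    using x z assms(2) by (auto simp: affine_space_def fun_eq_iff)
  ultimately show "z \<in> W" by simp
qed (use assms in auto)

text \<open>
  Unless \<open>W\<close> is the whole space, it fails to be a cylinder in the direction of some coordinate \<open>i\<close>. By induction,
  the closure of its projection along \<open>i\<close> starts a chain of length one less. The cylinders over this chain
  form a chain whose first member properly contains \<open>W\<close>.
\<close>

lemma chain_exists:
  fixes W :: "('j \<Rightarrow> 'a::alg_closed_field) set"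
  assumes "finite A" "irreducible_closed A W" "growth_le A W r"
  shows "\<exists>C. C 0 = W \<and> (\<forall>j\<le>card A - r. irreducible_closed A (C j)) \<and>
    (\<forall>j<card A - r. C j \<subset> C (Suc j))"
  using assms
proof (induction A arbitrary: W rule: finite_psubset_induct)
  case (psubset A)
  have sub: "W \<subseteq> affine_space A" and "W \<noteq> {}"
    using irreducible_closed_subset[OF psubset.prems(1)] irreducible_closed_nonempty[OF psubset.prems(1)] .
  show ?case
  proof (cases "card A \<le> r")
    case True
    then show ?thesis using psubset.prems by (intro exI[of _ "\<lambda>_. W"]) auto
  next
    case False
    have "W \<noteq> affine_space A"
    proof
      assume W: "W = affine_space A"
      obtain h where h: "bij_betw h {..<card A} A"
        using ex_bij_betw_nat_finite[OF psubset.hyps(1)] by (auto simp: lessThan_atLeast0)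
      have "h k \<in> A" if "k < card A" for k using h that by (auto simp: bij_betw_def)
      then have "card A \<le> r"
        by (intro alg_independent_le_growth[OF psubset.prems(2)[unfolded W] coordinates_alg_independent[OF h]]
            regular_coord)
      then show False using False by simp
    qed
    then obtain i where i: "i \<in> A" "W \<noteq> cylinder A i (image_closure A i W)"
    proof (rule_tac ccontr)
      assume "\<not> thesis"
      with that have cyl: "W = cylinder A i (image_closure A i W)" if "i \<in> A" for i using that by blast
      have "x(i := t) \<in> W" if "i \<in> A" "x \<in> W" for i x t
      proof -
        have "x \<in> cylinder A i (image_closure A i W)" using cyl that by blast
        then have "x(i := t) \<in> cylinder A i (image_closure A i W)"
          using that(1) by (auto simp: cylinder_def affine_space_def)
        then show ?thesis using cyl[OF that(1)] by blast
      qed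
      then have "W = affine_space A"
        using invariant_under_coordinate_changes[OF psubset.hyps(1) sub \<open>W \<noteq> {}\<close>] by blast
      then show False using \<open>W \<noteq> affine_space A\<close> by simp
    qed
    define n where "n = card (A - {i}) - r"
    have n: "card A - r = Suc n"
      using False i(1) psubset.hyps(1) by (simp add: n_def card_Diff_singleton)
    have proper: "A - {i} \<subset> A" using i(1) by auto
    obtain D where D: "D 0 = image_closure A i W" "\<forall>j\<le>n. irreducible_closed (A - {i}) (D j)"
      "\<forall>j<n. D j \<subset> D (Suc j)"
      using psubset.IH[OF proper irreducible_image_closure[OF i(1) psubset.prems(1)]
          growth_le_image_closure[OF psubset.prems(2)]] unfolding n_def[symmetric] by (elim exE conjE) (rule that)
    define C where "C j = (case j of 0 \<Rightarrow> W | Suc k \<Rightarrow> cylinder A i (D k))" for j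
    have "irreducible_closed A (C j)" if "j \<le> Suc n" for j
      using that psubset.prems(1) D(2) irreducible_cylinder[OF i(1)] by (auto simp: C_def split: nat.splits)
    moreover have "C j \<subset> C (Suc j)" if "j < Suc n" for j
    proof (cases j)
      case 0
      then show ?thesis
        using subset_cylinder_image_closure[OF sub, of i] i(2) by (auto simp: C_def D(1))
    next
      case (Suc k)
      then have DD: "D k \<subset> D (Suc k)" using D(3) that by auto
      then obtain z where z: "z \<in> D (Suc k)" "z \<notin> D k" by auto
      have "D (Suc k) \<subseteq> affine_space (A - {i})"
        using D(2) Suc that by (intro irreducible_closed_subset) auto
      then have "z \<in> affine_space (A - {i})" using z(1) by blast
      then have "z(i := 0) = z" "z \<in> affine_space A" by (auto simp: affine_space_def fun_eq_iff)
      then have "z \<in> cylinder A i (D (Suc k))" "z \<notin> cylinder A i (D k)"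
        using z by (auto simp: cylinder_def)
      moreover have "cylinder A i (D k) \<subseteq> cylinder A i (D (Suc k))"
        using DD by (auto simp: cylinder_def)
      ultimately show ?thesis unfolding C_def Suc by auto
    qed
    moreover have "C 0 = W" by (simp add: C_def)
    ultimately show ?thesis unfolding n by (intro exI[of _ C]) auto
  qed
qed

section \<open>The codimension of a cone\<close>

definition cut_by :: "'j set \<Rightarrow> ('j \<Rightarrow> 'a::comm_ring_1) set \<Rightarrow> nat \<Rightarrow> bool" where
  "cut_by A V r \<longleftrightarrow> (\<exists>y. (\<forall>k<r. linear_form A (y k)) \<and> (\<forall>x\<in>V. (\<forall>k<r. y k x = 0) \<longrightarrow> x = (\<lambda>_. 0)))"

lemma cut_by_family:
  fixes y :: "'k \<Rightarrow> ('j \<Rightarrow> 'a::comm_ring_1) \<Rightarrow> 'a"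
  assumes "finite K" "\<And>k. k \<in> K \<Longrightarrow> linear_form A (y k)"
    and "\<And>x. x \<in> V \<Longrightarrow> \<forall>k\<in>K. y k x = 0 \<Longrightarrow> x = (\<lambda>_. 0)"
  shows "cut_by A V (card K)"
proof -
  obtain h where h: "bij_betw h {..<card K} K"
    using ex_bij_betw_nat_finite[OF assms(1)] by (auto simp: lessThan_atLeast0)
  then have img: "K = h ` {..<card K}" by (simp add: bij_betw_def)
  show ?thesis
    unfolding cut_by_def
  proof (intro exI[of _ "\<lambda>k. y (h k)"] conjI allI ballI impI)
    fix k assume "k < card K"
    then show "linear_form A (y (h k))" using img assms(2) by blast
  next
    fix x assume x: "x \<in> V" "\<forall>k<card K. y (h k) x = 0"
    have "y k x = 0" if "k \<in> K" for k
    proof -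
      have "k \<in> h ` {..<card K}" using that h unfolding bij_betw_def by (elim conjE) simp
      then obtain j where "j < card K" "k = h j" by auto
      then show ?thesis using x(2) by simp
    qed
    then show "x = (\<lambda>_. 0)" using assms(3)[OF x(1)] by blast
  qed
qed

lemma cut_by_card:
  assumes "finite A" "V \<subseteq> affine_space A"
  shows "cut_by A V (card A)"
  using assms by (intro cut_by_family[of A A "\<lambda>i x. x i"])
    (auto simp: affine_space_def intro: linear_form_coord)

text \<open>
  The dimension of the cone \<open>V\<close>: a linear subspace of codimension \<open>r\<close> that meets \<open>V\<close> only in \<open>0\<close> exists if and only if
  \<open>r\<close> is at least the dimension.
\<close>

definition cone_dim :: "'j set \<Rightarrow> ('j \<Rightarrow> 'a::comm_ring_1) set \<Rightarrow> nat" where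
  "cone_dim A V = (LEAST r. cut_by A V r)"

lemma cone_dim_le: "cut_by A V r \<Longrightarrow> cone_dim A V \<le> r"
  unfolding cone_dim_def by (rule Least_le)

lemma cut_by_cone_dim:
  assumes "finite A" "V \<subseteq> affine_space A"
  shows "cut_by A V (cone_dim A V)"
  unfolding cone_dim_def by (rule LeastI) (rule cut_by_card[OF assms])

lemma linear_form_diff:
  assumes "linear_form A l" "linear_form A l'"
  shows "linear_form A (\<lambda>x. a * l x - b * l' x)"
proof -
  have "polyfun A 1 (\<lambda>x. a * l x + (- b) * l' x)"
    using assms by (intro polyfun_add polyfun_cmult) (auto simp: linear_form_def)
  then show ?thesis using assms by (auto simp: linear_form_def homog_fun_def algebra_simps)
qed

lemma projected_coneI:
  assumes "finite A" "zariski_closed A V" "cone V" "\<forall>k<r. linear_form A (y k)"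
    "\<forall>x\<in>V. (\<forall>k<r. y k x = 0) \<longrightarrow> x = (\<lambda>_. 0)"
  shows "projected_cone A V r y"
  using assms by unfold_locales auto

text \<open>
  An irreducible closed subset \<open>W\<close> of \<open>V\<close> inherits the growth bound of \<open>V\<close>, which yields a long chain above \<open>W\<close>.
\<close>

lemma codim_cone_ge:
  assumes "finite A" "zariski_closed A V" "cone V" "cut_by A V r"
  shows "enat (card A - r) \<le> codim A V"
  unfolding codim_def
proof (rule INF_greatest)
  fix W assume "W \<in> {W. irreducible_closed A W \<and> W \<subseteq> V}"
  then have W: "irreducible_closed A W" "W \<subseteq> V" by auto
  obtain y where y: "\<forall>k<r. linear_form A (y k)" "\<forall>x\<in>V. (\<forall>k<r. y k x = 0) \<longrightarrow> x = (\<lambda>_. 0)"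
    using assms(4) unfolding cut_by_def by (elim exE conjE) (rule that)
  interpret projected_cone A V r y by (rule projected_coneI[OF assms(1-3) y])
  obtain C where C: "C 0 = W" "\<forall>j\<le>card A - r. irreducible_closed A (C j)"
    "\<forall>j<card A - r. C j \<subset> C (Suc j)"
    using chain_exists[OF assms(1) W(1) growth_le_mono[OF growth_le_V W(2)]]
    by (elim exE conjE) (rule that)
  show "enat (card A - r) \<le> codim_irreducible A W"
    unfolding codim_irreducible_def
    by (intro Sup_upper CollectI exI[of _ "card A - r"] exI[of _ C] conjI refl C)
qed

context projected_cone
begin

text \<open>
  A point \<open>p\<close> outside of the image of \<open>V \<rightarrow> K\<^sup>r\<close> spans a line that meets the image, a cone, only in \<open>0\<close>. The \<open>r - 1\<close> linear
  equations of this line then give \<open>r - 1\<close> forms that cut \<open>V\<close> down to \<open>0\<close>.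
\<close>

lemma projection_onto:
  assumes minimal: "cone_dim A V = r"
  shows "tuple r y ` V = affine_space {..<r}"
proof (intro equalityI subsetI)
  fix p assume "p \<in> tuple r y ` V"
  then show "p \<in> affine_space {..<r}" by (auto simp: affine_space_def tuple_def)
next
  fix p :: "nat \<Rightarrow> 'a" assume p: "p \<in> affine_space {..<r}"
  show "p \<in> tuple r y ` V"
  proof (rule ccontr)
    assume not_in: "p \<notin> tuple r y ` V"
    have "(\<lambda>_. 0) \<in> V" using cone_V by (simp add: cone_def)
    moreover have "tuple r y (\<lambda>_. 0) = (\<lambda>_. 0)" by (auto simp: tuple_def y_zero)
    ultimately have "p \<noteq> (\<lambda>_. 0)" using not_in by (metis imageI)
    then obtain k0 where "p k0 \<noteq> 0" by auto
    then have k0: "k0 < r" "p k0 \<noteq> 0" using p by (auto simp: affine_space_def)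
    have "cut_by A V (card ({..<r} - {k0}))"
    proof (rule cut_by_family[where y = "\<lambda>k x. p k0 * y k x - p k * y k0 x"])
      fix k assume "k \<in> {..<r} - {k0}"
      then show "linear_form A (\<lambda>x. p k0 * y k x - p k * y k0 x)"
        using forms k0 by (intro linear_form_diff) auto
    next
      fix x assume x: "x \<in> V" "\<forall>k\<in>{..<r} - {k0}. p k0 * y k x - p k * y k0 x = 0"
      define t where "t = y k0 x / p k0"
      have y_eq: "y k x = t * p k" if "k < r" for k
        using x(2) that k0(2) by (cases "k = k0") (auto simp: t_def field_simps)
      have "t = 0"
      proof (rule ccontr)
        assume "t \<noteq> 0"
        have "(\<lambda>i. inverse t * x i) \<in> V" using cone_V x(1) by (simp add: cone_def)
        moreover have "tuple r y (\<lambda>i. inverse t * x i) = p"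
        proof
          fix k
          show "tuple r y (\<lambda>i. inverse t * x i) k = p k"
            unfolding tuple_scale using y_eq \<open>t \<noteq> 0\<close> p
            by (cases "k < r") (auto simp: tuple_def affine_space_def)
        qed
        ultimately show False using not_in by (metis imageI)
      qed
      then show "x = (\<lambda>_. 0)" using y_eq trivial_kernel[OF x(1)] by simp
    qed simp
    then have "cone_dim A V \<le> r - 1" using k0(1) by (intro cone_dim_le) (simp add: card_Diff_singleton)
    then show False using minimal k0(1) by simp
  qed
qed

text \<open>
  A minimal closed subset of \<open>V\<close> that still projects onto \<open>K\<^sup>r\<close> is irreducible, because images of closed
  subsets are closed and \<open>K\<^sup>r\<close> is irreducible. A minimal one exists: by Zorn's lemma it is enough that the intersection of a
  chain still projects onto \<open>K\<^sup>r\<close>, and a chain of nonempty subsets of a finite fibre has a least member.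
\<close>

lemma irreducible_dominating_subset:
  assumes onto: "tuple r y ` V = affine_space {..<r}"
  shows "\<exists>W. irreducible_closed A W \<and> W \<subseteq> V \<and> tuple r y ` W = affine_space {..<r}"
proof -
  define \<Y> where "\<Y> = {Y. zariski_closed A Y \<and> Y \<subseteq> V \<and> tuple r y ` Y = affine_space {..<r}}"
  have "\<exists>W\<in>\<Y>. \<forall>Y\<in>\<Y>. Y \<subseteq> W \<longrightarrow> Y = W"
  proof (rule predicate_Zorn)
    show "partial_order_on \<Y> (relation_of (\<lambda>Y W. W \<subseteq> Y) \<Y>)"
      by (rule partial_order_on_relation_ofI) auto
  next
    fix \<C> assume "\<C> \<in> Chains (relation_of (\<lambda>Y W. W \<subseteq> Y) \<Y>)"
    then have chain: "\<C> \<subseteq> \<Y>" "\<And>Y W. Y \<in> \<C> \<Longrightarrow> W \<in> \<C> \<Longrightarrow> W \<subseteq> Y \<or> Y \<subseteq> W"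
      by (auto simp: Chains_def relation_of_def)
    show "\<exists>U\<in>\<Y>. \<forall>Y\<in>\<C>. U \<subseteq> Y"
    proof (cases "\<C> = {}")
      case True
      then show ?thesis using closed_V onto by (intro bexI[of _ V]) (auto simp: \<Y>_def)
    next
      case False
      have "\<exists>x\<in>\<Inter>\<C>. tuple r y x = p" if p: "p \<in> affine_space {..<r}" for p
      proof -
        define fib where "fib Y = {x \<in> Y. tuple r y x = p}" for Y
        have fin_fib: "finite (fib Y)" if "Y \<in> \<C>" for Y
        proof -
          have "Y \<subseteq> V" using chain(1) that by (auto simp: \<Y>_def)
          then show ?thesis unfolding fib_def by (intro finite_subset[OF _ finite_fibre[of p]]) auto
        qed
        obtain Y0 where Y0: "Y0 \<in> \<C>" "\<And>Y. Y \<in> \<C> \<Longrightarrow> card (fib Y0) \<le> card (fib Y)"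
          using False arg_min_nat_lemma[of "\<lambda>Y. Y \<in> \<C>" _ "\<lambda>Y. card (fib Y)"] by blast
        have "fib Y0 \<subseteq> Y" if "Y \<in> \<C>" for Y
        proof (cases "Y0 \<subseteq> Y")
          case False
          then have "fib Y \<subseteq> fib Y0" using chain(2)[OF Y0(1) that] by (auto simp: fib_def)
          then have "fib Y = fib Y0" using Y0 fin_fib that by (intro card_seteq) auto
          then show ?thesis by (auto simp: fib_def)
        qed (auto simp: fib_def)
        moreover have "p \<in> tuple r y ` Y0" using Y0(1) chain(1) p by (auto simp: \<Y>_def)
        ultimately show ?thesis by (auto simp: fib_def)
      qed
      moreover have "tuple r y ` \<Inter>\<C> \<subseteq> affine_space {..<r}"
        by (auto simp: affine_space_def tuple_def)
      ultimately have "tuple r y ` \<Inter>\<C> = affine_space {..<r}" by blast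
      moreover have "zariski_closed A (\<Inter>\<C>)"
        using False chain(1) by (intro zariski_closed_Inter) (auto simp: \<Y>_def)
      moreover have "\<Inter>\<C> \<subseteq> V" using False chain(1) by (auto simp: \<Y>_def)
      ultimately have "\<Inter>\<C> \<in> \<Y>" by (simp add: \<Y>_def)
      then show ?thesis by (intro bexI[of _ "\<Inter>\<C>"]) auto
    qed
  qed
  then obtain W where W: "W \<in> \<Y>" and min: "\<And>Y. Y \<in> \<Y> \<Longrightarrow> Y \<subseteq> W \<Longrightarrow> Y = W" by blast
  have W': "zariski_closed A W" "W \<subseteq> V" "tuple r y ` W = affine_space {..<r}" using W by (auto simp: \<Y>_def)
  have "irreducible_closed A W"
  proof (rule irreducible_closedI[OF W'(1)])
    have "(\<lambda>_. 0) \<in> tuple r y ` W" using W'(3) by (simp add: affine_space_def)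
    then show "W \<noteq> {}" by auto
  next
    fix P Q assume PQ: "zariski_closed A P" "zariski_closed A Q" "W \<subseteq> P \<union> Q"
    have cl: "zariski_closed {..<r} (tuple r y ` (W \<inter> R))" if "zariski_closed A R" for R
      using that W' by (intro zariski_closed_projection zariski_closed_Int) auto
    have covered: "W \<subseteq> R" if "zariski_closed A R" "affine_space {..<r} \<subseteq> tuple r y ` (W \<inter> R)" for R
    proof -
      have "W \<inter> R \<in> \<Y>" using that W' by (auto simp: \<Y>_def intro: zariski_closed_Int)
      then have "W \<inter> R = W" by (rule min) auto
      then show ?thesis by auto
    qed
    have "affine_space {..<r} \<subseteq> tuple r y ` (W \<inter> P) \<union> tuple r y ` (W \<inter> Q)"
      using PQ(3) unfolding W'(3)[symmetric] by blast
    then show "W \<subseteq> P \<or> W \<subseteq> Q"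
      using irreducible_closedD[OF irreducible_affine_space cl[OF PQ(1)] cl[OF PQ(2)]] covered PQ by blast
  qed
  then show ?thesis using W' by blast
qed

lemma alg_independent_forms:
  assumes "tuple r y ` W = affine_space {..<r}"
  shows "alg_independent_on W r y"
  unfolding alg_independent_on_def
proof (intro allI impI)
  fix g :: "(nat \<Rightarrow> 'a) \<Rightarrow> 'a" and p
  assume g: "regular {..<r} g" "\<forall>x\<in>W. g (tuple r y x) = 0"
  have "(\<lambda>k. if k \<in> {..<r} then p k else 0) \<in> tuple r y ` W"
    unfolding assms by (auto simp: affine_space_def)
  then have "g (\<lambda>k. if k \<in> {..<r} then p k else 0) = 0" using g(2) by auto
  then show "g p = 0" by (simp only: regular_restrict[OF g(1)])
qed

end

lemma minimal_projection:
  fixes V :: "('j \<Rightarrow> 'a::alg_closed_field) set"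
  assumes "finite A" "zariski_closed A V" "cone V"
  obtains y where "projected_cone A V (cone_dim A V) y"
    and "tuple (cone_dim A V) y ` V = affine_space {..<cone_dim A V}"
proof -
  obtain y where y: "\<forall>k<cone_dim A V. linear_form A (y k)"
    "\<forall>x\<in>V. (\<forall>k<cone_dim A V. y k x = 0) \<longrightarrow> x = (\<lambda>_. 0)"
    using cut_by_cone_dim[OF assms(1) zariski_closed_subset[OF assms(2)]] unfolding cut_by_def
    by (elim exE conjE) (rule that)
  have P: "projected_cone A V (cone_dim A V) y" by (rule projected_coneI[OF assms y])
  show thesis by (rule that[OF P projected_cone.projection_onto[OF P refl]])
qed

text \<open>
  The upper bound is attained at an irreducible closed subset that projects onto \<open>K\<^sup>r\<close>. The \<open>r\<close> forms are algebraically
  independent on it, and the chains above it have at most \<open>card A - r\<close> steps.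
\<close>

theorem codim_cone:
  fixes V :: "('j \<Rightarrow> 'a::alg_closed_field) set"
  assumes "finite A" "zariski_closed A V" "cone V"
  shows "codim A V = enat (card A - cone_dim A V)"
proof (rule antisym)
  show "enat (card A - cone_dim A V) \<le> codim A V"
    using assms cut_by_cone_dim[OF assms(1) zariski_closed_subset[OF assms(2)]] by (intro codim_cone_ge)
next
  let ?r = "cone_dim A V"
  obtain y where P: "projected_cone A V ?r y" and onto: "tuple ?r y ` V = affine_space {..<?r}"
    by (rule minimal_projection[OF assms])
  interpret projected_cone A V ?r y by (rule P)
  obtain W where W: "irreducible_closed A W" "W \<subseteq> V" "tuple ?r y ` W = affine_space {..<?r}"
    using irreducible_dominating_subset[OF onto] by (elim exE conjE) (rule that)
  have "codim A V \<le> codim_irreducible A W"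
    unfolding codim_def using W by (intro INF_lower) auto
  also have "\<dots> \<le> enat (card A - ?r)"
    unfolding codim_irreducible_def
  proof (rule Sup_least)
    fix l assume "l \<in> {enat n | n. \<exists>C. C 0 = W \<and> (\<forall>j\<le>n. irreducible_closed A (C j)) \<and> (\<forall>j<n. C j \<subset> C (Suc j))}"
    then obtain n C where l: "l = enat n" and C: "C 0 = W" "\<forall>j\<le>n. irreducible_closed A (C j)" "\<forall>j<n. C j \<subset> C (Suc j)"
      by (elim CollectE exE conjE) (rule that)
    have "?r + n \<le> card A"
      by (rule chain_length_bound[OF assms(1) _ regular_y C(2,3)])
        (simp_all add: C(1) alg_independent_forms[OF W(3)])
    then show "l \<le> enat (card A - ?r)" using l by simp
  qed
  finally show "codim A V \<le> enat (card A - ?r)" .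
qed

lemma cone_dim_le_card:
  assumes "finite A" "V \<subseteq> affine_space A"
  shows "cone_dim A V \<le> card A"
  using cone_dim_le[OF cut_by_card[OF assms]] .

section \<open>Formal derivatives and polarization\<close>

abbreviation expo :: "'i \<Rightarrow> 'i \<Rightarrow>\<^sub>0 nat" where
  "expo i \<equiv> single i (Suc 0)"

lemma degree_in_superset:
  "finite T \<Longrightarrow> keys m \<inter> S \<subseteq> T \<Longrightarrow> T \<subseteq> S \<Longrightarrow> degree_in S m = (\<Sum>i\<in>T. lookup m i)"
  unfolding degree_in_def by (rule sum.mono_neutral_left) (auto simp: in_keys_iff)

lemma degree_in_0 [simp]: "degree_in S 0 = 0"
  by (simp add: degree_in_def)

lemma degree_in_add: "degree_in S (m + n) = degree_in S m + degree_in S n"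
proof -
  let ?T = "(keys m \<union> keys n) \<inter> S"
  have "degree_in S u = (\<Sum>i\<in>?T. lookup u i)"
    if "keys u \<subseteq> keys m \<union> keys n" for u
    using that by (intro degree_in_superset) auto
  then show ?thesis using Poly_Mapping.keys_add[of m n] by (simp add: lookup_add sum.distrib)
qed

lemma degree_in_expo: "degree_in S (expo i) = (if i \<in> S then 1 else 0)"
  by (simp add: degree_in_def)

lemma expo_add_diff: "lookup m i \<noteq> 0 \<Longrightarrow> expo i + (m - expo i) = m"
  by (rule poly_mapping_eqI) (auto simp: lookup_add lookup_minus lookup_single when_def)

lemma monomial_induct [case_names zero add]:
  assumes "P 0" and "\<And>i m. P m \<Longrightarrow> P (expo i + m)"
  shows "P m"
proof (induction "degree_in UNIV m" arbitrary: m rule: less_induct)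
  case less
  show ?case
  proof (cases "m = 0")
    case False
    then have "\<exists>i. lookup m i \<noteq> 0" by (metis lookup_zero poly_mapping_eqI)
    then obtain i where "lookup m i \<noteq> 0" by blast
    note i = expo_add_diff[OF this]
    have "degree_in UNIV m = 1 + degree_in UNIV (m - expo i)"
      using degree_in_add[of UNIV "expo i" "m - expo i"] unfolding i by (simp add: degree_in_expo)
    then have "P (m - expo i)" by (intro less) simp
    then show ?thesis using assms(2)[of "m - expo i" i] unfolding i by simp
  qed (use assms in simp)
qed

lemma single_expo_add: "single (expo i + m) c = var i * single m (c :: 'k::comm_ring_1)"
  by (simp add: var_def mult_single)

lemma pderiv_in_superset:
  assumes "finite S" "keys p \<subseteq> S"
  shows "pderiv_in i p = (\<Sum>m\<in>S. single (m - expo i)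
    (of_nat (lookup m i) * lookup p m))"
  unfolding pderiv_in_def One_nat_def using assms by (intro sum.mono_neutral_left) (auto simp: in_keys_iff)

lemma pderiv_in_single:
  "pderiv_in i (single m c) = single (m - expo i) (of_nat (lookup m i) * c)"
  by (subst pderiv_in_superset[of "{m}"]) auto

lemma pderiv_in_add: "pderiv_in i (p + q) = pderiv_in i p + pderiv_in i q"
  using Poly_Mapping.keys_add[of p q]
  by (subst (1 2 3) pderiv_in_superset[of "keys p \<union> keys q"])
    (auto simp: lookup_add distrib_left single_add sum.distrib)

lemma pderiv_in_0 [simp]: "pderiv_in i 0 = 0"
  by (simp add: pderiv_in_def)

lemma pderiv_in_var_mult:
  fixes q :: "('i, 'k::comm_ring_1) mpoly"
  shows "pderiv_in a (var b * q) = (if a = b then q else 0) + var b * pderiv_in a q"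
proof (induction q rule: mpoly_induct)
  case (single m c)
  show ?case
  proof (cases "a = b")
    case True
    have "var a * single (m - expo a) (of_nat (lookup m a) * c) =
        single m (of_nat (lookup m a) * c)"
    proof (cases "lookup m a = 0")
      case False
      show ?thesis unfolding single_expo_add[symmetric] expo_add_diff[OF False] ..
    qed simp
    with True show ?thesis
      by (simp add: pderiv_in_single lookup_add distrib_right single_add flip: single_expo_add)
  next
    case False
    have "expo b + m - expo a = expo b + (m - expo a)"
      using False by (intro poly_mapping_eqI) (auto simp: lookup_add lookup_minus lookup_single when_def)
    with False show ?thesis
      by (simp add: pderiv_in_single lookup_add lookup_single when_def flip: single_expo_add)
  qed
qed (auto simp: pderiv_in_add distrib_left add_ac)

lemma pderiv_in_commute: "pderiv_in i (pderiv_in j p) = pderiv_in j (pderiv_in i p)"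
proof (induction p rule: mpoly_induct)
  case (single m c)
  have "m - expo j - expo i = m - expo i - expo j"
    by (rule poly_mapping_eqI) (simp add: lookup_minus)
  then show ?case
    by (cases "i = j") (simp_all add: pderiv_in_single lookup_minus lookup_single when_def mult.left_commute)
qed (simp add: pderiv_in_add)

lemma keys_pderiv_in:
  assumes "k \<in> keys (pderiv_in i p)"
  shows "expo i + k \<in> keys p"
proof -
  have "k \<in> (\<Union>m\<in>keys p. keys (single (m - expo i)
    (of_nat (lookup m i) * lookup p m)))"
    using assms unfolding pderiv_in_def One_nat_def by (rule subsetD[OF Poly_Mapping.keys_sum])
  then obtain m where m: "m \<in> keys p" "k = m - expo i"
    "of_nat (lookup m i) * lookup p m \<noteq> 0"
    by (auto split: if_splits)
  then have "lookup m i \<noteq> 0" by (intro notI) simp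
  from expo_add_diff[OF this] show ?thesis using m(1) unfolding m(2) by simp
qed

lemma polys_on_pderiv_in:
  assumes "p \<in> polys_on I"
  shows "pderiv_in i p \<in> polys_on I"
  unfolding polys_on_def
proof (intro CollectI ballI)
  fix k assume "k \<in> keys (pderiv_in i p)"
  then have "expo i + k \<in> keys p" by (rule keys_pderiv_in)
  then have "keys (expo i + k) \<subseteq> I" using assms by (auto simp: polys_on_def)
  moreover have "keys k \<subseteq> keys (expo i + k)"
    by (auto simp: in_keys_iff lookup_add)
  ultimately show "keys k \<subseteq> I" by blast
qed

lemma homogeneous_pderiv_in:
  assumes "homogeneous d p"
  shows "homogeneous (d - 1) (pderiv_in i p)"
  unfolding homogeneous_def
proof
  fix k assume "k \<in> keys (pderiv_in i p)"
  then have "expo i + k \<in> keys p" by (rule keys_pderiv_in)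
  then have "degree_in UNIV (expo i + k) = d" using assms by (auto simp: homogeneous_def)
  then show "degree_in UNIV k = d - 1" by (simp add: degree_in_add degree_in_expo)
qed

lemma eval_poly_homogeneous:
  assumes "homogeneous e p"
  shows "eval_poly \<phi> (\<lambda>i. t * x i) p = t ^ e * eval_poly \<phi> x p"
proof -
  have "(\<Prod>i\<in>keys m. (t * x i) ^ lookup m i) =
      t ^ e * (\<Prod>i\<in>keys m. x i ^ lookup m i)" if "m \<in> keys p" for m
    using assms that by (auto simp: homogeneous_def degree_in_def power_mult_distrib prod.distrib power_sum)
  then show ?thesis
    unfolding eval_poly_def sum_distrib_left by (intro sum.cong refl) (simp add: mult.left_commute)
qed

lemma euler_identity:
  assumes "coeff_hom \<phi>" "finite J" "\<forall>m\<in>keys p. (\<Sum>a\<in>J. lookup m a) = k"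
  shows "(\<Sum>a\<in>J. x a * eval_poly \<phi> x (pderiv_in a p)) = of_nat k * eval_poly \<phi> x p"
proof -
  have hom: "\<phi> (of_nat n * c) = of_nat n * \<phi> c" for n c
    using coeff_hom_of_nat[OF assms(1)] assms(1) by (simp add: coeff_hom_def)
  have summand: "x a * eval_poly \<phi> x (single (m - expo a) (of_nat (lookup m a) * c)) =
      of_nat (lookup m a) * (\<phi> c * mon x m)" for a m c
  proof (cases "lookup m a = 0")
    case True
    then show ?thesis by (simp add: eval_poly_0)
  next
    case False
    have "mon x m = x a * mon x (m - expo a)"
      using mon_add[of x "expo a" "m - expo a"] unfolding expo_add_diff[OF False] by simp
    then show ?thesis by (simp add: eval_poly_single[OF assms(1)] hom)
  qed
  have "(\<Sum>a\<in>J. x a * eval_poly \<phi> x (pderiv_in a p)) =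
      (\<Sum>a\<in>J. \<Sum>m\<in>keys p. of_nat (lookup m a) * (\<phi> (lookup p m) * mon x m))"
    unfolding pderiv_in_def One_nat_def eval_poly_sum[OF assms(1)] sum_distrib_left summand ..
  also have "\<dots> = (\<Sum>m\<in>keys p. (\<Sum>a\<in>J. of_nat (lookup m a)) * (\<phi> (lookup p m) * mon x m))"
    unfolding sum_distrib_right by (rule sum.swap)
  also have "\<dots> = (\<Sum>m\<in>keys p. of_nat k * (\<phi> (lookup p m) * mon x m))"
    using assms(3) by (intro sum.cong refl) (simp flip: of_nat_sum)
  also have "\<dots> = of_nat k * eval_poly \<phi> x p"
    unfolding eval_poly_def mon_def[symmetric] sum_distrib_left ..
  finally show ?thesis .
qed

text \<open>
  The polynomial \<open>f(v + x)\<close> on \<open>V \<times> V\<close>.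
\<close>

definition bisubst :: "('i, 'k::comm_ring_1) mpoly \<Rightarrow> ('i + 'i, 'k) mpoly" where
  "bisubst f = eval_poly const (\<lambda>i. var (Inl i) + var (Inr i)) f"

lemma bisubst_add: "bisubst (p + q) = bisubst p + bisubst q"
  and bisubst_0: "bisubst 0 = 0"
  and bisubst_var_mult: "bisubst (var i * q) = (var (Inl i) + var (Inr i)) * bisubst q"
  and bisubst_const: "bisubst (single 0 c) = single 0 c"
  by (simp_all add: bisubst_def eval_poly_add eval_poly_0 eval_poly_mult eval_poly_var eval_poly_single
      coeff_hom_const) (simp add: const_def)

lemma pderiv_in_bisubst: "pderiv_in (Inl i) (bisubst f) = bisubst (pderiv_in i f)"
proof (induction f rule: mpoly_induct)
  case (single m c)
  show ?case
  proof (induction m rule: monomial_induct)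
    case zero
    then show ?case by (simp add: bisubst_const pderiv_in_single bisubst_0)
  next
    case (add j m)
    then show ?case
      unfolding single_expo_add bisubst_var_mult pderiv_in_var_mult distrib_right pderiv_in_add bisubst_add
      by (simp add: bisubst_0 distrib_right add_ac)
  qed
qed (simp add: bisubst_add pderiv_in_add)

lemma bidegree_part_superset:
  assumes "finite S" "keys p \<subseteq> S"
  shows "bidegree_part a b p = (\<Sum>m\<in>S. if degree_in (range Inl) m = a \<and> degree_in (range Inr) m = b
    then single m (lookup p m) else 0)"
proof -
  have "bidegree_part a b p = (\<Sum>m\<in>keys p. if degree_in (range Inl) m = a \<and> degree_in (range Inr) m = b
    then single m (lookup p m) else 0)"
    unfolding bidegree_part_def by (rule sum.inter_filter) simp
  also have "\<dots> = (\<Sum>m\<in>S. if degree_in (range Inl) m = a \<and> degree_in (range Inr) m = b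
    then single m (lookup p m) else 0)"
    using assms by (intro sum.mono_neutral_left) (auto simp: in_keys_iff)
  finally show ?thesis .
qed

lemma bidegree_part_add: "bidegree_part a b (p + q) = bidegree_part a b p + bidegree_part a b q"
  using Poly_Mapping.keys_add[of p q]
  by (subst (1 2 3) bidegree_part_superset[of "keys p \<union> keys q"])
    (auto simp: lookup_add single_add sum.distrib[symmetric] intro!: sum.cong)

lemma bidegree_part_0 [simp]: "bidegree_part a b 0 = 0"
  by (simp add: bidegree_part_def)

lemma bidegree_part_single:
  "bidegree_part a b (single m c) =
    (if degree_in (range Inl) m = a \<and> degree_in (range Inr) m = b then single m c else 0)"
  by (subst bidegree_part_superset[of "{m}"]) auto

lemma pderiv_in_bidegree_part:
  "pderiv_in (Inl i) (bidegree_part (Suc a) b p) = bidegree_part a b (pderiv_in (Inl i) p)"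
proof (induction p rule: mpoly_induct)
  case (single m c)
  show ?case
  proof (cases "lookup m (Inl i) = 0")
    case True
    then show ?thesis by (simp add: bidegree_part_single pderiv_in_single)
  next
    case False
    have "degree_in S m = (if Inl i \<in> S then 1 else 0) + degree_in S (m - expo (Inl i))" for S
      using degree_in_add[of S "expo (Inl i)" "m - expo (Inl i)"]
      unfolding expo_add_diff[OF False] degree_in_expo .
    from this[of "range Inl"] this[of "range Inr"]
    have "degree_in (range Inl) m = Suc (degree_in (range Inl) (m - expo (Inl i)))"
      "degree_in (range Inr) m = degree_in (range Inr) (m - expo (Inl i))" by auto
    then show ?thesis by (simp add: bidegree_part_single pderiv_in_single)
  qed
qed (simp add: bidegree_part_add pderiv_in_add)

lemma bidegree_part_var_mult:
  fixes q :: "('i + 'j, 'k::comm_ring_1) mpoly"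
  shows "bidegree_part 0 b (var (Inl i) * q) = 0"
    and "bidegree_part a (Suc b) (var (Inr j) * q) = var (Inr j) * bidegree_part a b q"
proof -
  show "bidegree_part 0 b (var (Inl i) * q) = 0"
    by (induction q rule: mpoly_induct)
      (simp_all add: bidegree_part_single degree_in_add degree_in_expo bidegree_part_add distrib_left
        flip: single_expo_add)
  show "bidegree_part a (Suc b) (var (Inr j) * q) = var (Inr j) * bidegree_part a b q"
  proof (induction q rule: mpoly_induct)
    case (single m c)
    have "(Inr j :: 'i + 'j) \<notin> range Inl" by auto
    then show ?case
      by (simp add: bidegree_part_single degree_in_add degree_in_expo flip: single_expo_add)
  qed (simp add: bidegree_part_add distrib_left)
qed

lemma polar_bisubst: "polar a b f = bidegree_part a b (bisubst f)"
  by (simp add: polar_def bisubst_def)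

text \<open>
  A derivative with respect to \<open>v\<close> lowers the degree in \<open>v\<close> by one, and \<open>f(v + x)\<close> has the same derivatives in \<open>v\<close> as
  \<open>f\<close> has at \<open>v + x\<close>.
\<close>

lemma pderiv_in_polar: "pderiv_in (Inl i) (polar (Suc a) b f) = polar a b (pderiv_in i f)"
  by (simp add: polar_bisubst pderiv_in_bidegree_part pderiv_in_bisubst)

text \<open>
  A monomial of degree \<open>0\<close> in \<open>v\<close> arises only by choosing \<open>x\<close> in every factor \<open>v + x\<close>.
\<close>

lemma eval_polar_0:
  fixes h :: "('i, 'k::comm_ring_1) mpoly"
  assumes "coeff_hom \<phi>" "homogeneous b h"
  shows "eval_poly \<phi> (case_sum v x) (polar 0 b h) = eval_poly \<phi> x h"
proof -
  have monomial: "eval_poly \<phi> (case_sum v x) (polar 0 (degree_in UNIV m) (single m c)) =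
      eval_poly \<phi> x (single m c)" for m c
  proof (induction m rule: monomial_induct)
    case zero
    then show ?case using assms(1) by (simp add: polar_bisubst bisubst_const bidegree_part_single eval_poly_single)
  next
    case (add j m)
    have "polar 0 (degree_in UNIV (expo j + m)) (single (expo j + m) c) =
        var (Inr j) * polar 0 (degree_in UNIV m) (single m c)"
      by (simp add: polar_bisubst single_expo_add bisubst_var_mult degree_in_add degree_in_expo distrib_right
          bidegree_part_add bidegree_part_var_mult)
    then show ?case using add assms(1)
      by (simp add: eval_poly_mult eval_poly_var single_expo_add)
  qed
  have sums: "polar 0 b (\<Sum>m\<in>S. p m) = (\<Sum>m\<in>S. polar 0 b (p m))" for S and p :: "_ \<Rightarrow> ('i, 'k) mpoly"
    by (induction S rule: infinite_finite_induct)
      (auto simp: polar_bisubst bisubst_0 bisubst_add bidegree_part_add)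
  have "eval_poly \<phi> (case_sum v x) (polar 0 b h) =
      (\<Sum>m\<in>keys h. eval_poly \<phi> (case_sum v x) (polar 0 b (single m (lookup h m))))"
    by (subst mpoly_decompose[of h]) (simp add: sums eval_poly_sum[OF assms(1)])
  also have "\<dots> = (\<Sum>m\<in>keys h. eval_poly \<phi> x (single m (lookup h m)))"
    using monomial assms(2) by (intro sum.cong refl) (auto simp: homogeneous_def)
  also have "\<dots> = eval_poly \<phi> x h"
    by (subst (2) mpoly_decompose[of h]) (simp add: eval_poly_sum[OF assms(1)])
  finally show ?thesis .
qed

lemma polys_on_const: "const c \<in> polys_on I"
  and polys_on_var: "i \<in> I \<Longrightarrow> var i \<in> polys_on I"
  by (auto simp: polys_on_def const_def var_def split: if_splits)

lemma polys_on_0: "0 \<in> polys_on I"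
  by (simp add: polys_on_def)

lemma polys_on_sum: "(\<And>k. k \<in> S \<Longrightarrow> p k \<in> polys_on I) \<Longrightarrow> (\<Sum>k\<in>S. p k) \<in> polys_on I"
  by (induction S rule: infinite_finite_induct) (auto intro: polys_on_add polys_on_0)

lemma polys_on_1: "(1 :: ('i, 'k::comm_ring_1) mpoly) \<in> polys_on I"
  using polys_on_const[of "1 :: 'k"] by (simp add: const_def)

lemma polys_on_prod:
  fixes p :: "_ \<Rightarrow> ('i, 'k::comm_ring_1) mpoly"
  shows "(\<And>k. k \<in> S \<Longrightarrow> p k \<in> polys_on I) \<Longrightarrow> (\<Prod>k\<in>S. p k) \<in> polys_on I"
  by (induction S rule: infinite_finite_induct) (auto intro: polys_on_mult polys_on_1)

lemma polys_on_power:
  fixes p :: "('i, 'k::comm_ring_1) mpoly"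
  shows "p \<in> polys_on I \<Longrightarrow> p ^ n \<in> polys_on I"
  by (induction n) (auto intro: polys_on_mult polys_on_1)

lemma keys_bidegree_part:
  assumes "m \<in> keys (bidegree_part a b p)"
  shows "m \<in> keys p" "degree_in (range Inl) m = a"
proof -
  have "m \<in> (\<Union>m\<in>{m \<in> keys p. degree_in (range Inl) m = a \<and> degree_in (range Inr) m = b}.
      keys (single m (lookup p m)))"
    using assms unfolding bidegree_part_def by (rule subsetD[OF Poly_Mapping.keys_sum])
  then show "m \<in> keys p" "degree_in (range Inl) m = a" by (auto split: if_splits)
qed

lemma polys_on_polar:
  assumes "f \<in> polys_on I"
  shows "polar a b f \<in> polys_on (I <+> I)"
proof -
  have "bisubst f \<in> polys_on (I <+> I)"
    unfolding bisubst_def eval_poly_def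
  proof (intro polys_on_sum polys_on_mult polys_on_prod polys_on_power polys_on_add polys_on_const polys_on_var)
    fix m i assume "m \<in> keys f" "i \<in> keys m"
    then have "i \<in> I" using assms by (auto simp: polys_on_def)
    then show "Inl i \<in> I <+> I" "Inr i \<in> I <+> I" by auto
  qed
  then show ?thesis
    using keys_bidegree_part(1) unfolding polar_bisubst polys_on_def by blast
qed

text \<open>
  Euler's identity in \<open>v\<close> recovers a polynomial that is linear in \<open>v\<close> from its derivatives with respect to \<open>v\<close>.
\<close>

lemma eval_polar_1:
  assumes \<phi>: "coeff_hom \<phi>" and I: "finite I" and g: "g \<in> polys_on I" "homogeneous (Suc b) g"
  shows "eval_poly \<phi> (case_sum v x) (polar 1 b g) = (\<Sum>j\<in>I. v j * eval_poly \<phi> x (pderiv_in j g))"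
proof -
  have "(\<Sum>a\<in>Inl ` I. lookup m a) = 1" if "m \<in> keys (polar 1 b g)" for m
  proof -
    have "keys m \<subseteq> I <+> I" using polys_on_polar[OF g(1)] that by (auto simp: polys_on_def)
    then have "degree_in (range Inl) m = (\<Sum>a\<in>Inl ` I. lookup m a)"
      using I by (intro degree_in_superset) auto
    then show ?thesis using keys_bidegree_part(2) that unfolding polar_bisubst by metis
  qed
  then have "1 * eval_poly \<phi> (case_sum v x) (polar 1 b g) =
      (\<Sum>a\<in>Inl ` I. case_sum v x a * eval_poly \<phi> (case_sum v x) (pderiv_in a (polar 1 b g)))"
    using euler_identity[OF \<phi>, of "Inl ` I" "polar 1 b g" 1 "case_sum v x"] I by simp
  also have "\<dots> = (\<Sum>j\<in>I. v j * eval_poly \<phi> (case_sum v x) (polar 0 b (pderiv_in j g)))"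
    by (subst sum.reindex) (auto simp: pderiv_in_polar)
  also have "\<dots> = (\<Sum>j\<in>I. v j * eval_poly \<phi> x (pderiv_in j g))"
    using homogeneous_pderiv_in[OF g(2)] by (simp add: eval_polar_0[OF \<phi>])
  finally show ?thesis by simp
qed

text \<open>
  Along the line \<open>x + t v\<close>, the coefficient of \<open>t\<close> is the formal differential at \<open>x\<close> applied to \<open>v\<close>.
\<close>

lemma eval_poly_on_line:
  fixes q :: "('i, 'k::comm_ring_1) mpoly" and x v :: "'i \<Rightarrow> 'r::idom"
  assumes \<phi>: "coeff_hom \<phi>" and I: "finite I" and q: "q \<in> polys_on I" "homogeneous e q"
  shows "\<exists>p. degree p \<le> e \<and> (\<forall>t. eval_poly \<phi> (\<lambda>i. x i + t * v i) q = poly p t) \<and>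
    coeff p 1 = (\<Sum>j\<in>I. v j * eval_poly \<phi> x (pderiv_in j q))"
proof -
  define on_line where "on_line q p \<longleftrightarrow> (\<forall>t. eval_poly \<phi> (\<lambda>i. x i + t * v i) q = poly p t) \<and>
    coeff p 1 = (\<Sum>j\<in>I. v j * eval_poly \<phi> x (pderiv_in j q))" for q p
  have monomial: "\<exists>p. degree p \<le> degree_in UNIV m \<and> on_line (single m c) p"
    if "keys m \<subseteq> I" for m c
    using that
  proof (induction m rule: monomial_induct)
    case zero
    then show ?case
      by (intro exI[of _ "[:\<phi> c:]"])
        (simp add: on_line_def eval_poly_single[OF \<phi>] pderiv_in_single eval_poly_0)
  next
    case (add b m)
    have sub: "keys m \<subseteq> I" and b: "b \<in> I"
      using add.prems by (auto simp: in_keys_iff lookup_add)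
    define q where "q = single m c"
    obtain p where p: "degree p \<le> degree_in UNIV m" "on_line q p"
      using add.IH[OF sub] by (auto simp: q_def)
    have val: "poly p t = eval_poly \<phi> (\<lambda>i. x i + t * v i) q" for t using p(2) by (simp add: on_line_def)
    have "coeff p 0 = eval_poly \<phi> x q" using val[of 0] by (simp add: poly_0_coeff_0)
    moreover have "(\<Sum>j\<in>I. v j * eval_poly \<phi> x (pderiv_in j (var b * q))) =
        v b * eval_poly \<phi> x q + x b * (\<Sum>j\<in>I. v j * eval_poly \<phi> x (pderiv_in j q))"
    proof -
      have "v j * eval_poly \<phi> x (pderiv_in j (var b * q)) =
          (if j = b then v b * eval_poly \<phi> x q else 0) + x b * (v j * eval_poly \<phi> x (pderiv_in j q))" for j
        by (simp add: pderiv_in_var_mult eval_poly_add[OF \<phi>] eval_poly_mult[OF \<phi>] eval_poly_var[OF \<phi>]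
            eval_poly_0 distrib_left mult.left_commute)
      then show ?thesis using I b by (simp add: sum.distrib sum_distrib_left)
    qed
    ultimately have "on_line (var b * q) ([:x b, v b:] * p)"
      using p(2)
      by (simp add: on_line_def eval_poly_mult[OF \<phi>] eval_poly_var[OF \<phi>] coeff_pCons algebra_simps)
    moreover have "degree ([:x b, v b:] * p) \<le> degree_in UNIV (expo b + m)"
    proof -
      have "degree ([:x b, v b:] * p) \<le> degree [:x b, v b:] + degree p" by (rule degree_mult_le)
      also have "\<dots> \<le> 1 + degree_in UNIV m" using p(1) by (intro add_mono) auto
      finally show ?thesis by (simp add: degree_in_add degree_in_expo)
    qed
    ultimately show ?case unfolding single_expo_add q_def by blast
  qed
  have sum: "\<exists>p. degree p \<le> e \<and> on_line (\<Sum>m\<in>S. single m (lookup q m)) p"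
    if "S \<subseteq> keys q" "finite S" for S
    using that(2,1)
  proof (induction S rule: finite_induct)
    case empty
    then show ?case by (intro exI[of _ 0]) (simp add: on_line_def eval_poly_0)
  next
    case (insert m S)
    then obtain p where p: "degree p \<le> e" "on_line (\<Sum>m\<in>S. single m (lookup q m)) p"
      by auto
    have "keys m \<subseteq> I" "degree_in UNIV m = e"
      using q insert.prems by (auto simp: polys_on_def homogeneous_def)
    then obtain p' where p': "degree p' \<le> e" "on_line (single m (lookup q m)) p'"
      using monomial by metis
    show ?case
      using p p' insert.hyps
      by (intro exI[of _ "p' + p"])
        (simp add: on_line_def degree_add_le eval_poly_add[OF \<phi>] pderiv_in_add distrib_left sum.distrib)
  qed
  show ?thesis
    using sum[of "keys q"] unfolding mpoly_decompose[symmetric] on_line_def by simp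
qed

section \<open>The gradient cone and the Hessian cone\<close>

lemma hessian_ker_iff:
  assumes "finite I"
  shows "v \<in> hessian_ker I f x \<longleftrightarrow> v \<in> affine_space I \<and>
    (\<forall>i\<in>I. (\<Sum>j\<in>I. v j * eval_poly to_ac x (pderiv_in j (pderiv_in i f))) = 0)"
proof -
  define D where "D i = (\<Sum>j\<in>I. v j * eval_poly to_ac x (pderiv_in j (pderiv_in i f)))" for i
  have H: "hessian I f x u v = (\<Sum>i\<in>I. u i * D i)" for u
    unfolding hessian_def D_def sum_distrib_left
    by (intro sum.cong refl) (simp add: pderiv_in_commute mult_ac)
  have "(\<forall>u\<in>affine_space I. hessian I f x u v = 0) \<longleftrightarrow> (\<forall>i\<in>I. D i = 0)"
  proof
    assume *: "\<forall>u\<in>affine_space I. hessian I f x u v = 0"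
    show "\<forall>i\<in>I. D i = 0"
    proof
      fix i assume "i \<in> I"
      then have "(\<lambda>k. if k = i then 1 else 0) \<in> affine_space I" by (auto simp: affine_space_def)
      from bspec[OF * this] have "(\<Sum>k\<in>I. (if k = i then 1 else 0) * D k) = 0" unfolding H .
      then show "D i = 0" using \<open>i \<in> I\<close> assms by (simp add: if_distrib if_distribR cong: if_cong)
    qed
  qed (simp add: H)
  then show ?thesis by (auto simp: hessian_ker_def D_def)
qed

lemma case_sum_affine_space:
  "case_sum v x \<in> affine_space (I <+> I) \<longleftrightarrow> v \<in> affine_space I \<and> x \<in> affine_space I"
  by (auto simp: affine_space_def split: sum.splits)

lemma case_sum_components: "case_sum (\<lambda>i. w (Inl i)) (\<lambda>i. w (Inr i)) = w"
  by (auto simp: fun_eq_iff split: sum.splits)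

lemma Z_sym_iff:
  assumes "finite I"
  shows "case_sum v x \<in> Z_sym I f \<longleftrightarrow> v \<in> affine_space I \<and> x \<in> affine_space I \<and>
    (\<forall>i\<in>I. (\<Sum>j\<in>I. v j * eval_poly to_ac x (pderiv_in j (pderiv_in i f))) = 0)"
proof -
  have inj: "case_sum v x = case_sum v' x' \<longleftrightarrow> v = v' \<and> x = x'" for v' x'
    by (metis case_sum_expand_Inr_pointfree surjective_sum sum.case_distrib case_sum_o_inj)
  show ?thesis unfolding Z_sym_def using hessian_ker_iff[OF assms, of v f x] by (auto simp: inj)
qed

lemma Z_sym_subset: "Z_sym I f \<subseteq> affine_space (I <+> I)"
  unfolding Z_sym_def by (auto simp: case_sum_affine_space hessian_ker_def)

text \<open>
  The derivative of \<open>f\<^sup>(\<^sup>2\<^sup>,\<^sup>d\<^sup>-\<^sup>2\<^sup>)\<close> with respect to \<open>v\<^sub>i\<close> is \<open>H\<^sub>f(x)(e\<^sub>i, v)\<close>, where \<open>e\<^sub>i\<close> is the \<open>i\<close>-th unit vector.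
\<close>

lemma Sing_polar_subset_Z_sym:
  assumes "finite I" "d \<ge> 2" "f \<in> polys_on I" "homogeneous d f"
  shows "Sing (I <+> I) (polar 2 (d - 2) f) \<subseteq> Z_sym I f"
proof
  fix w assume w: "w \<in> Sing (I <+> I) (polar 2 (d - 2) f)"
  define v x where "v = (\<lambda>i. w (Inl i))" and "x = (\<lambda>i. w (Inr i))"
  have w_eq: "w = case_sum v x" unfolding v_def x_def by (simp only: case_sum_components)
  have "(\<Sum>j\<in>I. v j * eval_poly to_ac x (pderiv_in j (pderiv_in i f))) = 0" if "i \<in> I" for i
  proof -
    have "homogeneous (Suc (d - 2)) (pderiv_in i f)"
      using homogeneous_pderiv_in[OF assms(4), of i] Suc_diff_le[OF assms(2)] by (simp add: numeral_2_eq_2)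
    then have "(\<Sum>j\<in>I. v j * eval_poly to_ac x (pderiv_in j (pderiv_in i f))) =
        eval_poly to_ac w (polar 1 (d - 2) (pderiv_in i f))"
      unfolding w_eq by (intro eval_polar_1[symmetric] coeff_hom_to_ac assms polys_on_pderiv_in)
    also have "\<dots> = eval_poly to_ac w (pderiv_in (Inl i) (polar 2 (d - 2) f))"
      using pderiv_in_polar[of i 1 "d - 2" f] by (simp add: numeral_2_eq_2)
    also have "\<dots> = 0" using w that by (auto simp: Sing_def)
    finally show ?thesis .
  qed
  moreover have "v \<in> affine_space I \<and> x \<in> affine_space I"
    using w unfolding Sing_def w_eq by (simp add: case_sum_affine_space)
  ultimately show "w \<in> Z_sym I f" unfolding w_eq Z_sym_iff[OF assms(1)] by blast
qed

lemma zariski_closed_Sing: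
  assumes "f \<in> polys_on I"
  shows "zariski_closed I (Sing I f)"
  unfolding zariski_closed_iff_regular Sing_def
  using assms by (intro exI[of _ "(\<lambda>i x. eval_poly to_ac x (pderiv_in i f)) ` I"])
    (auto intro: regular_eval_poly polys_on_pderiv_in)

lemma cone_Sing:
  assumes "d \<ge> 2" "homogeneous d f"
  shows "cone (Sing I f)"
proof -
  have scale: "eval_poly to_ac (\<lambda>i. t * x i) (pderiv_in j f) = t ^ (d - 1) * eval_poly to_ac x (pderiv_in j f)"
    for t x j by (intro eval_poly_homogeneous homogeneous_pderiv_in assms)
  have "eval_poly to_ac (\<lambda>_. 0) (pderiv_in j f) = 0" for j
    using scale[of 0 "\<lambda>_. 0" j] assms(1) by (simp add: power_0_left)
  then show ?thesis by (auto simp: cone_def Sing_def affine_space_def scale)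
qed

lemma zariski_closed_Z_sym:
  assumes "finite I" "f \<in> polys_on I"
  shows "zariski_closed (I <+> I) (Z_sym I f)"
proof -
  define e where "e i w = (\<Sum>j\<in>I. w (Inl j) * eval_poly to_ac (\<lambda>k. w (Inr k)) (pderiv_in j (pderiv_in i f)))"
    for i and w :: "'a + 'a \<Rightarrow> 'b alg_closure"
  have "regular (I <+> I) (e i)" for i
  proof -
    have "regular (I <+> I) (\<lambda>w. eval_poly to_ac (\<lambda>k. w (Inr k)) (pderiv_in j (pderiv_in i f)))" for j
    proof -
      have "regular I (\<lambda>x. eval_poly to_ac x (pderiv_in j (pderiv_in i f)))"
        by (intro regular_eval_poly polys_on_pderiv_in assms)
      then show ?thesis by (rule regular_compose) (auto intro: regular_coord)
    qed
    then show ?thesis unfolding e_def by (intro regular_sum regular_mult regular_coord) auto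
  qed
  moreover have "Z_sym I f = {w \<in> affine_space (I <+> I). \<forall>g\<in>e ` I. g w = 0}"
  proof (rule Set.set_eqI)
    fix w :: "'a + 'a \<Rightarrow> 'b alg_closure"
    show "w \<in> Z_sym I f \<longleftrightarrow> w \<in> {w \<in> affine_space (I <+> I). \<forall>g\<in>e ` I. g w = 0}"
      using Z_sym_iff[OF assms(1), of "\<lambda>i. w (Inl i)" "\<lambda>i. w (Inr i)" f]
        case_sum_affine_space[of "\<lambda>i. w (Inl i)" "\<lambda>i. w (Inr i)" I]
      unfolding case_sum_components e_def by simp
  qed
  ultimately show ?thesis unfolding zariski_closed_iff_regular by (intro exI[of _ "e ` I"]) blast
qed

lemma cone_Z_sym:
  assumes "finite I" "homogeneous d f"
  shows "cone (Z_sym I f)"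
proof -
  have scale: "eval_poly to_ac (\<lambda>i. t * x i) (pderiv_in j (pderiv_in i f)) =
      t ^ (d - 1 - 1) * eval_poly to_ac x (pderiv_in j (pderiv_in i f))" for t x i j
    by (intro eval_poly_homogeneous homogeneous_pderiv_in assms)
  show ?thesis
    unfolding cone_def
  proof (intro conjI ballI allI)
    have "case_sum (\<lambda>_. 0) (\<lambda>_. 0) \<in> Z_sym I f"
      unfolding Z_sym_iff[OF assms(1)] by (simp add: affine_space_def)
    moreover have "case_sum (\<lambda>_. 0) (\<lambda>_. 0) = (\<lambda>_. 0)" by (auto simp: fun_eq_iff split: sum.splits)
    ultimately show "(\<lambda>_. 0) \<in> Z_sym I f" by simp
  next
    fix w t assume "w \<in> Z_sym I f"
    then obtain v x where w: "w = case_sum v x" "case_sum v x \<in> Z_sym I f" by (auto simp: Z_sym_def)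
    have "(\<Sum>j\<in>I. t * v j * (t ^ (d - 1 - 1) * eval_poly to_ac x (pderiv_in j (pderiv_in i f)))) =
        t * t ^ (d - 1 - 1) * (\<Sum>j\<in>I. v j * eval_poly to_ac x (pderiv_in j (pderiv_in i f)))" for i
      unfolding sum_distrib_left by (intro sum.cong refl) (simp add: mult_ac)
    then have "case_sum (\<lambda>i. t * v i) (\<lambda>i. t * x i) \<in> Z_sym I f"
      using w(2) unfolding Z_sym_iff[OF assms(1)] scale by (auto simp: affine_space_def)
    moreover have "(\<lambda>b. t * w b) = case_sum (\<lambda>i. t * v i) (\<lambda>i. t * x i)"
      by (auto simp: w fun_eq_iff split: sum.splits)
    ultimately show "(\<lambda>b. t * w b) \<in> Z_sym I f" by simp
  qed
qed

lemma linear_form_compose: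
  assumes l: "linear_form B l" and G: "\<And>i. i \<in> B \<Longrightarrow> linear_form A (G i)"
  shows "linear_form A (\<lambda>x. l (\<lambda>i. G i x))"
proof -
  have "polyfun A (1 * 1) (\<lambda>x. l (\<lambda>i. G i x))"
    using l G by (intro polyfun_compose) (auto simp: linear_form_def)
  moreover have "l (\<lambda>i. G i (\<lambda>j. t * x j)) = t * l (\<lambda>i. G i x)" for t x
  proof -
    have "l (\<lambda>i. G i (\<lambda>j. t * x j)) = l (\<lambda>i. t * G i x)"
      using l G by (intro polyfun_cong_on[of B 1 l]) (auto simp: linear_form_def homog_fun_def)
    also have "\<dots> = t * l (\<lambda>i. G i x)" using l by (simp add: linear_form_def homog_fun_def)
    finally show ?thesis .
  qed
  ultimately show ?thesis by (simp add: linear_form_def homog_fun_def)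
qed

text \<open>
  As \<open>d - 1\<close> is invertible, Euler's identity \<open>H\<^sub>f(x)(u, x) = (d - 1) \<partial>\<^sub>u f(x)\<close> shows that the singular cone is the
  intersection of \<open>Z\<close> with the diagonal.
  The diagonal is cut out by \<open>dim V\<close> linear forms.
\<close>

lemma cone_dim_Z_sym_le:
  fixes f :: "('i, 'k::field) mpoly"
  assumes I: "finite I" and d: "d \<ge> 2" and f: "f \<in> polys_on I" "homogeneous d f" and char: "\<not> CHAR('k) dvd d - 1"
  shows "cone_dim (I <+> I) (Z_sym I f) \<le> card I + cone_dim I (Sing I f)"
proof -
  let ?r = "cone_dim I (Sing I f)"
  obtain y where y: "\<forall>k<?r. linear_form I (y k)" "\<forall>x\<in>Sing I f. (\<forall>k<?r. y k x = 0) \<longrightarrow> x = (\<lambda>_. 0)"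
    using cut_by_cone_dim[OF I zariski_closed_subset[OF zariski_closed_Sing[OF f(1)]]] unfolding cut_by_def
    by (elim exE conjE) (rule that)
  define Y where "Y = case_sum (\<lambda>i w. w (Inl i) - w (Inr i)) (\<lambda>k w. y k (\<lambda>i. w (Inr i)))"
  have "cut_by (I <+> I) (Z_sym I f) (card (I <+> {..<?r}))"
  proof (rule cut_by_family[where y = Y])
    fix k assume k: "k \<in> I <+> {..<?r}"
    show "linear_form (I <+> I) (Y k)"
    proof (cases k)
      case (Inl i)
      then have "linear_form (I <+> I) (\<lambda>w. 1 * w (Inl i) - 1 * w (Inr i))"
        using k by (intro linear_form_diff linear_form_coord) auto
      then show ?thesis by (simp add: Y_def Inl)
    next
      case (Inr j)
      then have "linear_form I (y j)" using k y(1) by auto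
      then have "linear_form (I <+> I) (\<lambda>w. y j (\<lambda>i. w (Inr i)))"
        by (rule linear_form_compose) (auto intro: linear_form_coord)
      then show ?thesis by (simp add: Y_def Inr)
    qed
  next
    fix w assume w: "w \<in> Z_sym I f" "\<forall>k\<in>I <+> {..<?r}. Y k w = 0"
    define v x where "v = (\<lambda>i. w (Inl i))" and "x = (\<lambda>i. w (Inr i))"
    have w_eq: "w = case_sum v x" unfolding v_def x_def by (simp only: case_sum_components)
    have Z: "v \<in> affine_space I" "x \<in> affine_space I"
      "\<And>i. i \<in> I \<Longrightarrow> (\<Sum>j\<in>I. v j * eval_poly to_ac x (pderiv_in j (pderiv_in i f))) = 0"
      using w(1) unfolding w_eq Z_sym_iff[OF I] by auto
    have "v i = x i" for i
    proof (cases "i \<in> I")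
      case True
      then have "Y (Inl i) w = 0" using w(2) by blast
      then show ?thesis by (simp add: Y_def v_def x_def)
    qed (use Z in \<open>auto simp: affine_space_def\<close>)
    then have "v = x" by auto
    have "eval_poly to_ac x (pderiv_in i f) = 0" if "i \<in> I" for i
    proof -
      have "(\<Sum>a\<in>I. lookup m a) = d - 1" if m: "m \<in> keys (pderiv_in i f)" for m
      proof -
        have "keys m \<subseteq> I" using polys_on_pderiv_in[OF f(1)] m by (auto simp: polys_on_def)
        then have "degree_in UNIV m = (\<Sum>a\<in>I. lookup m a)"
          unfolding degree_in_def using I by (intro sum.mono_neutral_left) (auto simp: in_keys_iff)
        then show ?thesis using homogeneous_pderiv_in[OF f(2), of i] m by (auto simp: homogeneous_def)
      qed
      then have "(\<Sum>a\<in>I. x a * eval_poly to_ac x (pderiv_in a (pderiv_in i f))) =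
          of_nat (d - 1) * eval_poly to_ac x (pderiv_in i f)"
        by (intro euler_identity coeff_hom_to_ac I) blast
      then have "of_nat (d - 1) * eval_poly to_ac x (pderiv_in i f) = 0"
        using Z(3)[OF that] \<open>v = x\<close> by simp
      moreover have "(of_nat (d - 1) :: 'k alg_closure) \<noteq> 0"
      proof
        assume "(of_nat (d - 1) :: 'k alg_closure) = 0"
        then have "to_ac (of_nat (d - 1) :: 'k) = 0" by (simp only: to_ac_of_nat)
        then have "(of_nat (d - 1) :: 'k) = 0" by (simp only: to_ac_eq_0_iff)
        then show False using char by (simp only: of_nat_eq_0_iff_char_dvd)
      qed
      ultimately show ?thesis by simp
    qed
    then have "x \<in> Sing I f" using Z(2) by (simp add: Sing_def)
    moreover have "\<forall>k<?r. y k x = 0"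
    proof (intro allI impI)
      fix k assume "k < ?r"
      then have "Y (Inr k) w = 0" using w(2) by blast
      then show "y k x = 0" by (simp add: Y_def x_def)
    qed
    ultimately have "x = (\<lambda>_. 0)" using y(2) by blast
    then show "w = (\<lambda>_. 0)" unfolding w_eq \<open>v = x\<close> by (auto simp: fun_eq_iff split: sum.splits)
  qed (use I in auto)
  then show ?thesis using I by (intro cone_dim_le) (simp add: card_Plus)
qed

text \<open>
  The gradient along the line \<open>x + t v\<close> has degree at most \<open>d - 1\<close> in \<open>t\<close>, so that it vanishes identically as soon as it
  vanishes for \<open>d\<close> values of \<open>t\<close>. Its linear coefficient is \<open>H\<^sub>f(x)(\<cdot>, v)\<close>.
\<close>

lemma Z_sym_of_singular_points_on_line:
  fixes f :: "('i, 'k::field) mpoly"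
  assumes I: "finite I" and f: "f \<in> polys_on I" "homogeneous d f" and "v \<in> affine_space I" "x \<in> affine_space I"
    and t: "d \<ge> 1" "inj_on t {..<d}" "\<And>k. k < d \<Longrightarrow> (\<lambda>i. x i + t k * v i) \<in> Sing I f"
  shows "case_sum v x \<in> Z_sym I f"
  unfolding Z_sym_iff[OF I]
proof (intro conjI ballI)
  fix i assume i: "i \<in> I"
  obtain p where p: "degree p \<le> d - 1" "\<forall>s. eval_poly to_ac (\<lambda>i. x i + s * v i) (pderiv_in i f) = poly p s"
    "coeff p 1 = (\<Sum>j\<in>I. v j * eval_poly to_ac x (pderiv_in j (pderiv_in i f)))"
    using eval_poly_on_line[OF coeff_hom_to_ac I polys_on_pderiv_in[OF f(1), of i]
        homogeneous_pderiv_in[OF f(2), of i], of x v]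
    by (elim exE conjE) (rule that)
  have "p = 0"
  proof (rule ccontr)
    assume "p \<noteq> 0"
    have "poly p (t k) = 0" if "k < d" for k
      using t(3)[OF that] i unfolding p(2)[rule_format, symmetric] by (simp add: Sing_def)
    then have "card (t ` {..<d}) \<le> card {s. poly p s = 0}"
      using \<open>p \<noteq> 0\<close> by (intro card_mono poly_roots_finite) auto
    also have "\<dots> \<le> degree p" using \<open>p \<noteq> 0\<close> by (rule card_poly_roots_bound)
    finally show False using p(1) t(1,2) by (simp add: card_image)
  qed
  then show "(\<Sum>j\<in>I. v j * eval_poly to_ac x (pderiv_in j (pderiv_in i f))) = 0"
    unfolding p(3)[symmetric] by simp
qed (use assms in auto)

text \<open>
  The points \<open>w\<^sub>0, \<dots>, w\<^sub>d\<^sub>-\<^sub>1\<close> of the singular cone that have the form \<open>w\<^sub>k = x + t\<^sub>k v\<close> are cut out from its \<open>d\<close>-th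
  power by \<open>d - 2\<close> vector equations, and \<open>(v, x)\<close> then lies in \<open>Z\<close>. Forms that cut \<open>Z\<close> down to \<open>0\<close> thus give forms that
  cut the power down to \<open>0\<close>, while the power has dimension at least \<open>d\<close> times that of the singular cone, because it
  projects onto \<open>(K\<^sup>r)\<^sup>d\<close>.
\<close>

lemma cone_dim_Sing_times_le:
  fixes f :: "('i, 'k::field) mpoly"
  assumes I: "finite I" and d: "d \<ge> 2" and f: "f \<in> polys_on I" "homogeneous d f"
  shows "cone_dim I (Sing I f) * d \<le> cone_dim (I <+> I) (Z_sym I f) + card I * (d - 2)"
proof -
  let ?S = "Sing I f" and ?r = "cone_dim I (Sing I f)" and ?q = "cone_dim (I <+> I) (Z_sym I f)"
  let ?A = "I \<times> {..<d}"
  have S: "zariski_closed I ?S" "cone ?S" by (rule zariski_closed_Sing[OF f(1)], rule cone_Sing[OF d f(2)])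
  obtain t :: "nat \<Rightarrow> 'k alg_closure" where t: "inj_on t {..<d}"
    using infinite_countable_subset[OF alg_closed_field_infinite] by (meson inj_on_subset subset_UNIV)
  define slice where "slice w k = (\<lambda>i. w (i, k))" for w :: "'i \<times> nat \<Rightarrow> 'k alg_closure" and k
  define P where "P = {w \<in> affine_space ?A. \<forall>k<d. slice w k \<in> ?S}"
  have slice_affine: "slice w k \<in> affine_space I" if "w \<in> affine_space ?A" for w k
    using that by (auto simp: slice_def affine_space_def)
  have P_closed: "zariski_closed ?A P"
  proof (rule zariski_closedI)
    fix w assume w: "w \<in> affine_space ?A" "w \<notin> P"
    then obtain k where k: "k < d" "slice w k \<notin> ?S" by (auto simp: P_def)
    obtain g where g: "regular I g" "\<forall>x\<in>?S. g x = 0" "g (slice w k) \<noteq> 0"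
      using zariski_closedD[OF S(1) slice_affine[OF w(1)] k(2)] by (elim exE conjE) (rule that)
    have "regular ?A (\<lambda>w. g (\<lambda>i. w (i, k)))"
      using g(1) by (rule regular_compose) (use k(1) in \<open>auto intro: regular_coord\<close>)
    then show "\<exists>g. regular ?A g \<and> (\<forall>x\<in>P. g x = 0) \<and> g w \<noteq> 0"
      using g k(1) by (intro exI[of _ "\<lambda>w. g (slice w k)"]) (auto simp: slice_def P_def)
  qed (auto simp: P_def)
  have P_cone: "cone P"
    using S(2) by (auto simp: cone_def P_def slice_def affine_space_def)
  obtain z where z: "\<forall>k<?q. linear_form (I <+> I) (z k)"
    "\<forall>w\<in>Z_sym I f. (\<forall>k<?q. z k w = 0) \<longrightarrow> w = (\<lambda>_. 0)"
    using cut_by_cone_dim[OF finite_Plus[OF I I] Z_sym_subset[of I f]] unfolding cut_by_def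
    by (elim exE conjE) (rule that)
  \<comment> \<open>the solution of \<open>w\<^sub>0 = x + t\<^sub>0 v\<close> and \<open>w\<^sub>1 = x + t\<^sub>1 v\<close>\<close>
  define a where "a = inverse (t 1 - t 0)"
  have "t 1 - t 0 \<noteq> 0" using inj_onD[OF t, of 1 0] d by auto
  then have a: "(t 1 - t 0) * a = 1" by (simp add: a_def)
  define v where "v i w = a * w (i, 1) - a * w (i, 0)" for i :: 'i and w :: "'i \<times> nat \<Rightarrow> 'k alg_closure"
  define x where "x i w = 1 * w (i, 0) - t 0 * v i w" for i and w :: "'i \<times> nat \<Rightarrow> 'k alg_closure"
  have vx: "linear_form ?A (v i)" "linear_form ?A (x i)" if "i \<in> I" for i
  proof -
    show lv: "linear_form ?A (v i)"
      unfolding v_def using that d by (intro linear_form_diff linear_form_coord) auto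
    then show "linear_form ?A (x i)"
      unfolding x_def using that d by (intro linear_form_diff linear_form_coord) auto
  qed
  define Y where "Y = case_sum (\<lambda>k w. z k (\<lambda>b. case_sum (\<lambda>i. v i w) (\<lambda>i. x i w) b))
    (\<lambda>ik w. 1 * w ik - 1 * (1 * x (fst ik) w - (- t (snd ik)) * v (fst ik) w))"
  have "cut_by ?A P (card ({..<?q} <+> I \<times> {2..<d}))"
  proof (rule cut_by_family[where y = Y])
    fix b assume b: "b \<in> {..<?q} <+> I \<times> {2..<d}"
    show "linear_form ?A (Y b)"
    proof (cases b)
      case (Inl k)
      define G where "G c w = case_sum (\<lambda>i. v i w) (\<lambda>i. x i w) c" for c w
      have G: "linear_form ?A (G c)" if "c \<in> I <+> I" for c
        using that vx by (auto simp: G_def[abs_def])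
      have "linear_form (I <+> I) (z k)" using b Inl z(1) by auto
      from linear_form_compose[OF this G] have "linear_form ?A (\<lambda>w. z k (\<lambda>c. G c w))" .
      then show ?thesis by (simp add: Y_def Inl G_def)
    next
      case (Inr ik)
      then have "linear_form ?A (\<lambda>w. 1 * w ik - 1 * (1 * x (fst ik) w - (- t (snd ik)) * v (fst ik) w))"
        using b by (intro linear_form_diff linear_form_coord vx) auto
      then show ?thesis by (simp only: Y_def Inr sum.case)
    qed
  next
    fix w assume w: "w \<in> P" "\<forall>b\<in>{..<?q} <+> I \<times> {2..<d}. Y b w = 0"
    have w_affine: "w \<in> affine_space ?A" using w(1) by (simp add: P_def)
    define v' x' where "v' = (\<lambda>i. v i w)" and "x' = (\<lambda>i. x i w)"
    have aff: "v' \<in> affine_space I" "x' \<in> affine_space I"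
      using w_affine by (auto simp: v'_def x'_def v_def x_def affine_space_def)
    have on_line: "w (i, k) = x' i + t k * v' i" if "k < d" for i k
    proof (cases "i \<in> I")
      case True
      have "k = 0 \<or> k = 1 \<or> k \<in> {2..<d}" using that by auto
      then consider "k = 0" | "k = 1" | "k \<in> {2..<d}" by blast
      then show ?thesis
      proof cases
        case 2
        have "x' i + t 1 * v' i = w (i, 0) + ((t 1 - t 0) * a) * (w (i, 1) - w (i, 0))"
          by (simp add: x'_def v'_def x_def v_def algebra_simps)
        then show ?thesis unfolding a 2 by simp
      next
        case 3
        then have "Y (Inr (i, k)) w = 0" using w(2) True by blast
        then show ?thesis by (simp add: Y_def x'_def v'_def)
      qed (simp add: x'_def v'_def x_def)
    qed (use aff w_affine in \<open>auto simp: affine_space_def\<close>)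
    have "case_sum v' x' \<in> Z_sym I f"
    proof (rule Z_sym_of_singular_points_on_line[OF I f aff _ t])
      fix k assume "k < d"
      then have "slice w k \<in> ?S" using w(1) by (simp add: P_def)
      moreover have "slice w k = (\<lambda>i. x' i + t k * v' i)"
        using on_line[OF \<open>k < d\<close>] by (auto simp: slice_def)
      ultimately show "(\<lambda>i. x' i + t k * v' i) \<in> ?S" by simp
    qed (use d in simp)
    moreover have "\<forall>k<?q. z k (case_sum v' x') = 0"
    proof (intro allI impI)
      fix k assume "k < ?q"
      then have "Y (Inl k) w = 0" using w(2) by blast
      then show "z k (case_sum v' x') = 0" by (simp add: Y_def v'_def x'_def)
    qed
    ultimately have zero: "case_sum v' x' = (\<lambda>_. 0)" using z(2) by blast
    have "v' i = 0" "x' i = 0" for i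
      using fun_cong[OF zero, of "Inl i"] fun_cong[OF zero, of "Inr i"] by simp_all
    then have w_0: "w (i, k) = 0" if "k < d" for i k using on_line[OF that] by simp
    show "w = (\<lambda>_. 0)"
    proof
      fix ik
      show "w ik = 0"
        using w_0[of "snd ik" "fst ik"] w_affine
        by (cases ik, cases "snd ik < d") (auto simp: affine_space_def)
    qed
  qed (use I in auto)
  then have "cut_by ?A P (?q + card I * (d - 2))"
    using I by (simp add: card_Plus card_cartesian_product)
  then obtain u where u: "\<forall>k<?q + card I * (d - 2). linear_form ?A (u k)"
    "\<forall>x\<in>P. (\<forall>k<?q + card I * (d - 2). u k x = 0) \<longrightarrow> x = (\<lambda>_. 0)"
    unfolding cut_by_def by (elim exE conjE) (rule that)
  have growth: "growth_le ?A P (?q + card I * (d - 2))"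
    by (rule projected_cone.growth_le_V[OF projected_coneI[OF _ P_closed P_cone u]]) (use I in simp)
  obtain y where y: "projected_cone I ?S ?r y" "tuple ?r y ` ?S = affine_space {..<?r}"
    by (rule minimal_projection[OF I S])
  interpret projected_cone I ?S ?r y by (rule y(1))
  \<comment> \<open>the index \<open>l = k r + j\<close> stands for the \<open>j\<close>-th form on the \<open>k\<close>-th factor\<close>
  define F where "F l w = y (l mod ?r) (slice w (l div ?r))" for l w
  have div_mod: "l mod ?r < ?r" "l div ?r < d" if "l < ?r * d" for l
  proof -
    have "?r > 0" using that by (cases "?r = 0") auto
    then show "l mod ?r < ?r" by simp
    show "l div ?r < d" using that by (simp add: less_mult_imp_div_less mult.commute)
  qed
  have F_regular: "regular ?A (F l)" if "l < ?r * d" for l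
  proof -
    have "regular ?A (\<lambda>w. y (l mod ?r) (\<lambda>i. w (i, l div ?r)))"
      by (rule regular_compose[OF regular_y[OF div_mod(1)[OF that]]])
        (use div_mod(2)[OF that] in \<open>auto intro: regular_coord\<close>)
    then show ?thesis by (simp add: F_def[abs_def] slice_def)
  qed
  have "alg_independent_on P (?r * d) F"
    unfolding alg_independent_on_def
  proof (intro allI impI)
    fix g :: "(nat \<Rightarrow> 'k alg_closure) \<Rightarrow> 'k alg_closure" and p :: "nat \<Rightarrow> 'k alg_closure"
    assume g: "regular {..<?r * d} g" "\<forall>w\<in>P. g (tuple (?r * d) F w) = 0"
    define block where "block k = (\<lambda>j. if j < ?r then p (k * ?r + j) else 0)" for k
    have "block k \<in> tuple ?r y ` ?S" for k
      unfolding y(2) by (simp add: affine_space_def block_def)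
    then have "\<exists>u. u \<in> ?S \<and> tuple ?r y u = block k" for k by (metis imageE)
    then obtain s where s: "\<And>k. s k \<in> ?S" "\<And>k. tuple ?r y (s k) = block k" by metis
    define w where "w = (\<lambda>(i, k). if k < d then s k i else 0)"
    have slice_w: "slice w k = s k" if "k < d" for k using that by (simp add: slice_def w_def)
    have "s k i = 0" if "i \<notin> I" for i k
      using s(1)[of k] that by (auto simp: Sing_def affine_space_def)
    then have "w \<in> P" using s(1) slice_w by (auto simp: P_def affine_space_def w_def)
    have "tuple (?r * d) F w l = p l" if "l < ?r * d" for l
    proof -
      have "F l w = tuple ?r y (s (l div ?r)) (l mod ?r)"
        using div_mod[OF that] by (simp add: F_def slice_w tuple_def)
      also have "\<dots> = p l" using div_mod[OF that] by (simp add: s(2) block_def div_mult_mod_eq)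
      finally show ?thesis using that by (simp add: tuple_def)
    qed
    then have "g (tuple (?r * d) F w) = g p" by (intro regular_cong_on[OF g(1)]) auto
    then show "g p = 0" using g(2) \<open>w \<in> P\<close> by simp
  qed
  then show ?thesis using alg_independent_le_growth[OF growth _ F_regular] by simp
qed

section \<open>Comparison of the two codimensions\<close>

theorem proposition3p1:
  fixes I :: "'i set" and f :: "('i, 'k::field) mpoly" and d :: nat
  assumes "finite I" and "d \<ge> 2"
    and "f \<in> polys_on I" and "homogeneous d f"
  shows "Sing (I <+> I) (polar 2 (d - 2) f) \<subseteq> Z_sym I f \<and>
    g_sym I f \<le> enat (d + 1) * codim_Sing I f \<and>
    (odd d \<and> CHAR('k) \<noteq> 2 \<longrightarrow> g_sym I f \<le> enat d * codim_Sing I f) \<and>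
    (\<not> CHAR('k) dvd d - 1 \<longrightarrow> codim_Sing I f \<le> g_sym I f)"
proof -
  let ?n = "card I" and ?r = "cone_dim I (Sing I f)" and ?q = "cone_dim (I <+> I) (Z_sym I f)"
  have S: "zariski_closed I (Sing I f)" "cone (Sing I f)"
    by (rule zariski_closed_Sing[OF assms(3)], rule cone_Sing[OF assms(2,4)])
  have c: "codim_Sing I f = enat (?n - ?r)"
    unfolding codim_Sing_def by (rule codim_cone[OF assms(1) S])
  have "g_sym I f = enat (card (I <+> I) - ?q)"
    unfolding g_sym_def
    by (rule codim_cone[OF finite_Plus[OF assms(1,1)] zariski_closed_Z_sym[OF assms(1,3)] cone_Z_sym[OF assms(1,4)]])
  then have g: "g_sym I f = enat (2 * ?n - ?q)" using assms(1) by (simp add: card_Plus mult_2)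
  have "?r \<le> ?n" by (rule cone_dim_le_card[OF assms(1) zariski_closed_subset[OF S(1)]])
  moreover have "?r * d \<le> ?q + ?n * (d - 2)" by (rule cone_dim_Sing_times_le[OF assms])
  moreover have "?n * d = ?n * 2 + ?n * (d - 2)"
    using le_Suc_ex[OF assms(2)] by (auto simp: distrib_left)
  ultimately have "2 * ?n - ?q \<le> d * (?n - ?r)"
    by (simp add: diff_mult_distrib2 mult.commute)
  then have upper: "g_sym I f \<le> enat d * codim_Sing I f" by (simp add: g c)
  also have "\<dots> \<le> enat (d + 1) * codim_Sing I f" by (simp add: c)
  finally have "g_sym I f \<le> enat (d + 1) * codim_Sing I f" .
  moreover have "codim_Sing I f \<le> g_sym I f" if "\<not> CHAR('k) dvd d - 1"
    using cone_dim_Z_sym_le[OF assms that] by (simp add: g c)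
  ultimately show ?thesis using upper Sing_polar_subset_Z_sym[OF assms] by blast
qed

end
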